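(* In the localized double affine Hecke algebra $\widetilde H_{\mathrm{loc}}$ the Hecke symmetrizers $\varepsilon_+,\varepsilon_-,\varepsilon_\pm,\varepsilon_\mp$ satisfy \begin{align*} \chi^+(T_{w_0})\,\varepsilon_+ &= e_+^X\,\kappa_{\mathrm{st}}^{X^{-1}}\kappa_{\mathrm{dr}}^{X^{-1}} = e_+^Y\,\kappa_{\mathrm{st}}^{Y}\kappa_{\mathrm{dr}}^{Y},\\ \chi^+(T_{w_0})\,\varepsilon_- &= \kappa_{\mathrm{st}}^{X}\kappa_{\mathrm{dr}}^{X}\,e_-^X = \kappa_{\mathrm{st}}^{Y^{-1}}\kappa_{\mathrm{dr}}^{Y^{-1}}\,e_-^Y,\\ \chi^+(T_{w_0})\,\varepsilon_\pm &= \kappa_{\mathrm{dr}}^{X}\,e_\pm^X\,\kappa_{\mathrm{st}}^{X^{-1}} = \kappa_{\mathrm{dr}}^{Y^{-1}}\,e_\pm^Y\,\kappa_{\mathrm{st}}^{Y},\\ \chi^+(T_{w_0})\,\varepsilon_\mp &= \kappa_{\mathrm{st}}^{X}\,e_\mp^X\,\kappa_{\mathrm{dr}}^{X^{-1}} = \kappa_{\mathrm{st}}^{Y^{-1}}\,e_\mp^Y\,\kappa_{\mathrm{dr}}^{Y}. \end{align*}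
   Context: Let $n\ge 1$ and $\mathbb K=\mathbb C(q^{1/2},t^{1/2},t_0^{1/2},u_0^{1/2},t_n^{1/2},u_n^{1/2})$, with independent parameters. **Lattices and reflections.** Let $Q=\mathbb Z\text{-span}\{\varepsilon_1,\dots,\varepsilon_n,\tfrac12\delta\}$ and $Q^\vee=\mathbb Z\text{-span}\{\varepsilon_1^\vee,\dots,\varepsilon_n^\vee,\tfrac12K\}$. On $Q$: $s_i$ ($1\le i\le n-1$) swaps $\varepsilon_i,\varepsilon_{i+1}$; $s_n$ sends $\varepsilon_n\mapsto-\varepsilon_n$; $s_0$ sends $\varepsilon_1\mapsto-\varepsilon_1+\delta$; all other basis elements are fixed. The same formulas with $\varepsilon_i^\vee,K$ in place of $\varepsilon_i,\delta$ define the action on $Q^\vee$. $W_{\mathrm{fin}}$ is the group generated by $s_1,\dots,s_n$ (signed permutations). $w_0$ is its longest element. For $w\in W_{\mathrm{fin}}$, $\ell_s(w)$ (resp. $\ell_d(w)$) is the number of factors $s_i$ with $i<n$ (resp. factors $s_n$) in a reduced word of $w$. Simple roots: $\alpha_0=-\varepsilon_1+\tfrac12\delta$, $\alpha_i=\varepsilon_i-\varepsilon_{i+1}$ ($1\le i<n$), $\alpha_n=\varepsilon_n$; simple coroots: $\alpha_0^\vee=-\varepsilon_1^\vee+\tfrac12K$, $\alpha_i^\vee=\varepsilon_i^\vee-\varepsilon_{i+1}^\vee$, $\alpha_n^\vee=\varepsilon_n^\vee$. Parameters: $t_{\alpha_0}=t_0,u_{\alpha_0}=u_0$; $t_{\alpha_n}=t_n,u_{\alpha_n}=u_n$;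 $t_{\alpha_0^\vee}=u_n,u_{\alpha_0^\vee}=u_0$; $t_{\alpha_n^\vee}=t_n,u_{\alpha_n^\vee}=t_0$; and $t_{\alpha_i}=u_{\alpha_i}=t_{\alpha_i^\vee}=u_{\alpha_i^\vee}=t$ for $1\le i<n$. **Variables.** $\mathbb K(X)=\mathbb K(X_1,\dots,X_n)$ with $X^{\varepsilon_i}=X_i$, $X^{\delta/2}=q^{1/2}$; $\mathbb K(Y)=\mathbb K(Y_1,\dots,Y_n)$ with $Y^{\varepsilon_i^\vee}=Y_i$, $Y^{K/2}=q^{-1/2}$. Set $$c^Y_{\alpha^\vee}=t_{\alpha^\vee}^{-1/2}\frac{(1-t_{\alpha^\vee}^{1/2}u_{\alpha^\vee}^{1/2}Y^{\alpha^\vee})(1+t_{\alpha^\vee}^{1/2}u_{\alpha^\vee}^{-1/2}Y^{\alpha^\vee})}{1-Y^{2\alpha^\vee}},\qquad c^{X^{-1}}_{\alpha}=t_\alpha^{-1/2}\frac{(1-t_\alpha^{1/2}u_\alpha^{1/2}X^{-\alpha})(1+t_\alpha^{1/2}u_\alpha^{-1/2}X^{-\alpha})}{1-X^{-2\alpha}} .$$ **The algebra $\widetilde H_{\mathrm{loc}}$** is the $\mathbb K$-algebra generated by $\mathbb K(X)$, $\mathbb K(Y)$, $\xi_{s_i}$, $\eta_{s_i}$, $T_{\alpha_i}$, $T_{\alpha_i^\vee}$ ($0\le i\le n$), with relations: the $\xi_{s_i}$, and likewise the $\eta_{s_i}$, are involutions satisfying the braid relations of the affine Coxeter diagram of type $C_n$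 (nodes $0,1,\dots,n$ in a line, double bonds at both ends); $\xi_{s_i}X^\mu=X^{s_i\mu}\xi_{s_i}$; $\eta_{s_i}Y^{\lambda^\vee}=Y^{s_i\lambda^\vee}\eta_{s_i}$; $T_{\alpha_i^\vee}+t_{\alpha_i^\vee}^{-1/2}=(1+\eta_{s_i})c^Y_{\alpha_i^\vee}$ and $T_{\alpha_i}+t_{\alpha_i}^{-1/2}=(1+\xi_{s_i})c^{X^{-1}}_{\alpha_i}$ for $0\le i\le n$; $T_j:=T_{\alpha_j}=T_{\alpha_j^\vee}$ for $1\le j\le n$; and, with $T_{s_{\varepsilon_1}}=T_1\cdots T_{n-1}T_nT_{n-1}\cdots T_1$: $Y_1=T_{\alpha_0}T_{s_{\varepsilon_1}}$, $X_1=T_{\alpha_0^\vee}^{-1}T_{s_{\varepsilon_1}}^{-1}$, $Y_{j+1}=T_j^{-1}Y_jT_j^{-1}$, $X_{j+1}=T_jX_jT_j$ ($1\le j<n$), and $Y_1^{-1}X_1=q^{1/2}(u_0^{1/2}-u_0^{-1/2})T_{s_{\varepsilon_1}}^{-1}+qT_{s_{\varepsilon_1}}^{-1}X_1^{-1}Y_1T_{s_{\varepsilon_1}}^{-1}$. **Hecke symmetrizers.** For a reduced word $w=s_{i_1}\cdots s_{i_k}$ in $W_{\mathrm{fin}}$ put $T_w=T_{i_1}\cdots T_{i_k}$, $\xi_w=\xi_{s_{i_1}}\cdots\xi_{s_{i_k}}$, $\eta_w=\eta_{s_{i_1}}\cdots\eta_{s_{i_k}}$. The four one-dimensional characters $\chi^\Xi$,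 $\Xi\in\{+,\pm,\mp,-\}$, of the finite Hecke algebra generated by $T_1,\dots,T_n$ are: for $i<n$, $\chi^+(T_i)=\chi^\pm(T_i)=t^{1/2}$ and $\chi^\mp(T_i)=\chi^-(T_i)=-t^{-1/2}$; $\chi^+(T_n)=\chi^\mp(T_n)=t_n^{1/2}$ and $\chi^\pm(T_n)=\chi^-(T_n)=-t_n^{-1/2}$. Then $$\varepsilon_\Xi=\frac1{\chi^\Xi(T_{w_0})}\sum_{w\in W_{\mathrm{fin}}}\chi^\Xi(T_w)T_w ,$$ so $T_w\varepsilon_\Xi=\chi^\Xi(T_w)\varepsilon_\Xi$ and the coefficient of $T_{w_0}$ in $\varepsilon_\Xi$ is $1$. **$X$- and $Y$-symmetrizers.** $e_+^X=\sum_{w}\xi_w$, $e_-^X=\sum_w(-1)^{\ell_s(w)+\ell_d(w)}\xi_w$, $e_\pm^X=\sum_w(-1)^{\ell_d(w)}\xi_w$, $e_\mp^X=\sum_w(-1)^{\ell_s(w)}\xi_w$ (sums over $w\in W_{\mathrm{fin}}$), and $e^Y_\Xi$ is defined by the same formulas with $\eta_w$ in place of $\xi_w$. **$\kappa$-products.** $$\kappa^X_{\mathrm{dr}}=\prod_{i=1}^n\frac{(1-t_n^{1/2}u_n^{1/2}X_i)(1+t_n^{1/2}u_n^{-1/2}X_i)}{1-X_i^2},\quad \kappa^Y_{\mathrm{dr}}=\prod_{i=1}^n\frac{(1-t_n^{1/2}t_0^{1/2}Y_i)(1+t_n^{1/2}t_0^{-1/2}Y_i)}{1-Y_i^2},$$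 $$\kappa^Z_{\mathrm{st}}=\prod_{1\le i<j\le n}\frac{(1-tZ_iZ_j^{-1})(1-tZ_iZ_j)}{(1-Z_iZ_j^{-1})(1-Z_iZ_j)}\quad(Z=X\text{ or }Y),$$ and a superscript $X^{-1}$ (resp. $Y^{-1}$) means that every $X_i$ (resp. $Y_i$) is replaced by its inverse.
   Formalization: The lines for ε_- and ε_± are proved with (-1)^n χ^+(T_{w_0}) in place of χ^+(T_{w_0}); as printed they fail for odd n (for n=1, t_n^{1/2}ε_- = -κ_dr^X e_-^X), and for even n nothing changes. *)

theory Defs
  imports
    Complex_Main
    "HOL-Library.Poly_Mapping"
    "HOL-Computational_Algebra.Fraction_Field"
    "HOL-Algebra.QuotRing"
begin

section \<open>Rational function fields\<close>

text \<open>Polynomials in variables of type \<open>'v\<close> are finitely supported functions on monomials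
  (finitely supported exponent functions); rational functions are their fractions.\<close>

type_synonym ('v, 'k) mpol = "('v \<Rightarrow>\<^sub>0 nat) \<Rightarrow>\<^sub>0 'k"
type_synonym ('v, 'k) ratfun = "('v, 'k) mpol fract"

definition rvar :: "'v::linorder \<Rightarrow> ('v, 'k::idom) ratfun" where
  "rvar v = Fract (Poly_Mapping.single (Poly_Mapping.single v 1) 1) 1"

definition rconst :: "'k::idom \<Rightarrow> ('v::linorder, 'k) ratfun" where
  "rconst c = Fract (Poly_Mapping.single 0 c) 1"

definition mpol_vars :: "('v, 'k::zero) mpol \<Rightarrow> 'v set" where
  "mpol_vars p = (\<Union>m\<in>Poly_Mapping.keys p. Poly_Mapping.keys m)"

text \<open>The subfield of rational functions in the variables from \<open>V\<close> only.\<close>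

definition ratfuns :: "'v::linorder set \<Rightarrow> ('v, 'k::idom) ratfun set" where
  "ratfuns V = {Fract p r | p r. r \<noteq> 0 \<and> mpol_vars p \<subseteq> V \<and> mpol_vars r \<subseteq> V}"

text \<open>The six independent indeterminates of the ground field are the square roots
  $q^{1/2}, t^{1/2}, t_0^{1/2}, u_0^{1/2}, t_n^{1/2}, u_n^{1/2}$, in this order. The linear order
  on them is only there because the field of fractions needs it as a type class constraint.\<close>

datatype param = PQ | PT | PT0 | PU0 | PTn | PUn

fun param_index :: "param \<Rightarrow> nat" where
  "param_index PQ = 0" | "param_index PT = 1" | "param_index PT0 = 2"
| "param_index PU0 = 3" | "param_index PTn = 4" | "param_index PUn = 5"

lemma param_index_inject: "param_index a = param_index b \<longleftrightarrow> a = b"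
  by (cases a; cases b) auto

instantiation param :: linorder
begin
definition less_eq_param :: "param \<Rightarrow> param \<Rightarrow> bool" where
  "less_eq_param a b \<longleftrightarrow> param_index a \<le> param_index b"
definition less_param :: "param \<Rightarrow> param \<Rightarrow> bool" where
  "less_param a b \<longleftrightarrow> param_index a < param_index b"
instance
  by standard (auto simp: less_eq_param_def less_param_def param_index_inject)
end

type_synonym KK = "(param, complex) ratfun"

abbreviation qh :: KK where "qh \<equiv> rvar PQ"
abbreviation th :: KK where "th \<equiv> rvar PT"
abbreviation t0h :: KK where "t0h \<equiv> rvar PT0"
abbreviation u0h :: KK where "u0h \<equiv> rvar PU0"
abbreviation tnh :: KK where "tnh \<equiv> rvar PTn"
abbreviation unh :: KK where "unh \<equiv> rvar PUn"

text \<open>Both $\mathbb K(X)$ and $\mathbb K(Y)$ are represented by \<open>ratfuns {1..n}\<close> in the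
  following type; the generators of the algebra below keep the two copies apart.\<close>

type_synonym KZ = "(nat, KK) ratfun"


section \<open>Lattices, reflections, monomials, c-functions\<close>

text \<open>An element of $Q$ is its coordinate function: coordinate \<open>i\<close> with \<open>1 \<le> i \<le> n\<close> belongs
  to $\varepsilon_i$, coordinate 0 belongs to $\frac12\delta$. Elements of $Q^\vee$ are encoded
  in the same way, with coordinate 0 belonging to $\frac12 K$.\<close>

type_synonym lat = "nat \<Rightarrow> int"

definition lattice :: "nat \<Rightarrow> lat set" where
  "lattice n = {\<mu>. \<forall>i>n. \<mu> i = 0}"

text \<open>In the case \<open>i = 0\<close>: $\varepsilon_1 \mapsto -\varepsilon_1 + \delta$ and
  $\delta$ is twice the basis vector $\frac12\delta$.\<close>

definition refl :: "nat \<Rightarrow> nat \<Rightarrow> lat \<Rightarrow> lat" where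
  "refl n i \<mu> =
    (if i = 0 then \<mu>(0 := \<mu> 0 + 2 * \<mu> 1, 1 := - \<mu> 1)
     else if i = n then \<mu>(n := - \<mu> n)
     else \<mu>(i := \<mu> (i + 1), i + 1 := \<mu> i))"

text \<open>Simple roots, and at the same time simple coroots.\<close>

definition sroot :: "nat \<Rightarrow> nat \<Rightarrow> lat" where
  "sroot n i =
    (if i = 0 then (\<lambda>_. 0)(0 := 1, 1 := -1)
     else if i = n then (\<lambda>_. 0)(n := 1)
     else (\<lambda>_. 0)(i := 1, i + 1 := -1))"

definition Xmon :: "nat \<Rightarrow> lat \<Rightarrow> KZ" where
  "Xmon n \<mu> = rconst (qh powi \<mu> 0) * (\<Prod>i=1..n. rvar i powi \<mu> i)"

definition Ymon :: "nat \<Rightarrow> lat \<Rightarrow> KZ" where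
  "Ymon n \<mu> = rconst (qh powi (- \<mu> 0)) * (\<Prod>i=1..n. rvar i powi \<mu> i)"

text \<open>Square roots $t_{\alpha_i}^{1/2}, u_{\alpha_i}^{1/2}$ of the parameters of the simple roots
  and $t_{\alpha_i^\vee}^{1/2}, u_{\alpha_i^\vee}^{1/2}$ of the simple coroots.\<close>

definition tr :: "nat \<Rightarrow> nat \<Rightarrow> KK" where
  "tr n i = (if i = 0 then t0h else if i = n then tnh else th)"
definition ur :: "nat \<Rightarrow> nat \<Rightarrow> KK" where
  "ur n i = (if i = 0 then u0h else if i = n then unh else th)"
definition tc :: "nat \<Rightarrow> nat \<Rightarrow> KK" where
  "tc n i = (if i = 0 then unh else if i = n then tnh else th)"
definition uc :: "nat \<Rightarrow> nat \<Rightarrow> KK" where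
  "uc n i = (if i = 0 then u0h else if i = n then t0h else th)"

definition cfun :: "KK \<Rightarrow> KK \<Rightarrow> KZ \<Rightarrow> KZ" where
  "cfun s u z = rconst (inverse s) *
     ((1 - rconst (s * u) * z) * (1 + rconst (s * inverse u) * z) / (1 - z ^ 2))"

definition cY :: "nat \<Rightarrow> nat \<Rightarrow> KZ" where
  "cY n i = cfun (tc n i) (uc n i) (Ymon n (sroot n i))"

definition cXinv :: "nat \<Rightarrow> nat \<Rightarrow> KZ" where
  "cXinv n i = cfun (tr n i) (ur n i) (Xmon n (- sroot n i))"


section \<open>Free algebras\<close>

datatype 'g word = Word (letters: "'g list")

instantiation word :: (type) monoid_add
begin
definition zero_word :: "'a word" where "0 = Word []"
definition plus_word :: "'a word \<Rightarrow> 'a word \<Rightarrow> 'a word" where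
  "a + b = Word (letters a @ letters b)"
instance
  by standard (auto simp: zero_word_def plus_word_def)
end

lemma letters_plus [simp]: "letters (a + b) = letters a @ letters b"
  by (simp add: plus_word_def)

lemma letters_zero [simp]: "letters 0 = []"
  by (simp add: zero_word_def)

text \<open>The multiplication of the following type is the noncommutative convolution product
  along concatenation of words.\<close>

type_synonym ('g, 'k) free = "'g word \<Rightarrow>\<^sub>0 'k"

definition gen :: "'g \<Rightarrow> ('g, 'k::ring_1) free" where
  "gen g = Poly_Mapping.single (Word [g]) 1"

definition scal :: "'k::ring_1 \<Rightarrow> ('g, 'k) free" where
  "scal c = Poly_Mapping.single 0 c"

definition free_alg :: "'g set \<Rightarrow> ('g, 'k::ring_1) free ring" where
  "free_alg G =
    \<lparr>carrier = {p. \<forall>w\<in>Poly_Mapping.keys p. set (letters w) \<subseteq> G},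
     mult = (*), one = 1, zero = 0, add = (+)\<rparr>"


section \<open>The localized double affine Hecke algebra\<close>

text \<open>\<open>GTX i\<close> and \<open>GTY i\<close> stand for $T_{\alpha_i}$ and $T_{\alpha_i^\vee}$. The letters
  \<open>GTXi i\<close> and \<open>GTYi i\<close> are formal inverses of these, which give a meaning to the inverses in
  the defining relations. They do not change the algebra: with
  $T + t^{-1/2} = (1 + s)\,c$, the reflection $s$ sending the argument of $c$ to its inverse,
  one has $(T + t^{-1/2})(T - t^{1/2}) = 0$, so that $T$ is invertible anyway.\<close>

datatype dgen = GX KZ | GY KZ | GXi nat | GEta nat | GTX nat | GTY nat | GTXi nat | GTYi nat

type_synonym dfree = "(dgen, KK) free"

definition dgens :: "nat \<Rightarrow> dgen set" where
  "dgens n = GX ` ratfuns {1..n} \<union> GY ` ratfuns {1..n} \<union>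
     GXi ` {0..n} \<union> GEta ` {0..n} \<union> GTX ` {0..n} \<union> GTY ` {0..n} \<union> GTXi ` {0..n} \<union> GTYi ` {0..n}"

abbreviation KX :: "KZ \<Rightarrow> dfree" where "KX f \<equiv> gen (GX f)"
abbreviation KY :: "KZ \<Rightarrow> dfree" where "KY f \<equiv> gen (GY f)"
abbreviation xi :: "nat \<Rightarrow> dfree" where "xi i \<equiv> gen (GXi i)"
abbreviation eta :: "nat \<Rightarrow> dfree" where "eta i \<equiv> gen (GEta i)"
abbreviation TX :: "nat \<Rightarrow> dfree" where "TX i \<equiv> gen (GTX i)"
abbreviation TY :: "nat \<Rightarrow> dfree" where "TY i \<equiv> gen (GTY i)"
abbreviation TXi :: "nat \<Rightarrow> dfree" where "TXi i \<equiv> gen (GTXi i)"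
abbreviation TYi :: "nat \<Rightarrow> dfree" where "TYi i \<equiv> gen (GTYi i)"

text \<open>$T_{s_{\varepsilon_1}} = T_1 \cdots T_{n-1} T_n T_{n-1} \cdots T_1$; the word is a
  palindrome, so its inverse is the same word in the inverses. As $T_j$ is the common value of
  $T_{\alpha_j}$ and $T_{\alpha_j^\vee}$, either letter can represent it.\<close>

definition pal :: "nat \<Rightarrow> nat list" where
  "pal n = [1..<n] @ [n] @ rev [1..<n]"

definition Teps1 :: "nat \<Rightarrow> dfree" where
  "Teps1 n = prod_list (map TX (pal n))"
definition Teps1i :: "nat \<Rightarrow> dfree" where
  "Teps1i n = prod_list (map TXi (pal n))"

text \<open>Braid relations of the affine diagram of type $C_n$ on nodes \<open>0,\<dots>,n\<close>. For \<open>n = 1\<close> the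
  two nodes generate an infinite dihedral group, i.e. there is no braid relation.\<close>

inductive braid :: "nat \<Rightarrow> (nat \<Rightarrow> dfree) \<Rightarrow> dfree \<Rightarrow> dfree \<Rightarrow> bool"
  for n :: nat and s :: "nat \<Rightarrow> dfree" where
  commute: "i + 2 \<le> j \<Longrightarrow> j \<le> n \<Longrightarrow> braid n s (s i * s j) (s j * s i)"
| single_bond: "1 \<le> i \<Longrightarrow> i + 1 < n \<Longrightarrow>
    braid n s (s i * s (i + 1) * s i) (s (i + 1) * s i * s (i + 1))"
| double_bond: "2 \<le> n \<Longrightarrow> i = 0 \<or> i = n - 1 \<Longrightarrow>
    braid n s (s i * s (i + 1) * s i * s (i + 1)) (s (i + 1) * s i * s (i + 1) * s i)"

inductive drel :: "nat \<Rightarrow> dfree \<Rightarrow> dfree \<Rightarrow> bool" for n :: nat where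
  X_const: "drel n (KX (rconst c)) (scal c)"
| X_add: "f \<in> ratfuns {1..n} \<Longrightarrow> g \<in> ratfuns {1..n} \<Longrightarrow> drel n (KX (f + g)) (KX f + KX g)"
| X_mult: "f \<in> ratfuns {1..n} \<Longrightarrow> g \<in> ratfuns {1..n} \<Longrightarrow> drel n (KX (f * g)) (KX f * KX g)"
| Y_const: "drel n (KY (rconst c)) (scal c)"
| Y_add: "f \<in> ratfuns {1..n} \<Longrightarrow> g \<in> ratfuns {1..n} \<Longrightarrow> drel n (KY (f + g)) (KY f + KY g)"
| Y_mult: "f \<in> ratfuns {1..n} \<Longrightarrow> g \<in> ratfuns {1..n} \<Longrightarrow> drel n (KY (f * g)) (KY f * KY g)"
| xi_invol: "i \<le> n \<Longrightarrow> drel n (xi i * xi i) 1"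
| xi_braid: "braid n xi a b \<Longrightarrow> drel n a b"
| eta_invol: "i \<le> n \<Longrightarrow> drel n (eta i * eta i) 1"
| eta_braid: "braid n eta a b \<Longrightarrow> drel n a b"
| xi_X: "i \<le> n \<Longrightarrow> \<mu> \<in> lattice n \<Longrightarrow>
    drel n (xi i * KX (Xmon n \<mu>)) (KX (Xmon n (refl n i \<mu>)) * xi i)"
| eta_Y: "i \<le> n \<Longrightarrow> \<mu> \<in> lattice n \<Longrightarrow>
    drel n (eta i * KY (Ymon n \<mu>)) (KY (Ymon n (refl n i \<mu>)) * eta i)"
| TX_inverse_right: "i \<le> n \<Longrightarrow> drel n (TX i * TXi i) 1"
| TX_inverse_left: "i \<le> n \<Longrightarrow> drel n (TXi i * TX i) 1"
| TY_inverse_right: "i \<le> n \<Longrightarrow> drel n (TY i * TYi i) 1"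
| TY_inverse_left: "i \<le> n \<Longrightarrow> drel n (TYi i * TY i) 1"
| TY_eta: "i \<le> n \<Longrightarrow> drel n (TY i + scal (inverse (tc n i))) ((1 + eta i) * KY (cY n i))"
| TX_xi: "i \<le> n \<Longrightarrow> drel n (TX i + scal (inverse (tr n i))) ((1 + xi i) * KX (cXinv n i))"
| TX_TY: "1 \<le> j \<Longrightarrow> j \<le> n \<Longrightarrow> drel n (TX j) (TY j)"
| Y1: "drel n (KY (rvar 1)) (TX 0 * Teps1 n)"
| X1: "drel n (KX (rvar 1)) (TYi 0 * Teps1i n)"
| Y_Suc: "1 \<le> j \<Longrightarrow> j < n \<Longrightarrow> drel n (KY (rvar (j + 1))) (TXi j * KY (rvar j) * TXi j)"
| X_Suc: "1 \<le> j \<Longrightarrow> j < n \<Longrightarrow> drel n (KX (rvar (j + 1))) (TX j * KX (rvar j) * TX j)"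
| YX: "drel n (KY (inverse (rvar 1)) * KX (rvar 1))
    (scal (qh * (u0h - inverse u0h)) * Teps1i n
     + scal (qh ^ 2) * Teps1i n * KX (inverse (rvar 1)) * KY (rvar 1) * Teps1i n)"

text \<open>The presented algebra is the quotient of the free algebra by the two-sided ideal
  generated by the relations; \<open>hcls n\<close> is the canonical projection. Identities in the algebra
  are stated between images under \<open>hcls n\<close> of expressions in the generators.\<close>

abbreviation dfree_alg :: "nat \<Rightarrow> dfree ring" where
  "dfree_alg n \<equiv> free_alg (dgens n)"

definition dideal :: "nat \<Rightarrow> dfree set" where
  "dideal n = Idl\<^bsub>dfree_alg n\<^esub> {a - b | a b. drel n a b}"

definition Hloc :: "nat \<Rightarrow> dfree set ring" where
  "Hloc n = dfree_alg n Quot dideal n"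

definition hcls :: "nat \<Rightarrow> dfree \<Rightarrow> dfree set" where
  "hcls n p = dideal n +>\<^bsub>dfree_alg n\<^esub> p"


text \<open>Both sides of every relation lie in the free algebra on the admissible generators, so
  the ideal is a genuine ideal of that algebra, the quotient is a ring, and \<open>hcls n\<close> is a ring
  homomorphism into it.\<close>

lemma free_alg_mult:
  "p \<in> carrier (free_alg G) \<Longrightarrow> q \<in> carrier (free_alg G) \<Longrightarrow> p * q \<in> carrier (free_alg G)"
  for p q :: "('g, 'k::ring_1) free"
  using keys_mult[of p q] unfolding free_alg_def by fastforce

lemma free_alg_add:
  "p \<in> carrier (free_alg G) \<Longrightarrow> q \<in> carrier (free_alg G) \<Longrightarrow> p + q \<in> carrier (free_alg G)"
  for p q :: "('g, 'k::ring_1) free"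
  using Poly_Mapping.keys_add[of p q] unfolding free_alg_def by fastforce

lemma free_alg_uminus:
  "p \<in> carrier (free_alg G) \<Longrightarrow> - p \<in> carrier (free_alg G)" for p :: "('g, 'k::ring_1) free"
  by (simp add: free_alg_def)

lemma free_alg_scal: "scal c \<in> carrier (free_alg G)"
  by (simp add: free_alg_def scal_def)

lemma free_alg_one: "1 \<in> carrier (free_alg G :: ('g, 'k::ring_1) free ring)"
  using free_alg_scal[of 1] by (simp add: scal_def)

lemma free_alg_gen: "g \<in> G \<Longrightarrow> gen g \<in> carrier (free_alg G)"
  by (simp add: free_alg_def gen_def)

lemma ring_free_alg: "ring (free_alg G :: ('g, 'k::ring_1) free ring)"
proof (intro ringI abelian_groupI monoidI)
  fix p :: "('g, 'k) free" assume "p \<in> carrier (free_alg G)"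
  then show "\<exists>q\<in>carrier (free_alg G). q \<oplus>\<^bsub>free_alg G\<^esub> p = \<zero>\<^bsub>free_alg G\<^esub>"
    by (intro bexI[of _ "- p"] free_alg_uminus) (simp_all add: free_alg_def)
qed (use free_alg_mult free_alg_add free_alg_one in
      \<open>simp_all add: free_alg_def distrib_left distrib_right mult.assoc add.assoc add.commute\<close>)

lemma mpol_vars_add: "mpol_vars (p + q) \<subseteq> mpol_vars p \<union> mpol_vars q"
  using Poly_Mapping.keys_add[of p q] by (fastforce simp: mpol_vars_def)

lemma mpol_vars_mult: "mpol_vars (p * q) \<subseteq> mpol_vars p \<union> mpol_vars q"
proof
  fix v assume "v \<in> mpol_vars (p * q)"
  then obtain a b where "a \<in> Poly_Mapping.keys p" "b \<in> Poly_Mapping.keys q"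
      "v \<in> Poly_Mapping.keys (a + b)"
    using keys_mult[of p q] by (fastforce simp: mpol_vars_def)
  then show "v \<in> mpol_vars p \<union> mpol_vars q"
    using Poly_Mapping.keys_add[of a b] by (fastforce simp: mpol_vars_def)
qed

lemma ratfuns_const: "rconst c \<in> ratfuns V"
proof -
  have "mpol_vars (Poly_Mapping.single 0 c) = {}" "mpol_vars (1 :: ('a,'b) mpol) = {}"
    by (auto simp: mpol_vars_def)
  then show ?thesis unfolding ratfuns_def rconst_def by force
qed

lemma ratfuns_var: "v \<in> V \<Longrightarrow> rvar v \<in> ratfuns V"
proof -
  assume "v \<in> V"
  then have "mpol_vars (Poly_Mapping.single (Poly_Mapping.single v 1) (1::'b)) \<subseteq> V"
    "mpol_vars (1 :: ('a,'b) mpol) = {}"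
    by (auto simp: mpol_vars_def)
  then show ?thesis unfolding ratfuns_def rvar_def by force
qed

lemma ratfuns_add:
  assumes "f \<in> ratfuns V" "g \<in> ratfuns V" shows "f + g \<in> ratfuns V"
proof -
  from assms obtain p r q s where *: "f = Fract p r" "g = Fract q s" "r \<noteq> 0" "s \<noteq> 0"
    "mpol_vars p \<subseteq> V" "mpol_vars r \<subseteq> V" "mpol_vars q \<subseteq> V" "mpol_vars s \<subseteq> V"
    unfolding ratfuns_def by blast
  have "f + g = Fract (p * s + q * r) (r * s)" using * by simp
  moreover have "mpol_vars (p * s + q * r) \<subseteq> V"
    using mpol_vars_add[of "p * s" "q * r"] mpol_vars_mult[of p s] mpol_vars_mult[of q r] *(5-8)
    by blast
  moreover have "mpol_vars (r * s) \<subseteq> V"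
    using mpol_vars_mult[of r s] *(5-8) by blast
  moreover have "r * s \<noteq> 0" using * by simp
  ultimately show ?thesis unfolding ratfuns_def by blast
qed

lemma ratfuns_mult: "f \<in> ratfuns V \<Longrightarrow> g \<in> ratfuns V \<Longrightarrow> f * g \<in> ratfuns V"
  unfolding ratfuns_def
  apply clarify
  subgoal for p q r s
    apply (rule exI[of _ "p * q"], rule exI[of _ "r * s"])
    using mpol_vars_mult[of p q] mpol_vars_mult[of r s]
    by auto
  done

lemma ratfuns_uminus: "f \<in> ratfuns V \<Longrightarrow> - f \<in> ratfuns V"
  unfolding ratfuns_def
  apply clarify
  subgoal for p r
    by (rule exI[of _ "- p"], rule exI[of _ "r"]) (auto simp: mpol_vars_def)
  done

lemma ratfuns_inverse: "f \<in> ratfuns V \<Longrightarrow> inverse f \<in> ratfuns V"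
proof -
  assume "f \<in> ratfuns V"
  then obtain p r where pr: "f = Fract p r" "r \<noteq> 0" "mpol_vars p \<subseteq> V" "mpol_vars r \<subseteq> V"
    unfolding ratfuns_def by blast
  show ?thesis
  proof (cases "p = 0")
    case True
    then have "f = 0" using pr by (simp add: eq_fract Zero_fract_def)
    then show ?thesis using \<open>f \<in> ratfuns V\<close> by simp
  next
    case False
    then show ?thesis using pr unfolding ratfuns_def by auto
  qed
qed

lemma ratfuns_one: "1 \<in> ratfuns V"
  using ratfuns_const[of 1 V] by (simp add: rconst_def One_fract_def)

lemma ratfuns_power: "f \<in> ratfuns V \<Longrightarrow> f ^ k \<in> ratfuns V"
  by (induction k) (auto intro: ratfuns_one ratfuns_mult)

lemma ratfuns_powi: "f \<in> ratfuns V \<Longrightarrow> f powi k \<in> ratfuns V"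
  unfolding power_int_def by (auto intro: ratfuns_power ratfuns_inverse)

lemma ratfuns_prod: "(\<And>i. i \<in> I \<Longrightarrow> f i \<in> ratfuns V) \<Longrightarrow> prod f I \<in> ratfuns V"
  by (induction I rule: infinite_finite_induct) (auto intro: ratfuns_one ratfuns_mult)

lemma ratfuns_diff: "f \<in> ratfuns V \<Longrightarrow> g \<in> ratfuns V \<Longrightarrow> f - g \<in> ratfuns V"
  using ratfuns_add[of f V "- g"] ratfuns_uminus[of g V] by simp

lemma ratfuns_divide: "f \<in> ratfuns V \<Longrightarrow> g \<in> ratfuns V \<Longrightarrow> f / g \<in> ratfuns V"
  by (simp add: divide_inverse ratfuns_mult ratfuns_inverse)

lemmas ratfuns_intros = ratfuns_const ratfuns_var ratfuns_one ratfuns_add ratfuns_diff ratfuns_mult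
  ratfuns_inverse ratfuns_divide ratfuns_power ratfuns_powi ratfuns_prod

lemma drel_carrier:
  assumes "n \<ge> 1" "drel n a b"
  shows "a \<in> carrier (dfree_alg n)" "b \<in> carrier (dfree_alg n)"
proof -
  have mon: "Xmon n \<mu> \<in> ratfuns {1..n}" "Ymon n \<mu> \<in> ratfuns {1..n}" for \<mu>
    unfolding Xmon_def Ymon_def by (auto intro!: ratfuns_intros)
  have c: "cXinv n i \<in> ratfuns {1..n}" "cY n i \<in> ratfuns {1..n}" for i
    unfolding cXinv_def cY_def cfun_def by (intro ratfuns_intros mon)+
  have g: "KX f \<in> carrier (dfree_alg n)" "KY f \<in> carrier (dfree_alg n)" if "f \<in> ratfuns {1..n}" for f
    using that by (auto intro!: free_alg_gen simp: dgens_def)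
  have i: "xi i \<in> carrier (dfree_alg n)" "eta i \<in> carrier (dfree_alg n)"
    "TX i \<in> carrier (dfree_alg n)" "TY i \<in> carrier (dfree_alg n)"
    "TXi i \<in> carrier (dfree_alg n)" "TYi i \<in> carrier (dfree_alg n)" if "i \<le> n" for i
    using that by (auto intro!: free_alg_gen simp: dgens_def)
  have pl: "prod_list xs \<in> carrier (dfree_alg n)" if "set xs \<subseteq> carrier (dfree_alg n)" for xs
    using that by (induction xs) (auto intro: free_alg_one free_alg_mult)
  have t: "Teps1 n \<in> carrier (dfree_alg n)" "Teps1i n \<in> carrier (dfree_alg n)"
    unfolding Teps1_def Teps1i_def by (rule pl; use assms(1) in \<open>auto simp: pal_def intro!: i\<close>)+
  have br: "a \<in> carrier (dfree_alg n) \<and> b \<in> carrier (dfree_alg n)"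
    if "braid n s a b" "\<And>i. i \<le> n \<Longrightarrow> s i \<in> carrier (dfree_alg n)" for s a b
    using that by (induction rule: braid.induct) (auto intro!: free_alg_mult)
  have "a \<in> carrier (dfree_alg n) \<and> b \<in> carrier (dfree_alg n)"
    using assms(2)
    by (cases rule: drel.cases)
      (use assms(1) br[of xi] br[of eta] i in \<open>auto intro!: free_alg_mult free_alg_add
        free_alg_scal free_alg_one g i t c mon ratfuns_intros\<close>)
  then show "a \<in> carrier (dfree_alg n)" "b \<in> carrier (dfree_alg n)" by auto
qed

lemma dideal_ideal:
  assumes "n \<ge> 1" shows "ideal (dideal n) (dfree_alg n)"
proof -
  have "a - b \<in> carrier (dfree_alg n)" if "drel n a b" for a b
    using free_alg_add[OF drel_carrier(1)[OF assms that] free_alg_uminus[OF drel_carrier(2)[OF assms that]]]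
    by simp
  then show ?thesis
    unfolding dideal_def by (intro ring.genideal_ideal[OF ring_free_alg]) blast
qed

lemma hcls_ring_hom:
  assumes "n \<ge> 1" shows "ring (Hloc n)" "hcls n \<in> ring_hom (dfree_alg n) (Hloc n)"
proof -
  interpret ideal "dideal n" "dfree_alg n" by (rule dideal_ideal[OF assms])
  show "ring (Hloc n)" unfolding Hloc_def by (rule quotient_is_ring)
  show "hcls n \<in> ring_hom (dfree_alg n) (Hloc n)"
    using rcos_ring_hom unfolding Hloc_def hcls_def[abs_def] .
qed

section \<open>The finite Weyl group\<close>

text \<open>\<open>wact n [i\<^sub>1,\<dots>,i\<^sub>k]\<close> is the composite of the reflections $s_{i_1} \cdots s_{i_k}$.\<close>

definition wact :: "nat \<Rightarrow> nat list \<Rightarrow> lat \<Rightarrow> lat" where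
  "wact n is = foldr (\<lambda>i f. refl n i \<circ> f) is id"

definition Wfin :: "nat \<Rightarrow> (lat \<Rightarrow> lat) set" where
  "Wfin n = {wact n is | is. set is \<subseteq> {1..n}}"

definition reduced_word :: "nat \<Rightarrow> (lat \<Rightarrow> lat) \<Rightarrow> nat list \<Rightarrow> bool" where
  "reduced_word n w is \<longleftrightarrow> set is \<subseteq> {1..n} \<and> wact n is = w \<and>
     (\<forall>js. set js \<subseteq> {1..n} \<and> wact n js = w \<longrightarrow> length is \<le> length js)"

text \<open>None of the notions defined through a reduced word depends on which one is chosen.\<close>

definition rword :: "nat \<Rightarrow> (lat \<Rightarrow> lat) \<Rightarrow> nat list" where
  "rword n w = (SOME is. reduced_word n w is)"

definition len :: "nat \<Rightarrow> (lat \<Rightarrow> lat) \<Rightarrow> nat" where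
  "len n w = length (rword n w)"

definition len_s :: "nat \<Rightarrow> (lat \<Rightarrow> lat) \<Rightarrow> nat" where
  "len_s n w = length (filter (\<lambda>i. i < n) (rword n w))"

definition len_d :: "nat \<Rightarrow> (lat \<Rightarrow> lat) \<Rightarrow> nat" where
  "len_d n w = length (filter (\<lambda>i. i = n) (rword n w))"

definition w0 :: "nat \<Rightarrow> lat \<Rightarrow> lat" where
  "w0 n = (THE w. w \<in> Wfin n \<and> (\<forall>v\<in>Wfin n. len n v \<le> len n w))"

definition Tw :: "nat \<Rightarrow> (lat \<Rightarrow> lat) \<Rightarrow> dfree" where
  "Tw n w = prod_list (map TX (rword n w))"
definition xiw :: "nat \<Rightarrow> (lat \<Rightarrow> lat) \<Rightarrow> dfree" where
  "xiw n w = prod_list (map xi (rword n w))"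
definition etaw :: "nat \<Rightarrow> (lat \<Rightarrow> lat) \<Rightarrow> dfree" where
  "etaw n w = prod_list (map eta (rword n w))"


section \<open>Characters and symmetrizers\<close>

text \<open>The types $+$, $\pm$, $\mp$, $-$.\<close>

datatype sym_type = Plus | PlusMinus | MinusPlus | Minus

definition chi_gen :: "nat \<Rightarrow> sym_type \<Rightarrow> nat \<Rightarrow> KK" where
  "chi_gen n S i =
    (if i < n then (if S \<in> {Plus, PlusMinus} then th else - inverse th)
     else (if S \<in> {Plus, MinusPlus} then tnh else - inverse tnh))"

text \<open>$\chi^\Xi(T_w)$\<close>

definition chi :: "nat \<Rightarrow> sym_type \<Rightarrow> (lat \<Rightarrow> lat) \<Rightarrow> KK" where
  "chi n S w = prod_list (map (chi_gen n S) (rword n w))"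

definition hecke_sym :: "nat \<Rightarrow> sym_type \<Rightarrow> dfree" where
  "hecke_sym n S = scal (inverse (chi n S (w0 n))) * (\<Sum>w\<in>Wfin n. scal (chi n S w) * Tw n w)"

definition sgn_w :: "nat \<Rightarrow> sym_type \<Rightarrow> (lat \<Rightarrow> lat) \<Rightarrow> KK" where
  "sgn_w n S w = (case S of
      Plus \<Rightarrow> 1
    | Minus \<Rightarrow> (-1) ^ (len_s n w + len_d n w)
    | PlusMinus \<Rightarrow> (-1) ^ len_d n w
    | MinusPlus \<Rightarrow> (-1) ^ len_s n w)"

definition eX :: "nat \<Rightarrow> sym_type \<Rightarrow> dfree" where
  "eX n S = (\<Sum>w\<in>Wfin n. scal (sgn_w n S w) * xiw n w)"
definition eY :: "nat \<Rightarrow> sym_type \<Rightarrow> dfree" where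
  "eY n S = (\<Sum>w\<in>Wfin n. scal (sgn_w n S w) * etaw n w)"


section \<open>The kappa-products\<close>

text \<open>The argument \<open>z\<close> is the family of variables: \<open>rvar\<close> for the superscript $X$ or $Y$ and
  \<open>rinv\<close> for $X^{-1}$ or $Y^{-1}$.\<close>

definition rinv :: "nat \<Rightarrow> KZ" where
  "rinv i = inverse (rvar i)"

definition kap_dr_X :: "nat \<Rightarrow> (nat \<Rightarrow> KZ) \<Rightarrow> KZ" where
  "kap_dr_X n z = (\<Prod>i=1..n.
     (1 - rconst (tnh * unh) * z i) * (1 + rconst (tnh * inverse unh) * z i) / (1 - z i ^ 2))"

definition kap_dr_Y :: "nat \<Rightarrow> (nat \<Rightarrow> KZ) \<Rightarrow> KZ" where
  "kap_dr_Y n z = (\<Prod>i=1..n.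
     (1 - rconst (tnh * t0h) * z i) * (1 + rconst (tnh * inverse t0h) * z i) / (1 - z i ^ 2))"

definition kap_st :: "nat \<Rightarrow> (nat \<Rightarrow> KZ) \<Rightarrow> KZ" where
  "kap_st n z = (\<Prod>(i, j)\<in>{(i, j). 1 \<le> i \<and> i < j \<and> j \<le> n}.
     (1 - rconst (th ^ 2) * z i * inverse (z j)) * (1 - rconst (th ^ 2) * z i * z j)
     / ((1 - z i * inverse (z j)) * (1 - z i * z j)))"

text \<open>On signs: \<open>hecke_sym\<close> has coefficient 1 at $T_{w_0}$, hence its leading coefficient at
  $\xi_{w_0}$ has no sign, whereas $\xi_{w_0}$ enters \<open>eX n Minus\<close> and \<open>eX n PlusMinus\<close> with the
  sign $(-1)^{n^2} = (-1)^n$. Identities that express \<open>hecke_sym\<close> through \<open>eX\<close> (or \<open>eY\<close>) for these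
  two types therefore carry a factor $(-1)^n$. For example, for \<open>n = 1\<close>,
  $\varepsilon_- = T_1 - t_n^{1/2} = (1 + \xi)\,c(X^{-1}) - t_n^{-1/2} - t_n^{1/2}
  = (1 + \xi)\,c(X^{-1}) - c(X) - c(X^{-1}) = c(X)\,(\xi - 1)
  = - t_n^{-1/2}\,\kappa^X_{\mathrm{dr}}\,e^X_-$.\<close>

end

theory Submission
  imports Defs
begin

text \<open>Write $Z$ for $X^{-1}$ or $Y$, and an element $\sum_w \xi_w\, G(w^{-1})$ of the algebra through its
  right coefficients $G(v) \in \mathbb K(Z)$. Left multiplication by $T_i$ then becomes the operator
  $(T_i G)(v) = (c_{v\alpha_i} - t_i^{-1/2})\, G(v) + c_{-v\alpha_i}\, G(v s_i)$, in which the $c$-functions of all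
  roots are fixed elements of the field, so that neither automorphisms of $\mathbb K(Z)$ nor the linear
  independence of the $\xi_w$ in the presented algebra are needed. Two rational identities in rank two give the
  braid relations of these operators, and Matsumoto's theorem makes $T_w$ independent of the reduced word.

  Let $S$ be the coefficient vector of $\sum_w \chi(T_w) T_w$. Since $T_i S = \chi(T_i) S$, the value $S(v)$
  determines $S(v s_i)$, and the coefficients of the right-hand side of the claim obey the same recursion.
  It remains to compare the values at $w_0$, where only the leading term of $T_{w_0}$, the product of $c_\beta$ over
  all positive roots $\beta$, contributes.\<close>

section \<open>Signed permutations and roots\<close>

text \<open>Indexing the coefficients by inverses turns left multiplication by T_i into the right
  translation of the index by s_i, under which the root carried by the index v is v \<alpha>_i.
  Passing from v to v s_i requires a division by the c-function at - v \<alpha>_i; it is nonzero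
  because no root monomial is a constant. The shape of the kappa-products can be read off from the
  recursion. Where the character is t^{1/2}, it says S(v s_i) = S(v), so those factors are constant
  and stand on the right. Where it is -t^{-1/2}, it says c(- v \<alpha>_i) S(v s_i) = - c(v
  \<alpha>_i) S(v). The product of c(- v \<beta>) over the positive \<beta> of that length changes
  by just this ratio, and the minus sign is that of the symmetrizer. At w_0 the kappa-factors
  multiply to \<chi>^+(T_{w_0}) times the product of all positive c-functions, whence the scalar
  common to the four identities. The sign of w_0 remains, since the Hecke symmetrizer has
  coefficient 1 at T_{w_0}. X and Y differ only in the family of variables and in the second
  parameter of the short roots, so one argument serves both.\<close>

text \<open>HOL-Algebra occupies the notation for the inverse of a function.\<close>

abbreviation winv :: "('a \<Rightarrow> 'b) \<Rightarrow> 'b \<Rightarrow> 'a" where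
  "winv \<equiv> inv_into UNIV"

text \<open>\<open>Wfin\<close> is given by words, so its elements need a closed form. The
  permutation and the signs live on coordinates 1 to n; coordinate 0, which belongs to \<delta>/2,
  and the coordinates beyond n stay fixed.\<close>

definition signed_perm :: "nat \<Rightarrow> (lat \<Rightarrow> lat) \<Rightarrow> bool" where
  "signed_perm n v \<longleftrightarrow> (\<exists>\<pi> \<sigma>. bij \<pi> \<and> (\<forall>k. k \<notin> {1..n} \<longrightarrow> \<pi> k = k \<and> \<sigma> k = 1) \<and>
     (\<forall>k. \<sigma> k = 1 \<or> \<sigma> k = -1) \<and> v = (\<lambda>\<mu> k. \<sigma> k * \<mu> (\<pi> k)))"

lemma signed_perm_id: "signed_perm n id"
  unfolding signed_perm_def by (intro exI[of _ id] exI[of _ "\<lambda>_. 1"]) auto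

lemma signed_permE:
  assumes "signed_perm n v"
  obtains \<pi> \<sigma> where "bij \<pi>" "\<And>k. k \<notin> {1..n} \<Longrightarrow> \<pi> k = k" "\<And>k. k \<notin> {1..n} \<Longrightarrow> \<sigma> k = 1"
    "\<And>k. \<sigma> k = 1 \<or> \<sigma> k = -1" "v = (\<lambda>\<mu> k. \<sigma> k * \<mu> (\<pi> k))"
  using assms unfolding signed_perm_def by blast

lemma signed_permI:
  assumes "bij \<pi>" "\<And>k. k \<notin> {1..n} \<Longrightarrow> \<pi> k = k" "\<And>k. k \<notin> {1..n} \<Longrightarrow> \<sigma> k = 1"
    "\<And>k. \<sigma> k = 1 \<or> \<sigma> k = -1" "v = (\<lambda>\<mu> k. \<sigma> k * \<mu> (\<pi> k))"
  shows "signed_perm n v"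
  using assms unfolding signed_perm_def by blast

lemma signed_perm_comp:
  assumes "signed_perm n v" "signed_perm n w" shows "signed_perm n (v \<circ> w)"
  using assms(1)
proof (rule signed_permE)
  fix \<pi> \<sigma> assume v: "bij \<pi>" "\<And>k. k \<notin> {1..n} \<Longrightarrow> \<pi> k = k" "\<And>k. k \<notin> {1..n} \<Longrightarrow> \<sigma> k = 1"
    "\<And>k. \<sigma> k = 1 \<or> \<sigma> k = -1" "v = (\<lambda>\<mu> k. \<sigma> k * \<mu> (\<pi> k))"
  from assms(2) show ?thesis
  proof (rule signed_permE)
    fix \<pi>' \<sigma>' assume w: "bij \<pi>'" "\<And>k. k \<notin> {1..n} \<Longrightarrow> \<pi>' k = k" "\<And>k. k \<notin> {1..n} \<Longrightarrow> \<sigma>' k = 1"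
      "\<And>k. \<sigma>' k = 1 \<or> \<sigma>' k = -1" "w = (\<lambda>\<mu> k. \<sigma>' k * \<mu> (\<pi>' k))"
    show ?thesis
    proof (rule signed_permI)
      show "bij (\<pi>' \<circ> \<pi>)" using v(1) w(1) by (rule bij_comp)
      show "v \<circ> w = (\<lambda>\<mu> k. (\<sigma> k * \<sigma>' (\<pi> k)) * \<mu> ((\<pi>' \<circ> \<pi>) k))"
        unfolding v(5) w(5) by (simp add: fun_eq_iff mult.assoc)
      show "\<sigma> k * \<sigma>' (\<pi> k) = 1 \<or> \<sigma> k * \<sigma>' (\<pi> k) = - 1" for k
        using v(4)[of k] w(4)[of "\<pi> k"] by auto
      show "(\<pi>' \<circ> \<pi>) k = k" "\<sigma> k * \<sigma>' (\<pi> k) = 1" if "k \<notin> {1..n}" for k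
        using v(2,3)[OF that] w(2,3)[OF that] by simp_all
    qed
  qed
qed

definition refl_index :: "nat \<Rightarrow> nat \<Rightarrow> nat \<Rightarrow> nat" where
  "refl_index n i k = (if i = n then k else if k = i then i + 1 else if k = i + 1 then i else k)"

definition refl_sign :: "nat \<Rightarrow> nat \<Rightarrow> nat \<Rightarrow> int" where
  "refl_sign n i k = (if i = n \<and> k = n then -1 else 1)"

lemma refl_index_refl_index [simp]: "refl_index n i (refl_index n i k) = k"
  by (auto simp: refl_index_def)

lemma refl_sign_refl_sign: "refl_sign n i k * refl_sign n i k = 1" "refl_sign n i k = 1 \<or> refl_sign n i k = - 1"
  by (auto simp: refl_sign_def)

lemma refl_sign_refl_index [simp]: "refl_sign n i (refl_index n i k) = refl_sign n i k"
  by (auto simp: refl_sign_def refl_index_def)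

lemma refl_alt: "1 \<le> i \<Longrightarrow> refl n i \<mu> = (\<lambda>k. refl_sign n i k * \<mu> (refl_index n i k))"
  by (auto simp: refl_def fun_eq_iff refl_index_def refl_sign_def)

lemma refl_refl [simp]: "1 \<le> i \<Longrightarrow> refl n i (refl n i \<mu>) = \<mu>"
  by (simp add: refl_alt mult.assoc[symmetric] refl_sign_refl_sign)

lemma signed_perm_refl:
  assumes "i \<in> {1..n}" shows "signed_perm n (refl n i)"
proof (rule signed_permI)
  show "bij (refl_index n i)" by (rule o_bij[of "refl_index n i"]) (simp_all add: fun_eq_iff)
  show "refl n i = (\<lambda>\<mu> k. refl_sign n i k * \<mu> (refl_index n i k))" using assms by (simp add: refl_alt fun_eq_iff)
qed (use assms in \<open>auto simp: refl_index_def refl_sign_def\<close>)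

lemma wact_Nil [simp]: "wact n [] = id" by (simp add: wact_def)
lemma wact_Cons [simp]: "wact n (i # is) = refl n i \<circ> wact n is" by (simp add: wact_def)
lemma wact_append [simp]: "wact n (is @ js) = wact n is \<circ> wact n js"
  by (induction "is") auto

lemma Wfin_wact [intro]: "set is \<subseteq> {1..n} \<Longrightarrow> wact n is \<in> Wfin n"
  by (auto simp: Wfin_def)

lemma Wfin_id [simp]: "id \<in> Wfin n"
  using Wfin_wact[of "[]" n] by simp

lemma Wfin_refl [intro]: "i \<in> {1..n} \<Longrightarrow> refl n i \<in> Wfin n"
  using Wfin_wact[of "[i]" n] by simp

lemma Wfin_comp [intro]:
  assumes "v \<in> Wfin n" "w \<in> Wfin n" shows "v \<circ> w \<in> Wfin n"
proof -
  obtain js ks where "v = wact n js" "set js \<subseteq> {1..n}" "w = wact n ks" "set ks \<subseteq> {1..n}"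
    using assms unfolding Wfin_def by blast
  then show ?thesis using Wfin_wact[of "js @ ks" n] by simp
qed

lemma signed_perm_Wfin: "v \<in> Wfin n \<Longrightarrow> signed_perm n v"
proof -
  have "set is \<subseteq> {1..n} \<Longrightarrow> signed_perm n (wact n is)" for "is"
    by (induction "is") (auto intro!: signed_perm_id signed_perm_comp signed_perm_refl)
  then show "v \<in> Wfin n \<Longrightarrow> signed_perm n v" by (auto simp: Wfin_def)
qed

lemma wact_rev: "set is \<subseteq> {1..n} \<Longrightarrow> wact n is \<circ> wact n (rev is) = id"
proof (induction "is")
  case (Cons i js)
  then have "wact n js (wact n (rev js) \<mu>) = \<mu>" for \<mu>
    by (auto dest: fun_cong)
  then show ?case using Cons by (intro ext) simp
qed simp

lemma wact_rev': "set is \<subseteq> {1..n} \<Longrightarrow> wact n (rev is) \<circ> wact n is = id"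
  using wact_rev[of "rev is" n] by simp

lemma inv_wact: "set is \<subseteq> {1..n} \<Longrightarrow> winv (wact n is) = wact n (rev is)"
  using inv_unique_comp[OF wact_rev wact_rev'] .

lemma bij_Wfin: "v \<in> Wfin n \<Longrightarrow> bij v"
  unfolding Wfin_def using wact_rev wact_rev' o_bij by blast

lemma inv_Wfin [intro]: "v \<in> Wfin n \<Longrightarrow> winv v \<in> Wfin n"
  by (auto simp: Wfin_def inv_wact) (metis set_rev)

lemma inv_refl: "i \<in> {1..n} \<Longrightarrow> winv (refl n i) = refl n i"
  using inv_wact[of "[i]" n] by simp

lemma comp_refl_refl [simp]: "1 \<le> i \<Longrightarrow> v \<circ> refl n i \<circ> refl n i = v"
  by (simp add: fun_eq_iff)

lemma refl_comp_refl [simp]: "1 \<le> i \<Longrightarrow> refl n i \<circ> (refl n i \<circ> v) = v"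
  by (simp add: fun_eq_iff)

section \<open>The root system of type B_n\<close>

definition short_vec :: "nat \<Rightarrow> int \<Rightarrow> lat" where
  "short_vec i a = (\<lambda>k. if k = i then a else 0)"

definition long_vec :: "nat \<Rightarrow> nat \<Rightarrow> int \<Rightarrow> int \<Rightarrow> lat" where
  "long_vec i j a b = (\<lambda>k. if k = i then a else if k = j then b else 0)"

definition short_roots :: "nat \<Rightarrow> lat set" where
  "short_roots n = {short_vec i a | i a. i \<in> {1..n} \<and> a \<in> {1, -1}}"

definition long_roots :: "nat \<Rightarrow> lat set" where
  "long_roots n = {long_vec i j a b | i j a b. i \<in> {1..n} \<and> j \<in> {1..n} \<and> i \<noteq> j \<and> a \<in> {1, -1} \<and> b \<in> {1, -1}}"

definition roots :: "nat \<Rightarrow> lat set" where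
  "roots n = short_roots n \<union> long_roots n"

text \<open>Lexicographic positivity: the first nonzero coordinate decides. It makes sense for all
  vectors, is compatible with sums, and has the \<open>sroot n i\<close> as its simple
  roots.\<close>

definition pos :: "lat \<Rightarrow> bool" where
  "pos \<beta> \<longleftrightarrow> (\<exists>k. \<beta> k > 0 \<and> (\<forall>j<k. \<beta> j = 0))"

lemma long_vec_commute: "i \<noteq> j \<Longrightarrow> long_vec i j a b = long_vec j i b a"
  by (auto simp: long_vec_def)

lemma pos_short_vec [simp]: "pos (short_vec i a) \<longleftrightarrow> a > 0"
  by (auto simp: pos_def short_vec_def intro!: exI[of _ i] split: if_splits)

lemma pos_long_vec: "i < j \<Longrightarrow> a \<noteq> 0 \<Longrightarrow> pos (long_vec i j a b) \<longleftrightarrow> a > 0"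
  unfolding pos_def long_vec_def
  by (auto intro!: exI[of _ i] split: if_splits)

lemma pos_not_pos_uminus:
  assumes "pos \<beta>" shows "\<not> pos (- \<beta>)"
proof
  assume "pos (- \<beta>)"
  then obtain k l where kl: "\<beta> k > 0" "\<forall>j<k. \<beta> j = 0" "\<beta> l < 0" "\<forall>j<l. \<beta> j = 0"
    using assms by (auto simp: pos_def)
  then show False by (cases k l rule: linorder_cases) auto
qed

lemma pos_add:
  assumes "pos a" "pos b" shows "pos (\<lambda>k. a k + b k)"
proof -
  obtain k l where kl: "a k > 0" "\<forall>j<k. a j = 0" "b l > 0" "\<forall>j<l. b j = 0"
    using assms by (auto simp: pos_def)
  have "k < l \<Longrightarrow> b k = 0" "l < k \<Longrightarrow> a l = 0" using kl by auto
  then show ?thesis unfolding pos_def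
    using kl by (intro exI[of _ "min k l"]) (cases k l rule: linorder_cases; auto)
qed

lemma finite_roots [simp]: "finite (roots n)"
proof -
  have "short_roots n = (\<Union>i\<in>{1..n}. \<Union>a\<in>{1, -1}. {short_vec i a})"
    unfolding short_roots_def by blast
  moreover have "long_roots n \<subseteq> (\<Union>i\<in>{1..n}. \<Union>j\<in>{1..n}. \<Union>a\<in>{1, -1}. \<Union>b\<in>{1, -1}. {long_vec i j a b})"
    unfolding long_roots_def by blast
  ultimately show ?thesis unfolding roots_def by (auto intro: finite_subset)
qed

lemma uminus_short_vec: "- short_vec i a = short_vec i (- a)" by (auto simp: short_vec_def fun_eq_iff)
lemma uminus_long_vec: "- long_vec i j a b = long_vec i j (- a) (- b)" by (auto simp: long_vec_def fun_eq_iff)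

lemma short_rootsI: "i \<in> {1..n} \<Longrightarrow> a = 1 \<or> a = -1 \<Longrightarrow> short_vec i a \<in> short_roots n"
  by (auto simp: short_roots_def)

lemma long_rootsI: "i \<in> {1..n} \<Longrightarrow> j \<in> {1..n} \<Longrightarrow> i \<noteq> j \<Longrightarrow> a = 1 \<or> a = -1 \<Longrightarrow> b = 1 \<or> b = -1 \<Longrightarrow>
    long_vec i j a b \<in> long_roots n"
  by (auto simp: long_roots_def)

lemma uminus_short_roots:
  assumes "\<beta> \<in> short_roots n" shows "- \<beta> \<in> short_roots n"
proof -
  obtain i a where "\<beta> = short_vec i a" "i \<in> {1..n}" "a = 1 \<or> a = -1" using assms unfolding short_roots_def by blast
  then show ?thesis using short_rootsI[of i n "- a"] by (auto simp: uminus_short_vec)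
qed

lemma uminus_long_roots:
  assumes "\<beta> \<in> long_roots n" shows "- \<beta> \<in> long_roots n"
proof -
  obtain i j a b where "\<beta> = long_vec i j a b" "i \<in> {1..n}" "j \<in> {1..n}" "i \<noteq> j" "a = 1 \<or> a = -1" "b = 1 \<or> b = -1"
    using assms unfolding long_roots_def by blast
  then show ?thesis using long_rootsI[of i n j "- a" "- b"] by (auto simp: uminus_long_vec)
qed

lemma uminus_roots: "\<beta> \<in> roots n \<Longrightarrow> - \<beta> \<in> roots n"
  using uminus_short_roots uminus_long_roots by (auto simp: roots_def)

lemma long_roots_cases:
  assumes "\<beta> \<in> long_roots n"
  obtains i j a b where "\<beta> = long_vec i j a b" "i \<in> {1..n}" "j \<in> {1..n}" "i < j" "a = 1 \<or> a = -1" "b = 1 \<or> b = -1"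
proof -
  obtain i j a b where *: "\<beta> = long_vec i j a b" "i \<in> {1..n}" "j \<in> {1..n}" "i \<noteq> j" "a = 1 \<or> a = -1" "b = 1 \<or> b = -1"
    using assms by (auto simp: long_roots_def)
  show ?thesis
  proof (cases "i < j")
    case True then show ?thesis using * that by blast
  next
    case False then show ?thesis using * that[of j i b a] long_vec_commute[of i j] by auto
  qed
qed

lemma pos_or_pos_uminus:
  assumes "\<beta> \<in> roots n" shows "pos \<beta> \<or> pos (- \<beta>)"
  using assms unfolding roots_def
  by (auto simp: short_roots_def uminus_short_vec pos_long_vec uminus_long_vec elim!: long_roots_cases)

lemma short_long_disjoint: "\<beta> \<in> short_roots n \<Longrightarrow> \<beta> \<notin> long_roots n"
proof
  assume "\<beta> \<in> short_roots n" "\<beta> \<in> long_roots n"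
  then obtain i a j k b c where *: "\<beta> = short_vec i a" "\<beta> = long_vec j k b c" "j \<noteq> k" "b \<noteq> 0" "c \<noteq> 0"
    unfolding short_roots_def long_roots_def by (smt (verit) insert_iff empty_iff mem_Collect_eq)
  then have "long_vec j k b c j = short_vec i a j" "long_vec j k b c k = short_vec i a k" by simp_all
  then show False using * by (auto simp: short_vec_def long_vec_def split: if_splits)
qed

text \<open>A signed permutation acts on coordinates by pulling back along \<pi>, so on basis
  vectors it acts by the inverse \<rho> of \<pi>, with the sign read at the target index. The last
  clause recovers the map from its action on the basis.\<close>

lemma signed_perm_short_vec_long_vec:
  assumes "signed_perm n v"
  obtains \<rho> \<tau> where "bij_betw \<rho> {1..n} {1..n}" "\<And>i. \<tau> i = 1 \<or> \<tau> i = (-1::int)"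
    "\<And>i a. v (short_vec i a) = short_vec (\<rho> i) (\<tau> i * a)"
    "\<And>i j a b. v (long_vec i j a b) = long_vec (\<rho> i) (\<rho> j) (\<tau> i * a) (\<tau> j * b)"
    "(\<forall>i\<in>{1..n}. \<rho> i = i \<and> \<tau> i = 1) \<Longrightarrow> v = id"
proof -
  from assms obtain \<pi> \<sigma> where *: "bij \<pi>" "\<And>k. k \<notin> {1..n} \<Longrightarrow> \<pi> k = k" "\<And>k. k \<notin> {1..n} \<Longrightarrow> \<sigma> k = 1" 
    "\<And>k. \<sigma> k = 1 \<or> \<sigma> k = -1" "v = (\<lambda>\<mu> k. \<sigma> k * \<mu> (\<pi> k))"
    by (rule signed_permE) blast
  define \<rho> where "\<rho> = winv \<pi>"
  have \<rho>: "\<pi> k = i \<longleftrightarrow> k = \<rho> i" for k i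
    using *(1) unfolding \<rho>_def by (metis bij_inv_eq_iff)
  have "bij \<rho>" using *(1) unfolding \<rho>_def by (rule bij_imp_bij_inv)
  have out: "i \<notin> {1..n} \<Longrightarrow> \<rho> i = i" for i using *(2) \<rho> by metis
  have "inj_on \<rho> {1..n}" using \<open>bij \<rho>\<close> by (meson bij_is_inj inj_on_subset subset_UNIV)
  moreover have "\<rho> ` {1..n} = {1..n}"
  \<comment> \<open>An injective map of a finite set into itself is onto; that the image stays
    inside holds since \<rho> fixes all indices outside.\<close>
  proof (rule card_subset_eq)
    show "\<rho> ` {1..n} \<subseteq> {1..n}"
      using out \<open>bij \<rho>\<close> by (metis bij_def image_subsetI injD)
  qed (use calculation in \<open>auto simp: card_image\<close>)
  ultimately have "bij_betw \<rho> {1..n} {1..n}" by (simp add: bij_betw_def)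
  moreover have "v = id" if "\<forall>i\<in>{1..n}. \<rho> i = i \<and> \<sigma> (\<rho> i) = 1"
  proof -
    have "\<pi> k = k \<and> \<sigma> k = 1" for k using that out *(3) \<rho> by metis
    then show ?thesis using *(5) by auto
  qed
  moreover have "v (short_vec i a) = short_vec (\<rho> i) (\<sigma> (\<rho> i) * a)" for i a
    unfolding *(5) short_vec_def by (auto simp: fun_eq_iff \<rho>)
  moreover have "v (long_vec i j a b) = long_vec (\<rho> i) (\<rho> j) (\<sigma> (\<rho> i) * a) (\<sigma> (\<rho> j) * b)" for i j a b
    unfolding *(5) long_vec_def by (auto simp: fun_eq_iff \<rho>)
  ultimately show ?thesis using that[of \<rho> "\<lambda>i. \<sigma> (\<rho> i)"] *(4) by blast
qed

lemma signed_perm_linear: "signed_perm n v \<Longrightarrow> v (\<lambda>k. a k + b k) = (\<lambda>k. v a k + v b k)"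
  by (auto simp: signed_perm_def algebra_simps)

lemma signed_perm_uminus: "signed_perm n v \<Longrightarrow> v (- \<beta>) = - v \<beta>"
  by (auto simp: signed_perm_def fun_eq_iff)

lemmas Wfin_linear = signed_perm_linear[OF signed_perm_Wfin]
lemmas Wfin_uminus = signed_perm_uminus[OF signed_perm_Wfin]

lemma Wfin_short_roots: 
  assumes "v \<in> Wfin n" "\<beta> \<in> short_roots n" shows "v \<beta> \<in> short_roots n"
proof -
  from signed_perm_short_vec_long_vec[OF signed_perm_Wfin[OF assms(1)]] obtain \<rho> \<tau> where
    *: "bij_betw \<rho> {1..n} {1..n}" "\<And>i. \<tau> i = 1 \<or> \<tau> i = (-1::int)"
    "\<And>i a. v (short_vec i a) = short_vec (\<rho> i) (\<tau> i * a)" by metis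
  obtain i a where "\<beta> = short_vec i a" "i \<in> {1..n}" "a = 1 \<or> a = -1" using assms(2) by (auto simp: short_roots_def)
  moreover have "\<rho> i \<in> {1..n}" using bij_betwE[OF *(1)] calculation by blast
  ultimately show ?thesis using *(2)[of i] by (auto simp: *(3) intro!: short_rootsI)
qed

lemma Wfin_long_roots: 
  assumes "v \<in> Wfin n" "\<beta> \<in> long_roots n" shows "v \<beta> \<in> long_roots n"
proof -
  from signed_perm_short_vec_long_vec[OF signed_perm_Wfin[OF assms(1)]] obtain \<rho> \<tau> where
    *: "bij_betw \<rho> {1..n} {1..n}" "\<And>i. \<tau> i = 1 \<or> \<tau> i = (-1::int)"
    "\<And>i j a b. v (long_vec i j a b) = long_vec (\<rho> i) (\<rho> j) (\<tau> i * a) (\<tau> j * b)" by metis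
  obtain i j a b where **: "\<beta> = long_vec i j a b" "i \<in> {1..n}" "j \<in> {1..n}" "i < j" "a = 1 \<or> a = -1" "b = 1 \<or> b = -1"
    using assms(2) by (rule long_roots_cases)
  have "\<rho> i \<noteq> \<rho> j" using inj_onD[OF bij_betw_imp_inj_on[OF *(1)], of i j] **(2,3,4) by auto
  moreover have "\<rho> i \<in> {1..n}" "\<rho> j \<in> {1..n}" using bij_betwE[OF *(1)] ** by blast+
  ultimately show ?thesis using ** *(2)[of i] *(2)[of j] by (auto simp: *(3) intro!: long_rootsI)
qed

lemma Wfin_roots: "v \<in> Wfin n \<Longrightarrow> \<beta> \<in> roots n \<Longrightarrow> v \<beta> \<in> roots n"
  using Wfin_short_roots Wfin_long_roots by (auto simp: roots_def)

lemma sroot_n: "1 \<le> n \<Longrightarrow> sroot n n = short_vec n 1"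
  by (auto simp: sroot_def short_vec_def fun_eq_iff)

lemma sroot_less: "1 \<le> i \<Longrightarrow> i < n \<Longrightarrow> sroot n i = long_vec i (i + 1) 1 (-1)"
  by (auto simp: sroot_def long_vec_def fun_eq_iff)

lemma sroot_short: "1 \<le> n \<Longrightarrow> sroot n n \<in> short_roots n"
  by (auto simp: sroot_n intro!: short_rootsI)

lemma sroot_long: "1 \<le> i \<Longrightarrow> i < n \<Longrightarrow> sroot n i \<in> long_roots n"
  by (auto simp: sroot_less intro!: long_rootsI)

lemma sroot_roots: "i \<in> {1..n} \<Longrightarrow> sroot n i \<in> roots n"
  using sroot_short sroot_long unfolding roots_def by (cases "i = n") auto

lemma pos_sroot: "i \<in> {1..n} \<Longrightarrow> pos (sroot n i)"
  by (cases "i = n") (auto simp: sroot_n sroot_less pos_long_vec)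

lemma refl_short_vec: "1 \<le> i \<Longrightarrow> refl n i (short_vec k a) = short_vec (refl_index n i k) (refl_sign n i k * a)"
  by (auto simp: refl_alt short_vec_def fun_eq_iff)

lemma refl_long_vec: "1 \<le> i \<Longrightarrow> refl n i (long_vec k l a b) = long_vec (refl_index n i k) (refl_index n i l) (refl_sign n i k * a) (refl_sign n i l * b)"
  by (auto simp: refl_alt long_vec_def fun_eq_iff)

lemma refl_sroot: "i \<in> {1..n} \<Longrightarrow> refl n i (sroot n i) = - sroot n i"
  by (auto simp: refl_def sroot_def fun_eq_iff)

text \<open>A simple reflection can change the sign of the first nonzero coordinate only by a sign
  change at n or by exchanging the two support indices. The first happens only to
  \<plusminus>\<epsilon>_n; the second only for support {i, i + 1}, where \<epsilon>_i +
  \<epsilon>_{i+1} is fixed and \<alpha>_i is excluded.\<close>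

lemma pos_refl:
  assumes i: "i \<in> {1..n}" and \<beta>: "\<beta> \<in> roots n" "pos \<beta>" "\<beta> \<noteq> sroot n i"
  shows "pos (refl n i \<beta>)"
proof (cases "\<beta> \<in> short_roots n")
  case True
  then show ?thesis using assms
    by (auto simp: short_roots_def refl_short_vec refl_sign_def sroot_n)
next
  case False
  with \<beta> have "\<beta> \<in> long_roots n" by (auto simp: roots_def)
  then obtain k l a b where *: "\<beta> = long_vec k l a b" "k \<in> {1..n}" "l \<in> {1..n}" "k < l" "a = 1 \<or> a = -1" "b = 1 \<or> b = -1"
    by (rule long_roots_cases)
  have a: "a = 1" using \<beta>(2) * by (auto simp: pos_long_vec)
  have k: "refl_sign n i k = 1" using * by (auto simp: refl_sign_def)
  show ?thesis
  proof (cases "refl_index n i k < refl_index n i l")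
    case True
    then show ?thesis using i a k * by (auto simp: refl_long_vec pos_long_vec)
  next
    case False
    then have **: "i < n" "k = i" "l = i + 1" using * i by (auto simp: refl_index_def split: if_splits)
    then have "b = 1" using * \<beta>(3) a i by (auto simp: sroot_less)
    then have "refl n i \<beta> = long_vec i (i + 1) 1 1"
      using i a * ** by (auto simp: refl_def long_vec_def fun_eq_iff)
    then show ?thesis by (simp add: pos_long_vec)
  qed
qed

section \<open>Inversions, length and the longest element\<close>

text \<open>These are the positive roots made negative by the inverse of v. This side is chosen
  because right multiplication by s_i then adds or removes a single root, \<plusminus>v
  \<alpha>_i.\<close>

definition inversions :: "nat \<Rightarrow> (lat \<Rightarrow> lat) \<Rightarrow> lat set" where
  "inversions n v = {\<beta> \<in> v ` {\<gamma> \<in> roots n. \<not> pos \<gamma>}. pos \<beta>}"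

lemma finite_inversions [simp]: "finite (inversions n v)"
  by (simp add: inversions_def)

lemma inversions_roots: "v \<in> Wfin n \<Longrightarrow> inversions n v \<subseteq> {\<beta> \<in> roots n. pos \<beta>}"
  by (auto simp: inversions_def Wfin_roots)

lemma lat_uminus_uminus [simp]: "- (- \<beta>) = (\<beta> :: lat)"
  by (simp add: fun_eq_iff)

lemma lat_uminus_eq: "- \<beta> = \<gamma> \<longleftrightarrow> \<beta> = (- \<gamma> :: lat)"
  by force

lemma Wfin_comp_refl [simp]: "v \<in> Wfin n \<Longrightarrow> 1 \<le> i \<Longrightarrow> i \<le> n \<Longrightarrow> v \<circ> refl n i \<in> Wfin n"
  by (intro Wfin_comp Wfin_refl) simp_all

lemma refl_negative_roots:
  assumes i: "i \<in> {1..n}"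
  shows "refl n i ` {\<gamma> \<in> roots n. \<not> pos \<gamma>} = insert (sroot n i) ({\<gamma> \<in> roots n. \<not> pos \<gamma>} - {- sroot n i})"
proof -
  let ?N = "{\<gamma> \<in> roots n. \<not> pos \<gamma>}" and ?a = "sroot n i"
  note W = Wfin_refl[OF i]
  have a: "?a \<in> roots n" "pos ?a" "- ?a \<in> ?N" 
    using sroot_roots[OF i] pos_sroot[OF i] pos_not_pos_uminus[of ?a] uminus_roots[of ?a n] by auto
  have neg: "refl n i \<gamma> \<in> ?N - {- ?a}" if \<gamma>: "\<gamma> \<in> ?N" "\<gamma> \<noteq> - ?a" for \<gamma>
  proof -
    have g: "pos (- \<gamma>)" "- \<gamma> \<noteq> ?a" "- \<gamma> \<in> roots n"
      using \<gamma> pos_or_pos_uminus[of \<gamma> n] uminus_roots[of \<gamma> n] lat_uminus_eq[of \<gamma> ?a] by auto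
    have "pos (- refl n i \<gamma>)" using pos_refl[OF i g(3,1,2)] by (simp add: Wfin_uminus[OF W])
    then have "\<not> pos (refl n i \<gamma>)" using pos_not_pos_uminus by blast
    moreover have "refl n i \<gamma> \<noteq> - ?a"
    proof
      assume "refl n i \<gamma> = - ?a"
      then have "refl n i (refl n i \<gamma>) = ?a" using refl_sroot[OF i] by (simp add: Wfin_uminus[OF W])
      then show False using \<gamma> a i by simp
    qed
    ultimately show ?thesis using \<gamma> Wfin_roots[OF W] by auto
  qed
  show ?thesis
  proof (intro equalityI subsetI)
    fix \<beta> assume "\<beta> \<in> refl n i ` ?N"
    then obtain \<gamma> where "\<beta> = refl n i \<gamma>" "\<gamma> \<in> ?N" by blast
    moreover have "refl n i (- ?a) = ?a" using refl_sroot[OF i] by (simp add: Wfin_uminus[OF W])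
    ultimately show "\<beta> \<in> insert ?a (?N - {- ?a})"
      using neg[of \<gamma>] by (cases "\<gamma> = - ?a") simp_all
  next
    fix \<beta> assume "\<beta> \<in> insert ?a (?N - {- ?a})"
    then consider "\<beta> = ?a" | "\<beta> \<in> ?N" "\<beta> \<noteq> - ?a" by blast
    then show "\<beta> \<in> refl n i ` ?N"
    proof cases
      case 1
      then have "\<beta> = refl n i (- ?a)" using refl_sroot[OF i] by (simp add: Wfin_uminus[OF W])
      then show ?thesis using a by blast
    next
      case 2
      then have "refl n i \<beta> \<in> ?N" using neg[of \<beta>] by simp
      moreover have "\<beta> = refl n i (refl n i \<beta>)" using i by simp
      ultimately show ?thesis by (metis imageI)
    qed
  qed
qed

text \<open>s_i preserves the set of negative roots except for trading - \<alpha>_i for \<alpha>_i.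
  Applying v transports this exchange to \<plusminus>v \<alpha>_i.\<close>

lemma inversions_ascent:
  assumes v: "v \<in> Wfin n" and i: "i \<in> {1..n}" and p: "pos (v (sroot n i))"
  shows "inversions n (v \<circ> refl n i) = insert (v (sroot n i)) (inversions n v)"
    "v (sroot n i) \<notin> inversions n v"
proof -
  let ?N = "{\<gamma> \<in> roots n. \<not> pos \<gamma>}" and ?a = "sroot n i"
  have inj: "inj v" using bij_Wfin[OF v] bij_is_inj by blast
  have "(v \<circ> refl n i) ` ?N = insert (v ?a) (v ` ?N - {- v ?a})"
    by (simp only: image_comp[symmetric] refl_negative_roots[OF i])
       (simp add: image_set_diff[OF inj] Wfin_uminus[OF v])
  then show "inversions n (v \<circ> refl n i) = insert (v ?a) (inversions n v)"
    unfolding inversions_def using p pos_not_pos_uminus by auto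
  show "v ?a \<notin> inversions n v"
    unfolding inversions_def using pos_sroot[OF i] injD[OF inj] by blast
qed

lemma card_inversions_ascent:
  assumes "v \<in> Wfin n" "i \<in> {1..n}" "pos (v (sroot n i))"
  shows "card (inversions n (v \<circ> refl n i)) = Suc (card (inversions n v))"
  using inversions_ascent[OF assms] by simp

lemma comp_refl_sroot:
  assumes "v \<in> Wfin n" "i \<in> {1..n}"
  shows "(v \<circ> refl n i) (sroot n i) = - v (sroot n i)"
  using refl_sroot[OF assms(2)] Wfin_uminus[OF assms(1)] by simp

lemma descent_comp_refl:
  assumes "v \<in> Wfin n" "i \<in> {1..n}"
  shows "pos ((v \<circ> refl n i) (sroot n i)) \<longleftrightarrow> \<not> pos (v (sroot n i))"
  unfolding comp_refl_sroot[OF assms]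
  using pos_or_pos_uminus[OF Wfin_roots[OF assms(1) sroot_roots[OF assms(2)]]] pos_not_pos_uminus by blast

lemma card_inversions_descent:
  assumes "v \<in> Wfin n" "i \<in> {1..n}" "\<not> pos (v (sroot n i))"
  shows "card (inversions n v) = Suc (card (inversions n (v \<circ> refl n i)))"
proof -
  have "v \<circ> refl n i \<in> Wfin n" "pos ((v \<circ> refl n i) (sroot n i))"
    using descent_comp_refl[OF assms(1,2)] assms by auto
  from card_inversions_ascent[OF this(1) assms(2) this(2)] show ?thesis
    using comp_refl_refl[of i v n] assms(2) by (metis atLeastAtMost_iff)
qed

lemma card_inversions_le: "v \<in> Wfin n \<Longrightarrow> i \<in> {1..n} \<Longrightarrow>
   card (inversions n (v \<circ> refl n i)) \<le> Suc (card (inversions n v))"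
  using card_inversions_ascent[of v n i] card_inversions_descent[of v n i] by linarith

text \<open>Counting upwards from 1 gives i \<le> \<rho> i, counting downwards from n gives the
  reverse inequality.\<close>

lemma strict_mono_interval_id:
  assumes "\<And>i. 1 \<le> i \<Longrightarrow> i < n \<Longrightarrow> \<rho> i < \<rho> (i + 1)" "\<And>i. i \<in> {1..n} \<Longrightarrow> \<rho> i \<in> {1..n}" "i \<in> {1..n}"
  shows "\<rho> i = (i :: nat)"
proof -
  have "i \<le> n \<Longrightarrow> i \<le> \<rho> i" if "1 \<le> i" for i
    using that
  proof (induction i rule: dec_induct)
    case base then show ?case using assms(2)[of 1] by auto
  next
    case (step j) then show ?case using assms(1)[of j] by auto
  qed
  moreover have "\<rho> (n - j) \<le> n - j" if "j < n" for j
    using that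
  proof (induction j)
    case 0 then show ?case using assms(2)[of n] by auto
  next
    case (Suc j)
    then have "n - j = n - Suc j + 1" "1 \<le> n - Suc j" "n - Suc j < n" by auto
    then show ?case using Suc assms(1)[of "n - Suc j"] by simp
  qed
  from this[of "n - i"] have "\<rho> i \<le> i" using assms(3) by auto
  ultimately show ?thesis using assms(3) by (simp add: le_antisym)
qed

text \<open>Positivity of v \<alpha>_n makes the sign at n positive. If the sign at i + 1 is
  positive, then v \<alpha>_i has a negative entry at \<rho> (i + 1), so its leading entry must be
  the other one: this gives the sign at i and \<rho> i < \<rho> (i + 1). The statement is about
  signed permutations because it is applied to \<open>negation n \<circ> v\<close> before
  \<open>negation n\<close> is known to lie in \<open>Wfin n\<close>.\<close>

lemma no_descent_imp_id:
  assumes v: "signed_perm n v" and p: "\<And>i. i \<in> {1..n} \<Longrightarrow> pos (v (sroot n i))"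
  shows "v = id"
proof (cases "n = 0")
  case True
  then show ?thesis using v unfolding signed_perm_def by (auto simp: fun_eq_iff)
next
  case False
  obtain \<rho> \<tau> where *: "bij_betw \<rho> {1..n} {1..n}" "\<And>i. \<tau> i = 1 \<or> \<tau> i = (-1::int)"
    "\<And>i a. v (short_vec i a) = short_vec (\<rho> i) (\<tau> i * a)"
    "\<And>i j a b. v (long_vec i j a b) = long_vec (\<rho> i) (\<rho> j) (\<tau> i * a) (\<tau> j * b)"
    "(\<forall>i\<in>{1..n}. \<rho> i = i \<and> \<tau> i = 1) \<Longrightarrow> v = id"
    using signed_perm_short_vec_long_vec[OF v] by blast
  have step: "\<rho> i < \<rho> (i + 1) \<and> \<tau> i = 1" if i: "1 \<le> i" "i < n" "\<tau> (i + 1) = 1" for i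
  proof -
    have "pos (long_vec (\<rho> i) (\<rho> (i + 1)) (\<tau> i) (- 1))"
      using p[of i] i *(4) by (simp add: sroot_less)
    moreover have "\<rho> i \<noteq> \<rho> (i + 1)"
      using bij_betw_imp_inj_on[OF *(1)] i by (auto dest: inj_onD)
    ultimately show ?thesis
      using *(2)[of i] pos_long_vec[of "\<rho> i" "\<rho> (i+1)" "\<tau> i" "-1"] pos_long_vec[of "\<rho> (i+1)" "\<rho> i" "-1" "\<tau> i"] long_vec_commute[of "\<rho> i" "\<rho> (i+1)"]
      by (cases "\<rho> i < \<rho> (i + 1)") auto
  qed
  have \<tau>: "\<tau> (n - j) = 1" if "j < n" for j
    using that
  proof (induction j)
    case 0
    then show ?case using p[of n] *(2)[of n] *(3) by (auto simp: sroot_n)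
  next
    case (Suc j)
    then show ?case using step[of "n - Suc j"] by (auto simp: Suc_diff_Suc)
  qed
  have \<tau>': "\<tau> i = 1" if "i \<in> {1..n}" for i using \<tau>[of "n - i"] that by auto
  have "\<rho> i = i" if "i \<in> {1..n}" for i
    by (rule strict_mono_interval_id[OF _ _ that]) (use step \<tau>' bij_betwE[OF *(1)] in auto)
  then show ?thesis using *(5) \<tau>' by blast
qed

lemma inversions_id [simp]: "inversions n id = {}"
  by (auto simp: inversions_def)

lemma card_inversions_wact: "set is \<subseteq> {1..n} \<Longrightarrow> card (inversions n (wact n is)) \<le> length is"
proof (induction "is" rule: rev_induct)
  case (snoc i js)
  then show ?case using card_inversions_le[of "wact n js" n i] Wfin_wact[of js n] by (auto simp: comp_def)
qed simp

text \<open>As long as v is not the identity it has a descent, and stripping the corresponding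
  reflection removes exactly one inversion.\<close>

lemma exists_reduced_word:
  assumes "v \<in> Wfin n"
  shows "\<exists>is. set is \<subseteq> {1..n} \<and> wact n is = v \<and> length is = card (inversions n v)"
  using assms
proof (induction "card (inversions n v)" arbitrary: v rule: less_induct)
  case less
  show ?case
  proof (cases "\<forall>i\<in>{1..n}. pos (v (sroot n i))")
    case True
    then have "v = id" using no_descent_imp_id[OF signed_perm_Wfin[OF less(2)]] by blast
    then show ?thesis by (intro exI[of _ "[]"]) simp
  next
    case False
    then obtain i where i: "i \<in> {1..n}" "\<not> pos (v (sroot n i))" by blast
    note c = card_inversions_descent[OF less(2) i]
    obtain js where "set js \<subseteq> {1..n}" "wact n js = v \<circ> refl n i" "length js = card (inversions n (v \<circ> refl n i))"
      using less(1)[of "v \<circ> refl n i"] c less(2) i Wfin_comp_refl[of v n i] by fastforce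
    then show ?thesis using c i by (intro exI[of _ "js @ [i]"]) auto
  qed
qed

text \<open>One letter adds at most one inversion, so the inversion number bounds the length of
  every word from below, and the bound is attained. This replaces minimality over all words by a
  count.\<close>

lemma reduced_word_iff:
  "reduced_word n v is \<longleftrightarrow> set is \<subseteq> {1..n} \<and> wact n is = v \<and> length is = card (inversions n v)"
proof (cases "v \<in> Wfin n")
  case True
  then obtain js where js: "set js \<subseteq> {1..n}" "wact n js = v" "length js = card (inversions n v)"
    using exists_reduced_word by blast
  show ?thesis unfolding reduced_word_def
    using js card_inversions_wact[of _ n] by (metis le_antisym)
next
  case False
  then show ?thesis using Wfin_wact unfolding reduced_word_def by blast
qed

lemma reduced_rword: "v \<in> Wfin n \<Longrightarrow> reduced_word n v (rword n v)"
  unfolding rword_def using exists_reduced_word reduced_word_iff someI_ex by metis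

lemma reduced_word_Wfin: "reduced_word n v is \<Longrightarrow> v \<in> Wfin n"
  unfolding reduced_word_def using Wfin_wact by blast

lemma reduced_word_rev: "reduced_word n v is \<Longrightarrow> reduced_word n (winv v) (rev is)"
  unfolding reduced_word_def
proof (elim conjE, intro conjI allI impI)
  fix js assume *: "set is \<subseteq> {1..n}" "wact n is = v"
     "\<forall>js. set js \<subseteq> {1..n} \<and> wact n js = v \<longrightarrow> length is \<le> length js" "set js \<subseteq> {1..n} \<and> wact n js = winv v"
  then have "wact n (rev js) = winv (winv v)" using inv_wact[of js n] by simp
  also have "\<dots> = v" using * bij_Wfin[of v n] by (simp add: Wfin_wact inv_inv_eq flip: *(2))
  finally show "length (rev is) \<le> length js" using * by (metis length_rev set_rev)
qed (auto simp: inv_wact)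

text \<open>The recursion behind all inductions on reduced words: the last letter of a reduced word
  is a descent, and conversely any descent may be appended to a reduced word of the shorter
  element.\<close>

lemma reduced_word_snoc:
  "reduced_word n v (is @ [i]) \<longleftrightarrow> i \<in> {1..n} \<and> v \<in> Wfin n \<and> reduced_word n (v \<circ> refl n i) is \<and> \<not> pos (v (sroot n i))"
proof
  assume *: "reduced_word n v (is @ [i])"
  then have i: "i \<in> {1..n}" "v \<in> Wfin n" using reduced_word_Wfin[OF *] by (simp_all add: reduced_word_iff)
  have s: "set is \<subseteq> {1..n}" "wact n is = v \<circ> refl n i" "Suc (length is) = card (inversions n v)"
    using * i by (auto simp: reduced_word_iff)
  have "card (inversions n (v \<circ> refl n i)) \<le> length is"
    using card_inversions_wact[OF s(1)] s(2) by simp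
  then have "\<not> pos (v (sroot n i))" using card_inversions_ascent[OF i(2,1)] s(3) by auto
  with card_inversions_descent[OF i(2,1) this] s i show "i \<in> {1..n} \<and> v \<in> Wfin n \<and> reduced_word n (v \<circ> refl n i) is \<and> \<not> pos (v (sroot n i))"
    by (auto simp: reduced_word_iff)
next
  assume "i \<in> {1..n} \<and> v \<in> Wfin n \<and> reduced_word n (v \<circ> refl n i) is \<and> \<not> pos (v (sroot n i))"
  then show "reduced_word n v (is @ [i])" using card_inversions_descent[of v n i]
    by (auto simp: reduced_word_iff)
qed

lemma finite_Wfin: "finite (Wfin n)"
proof (rule finite_subset)
  show "Wfin n \<subseteq> wact n ` {is. set is \<subseteq> {1..n} \<and> length is \<le> card (roots n)}"
  proof
    fix v assume v: "v \<in> Wfin n"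
    obtain "is" where *: "set is \<subseteq> {1..n}" "wact n is = v" "length is = card (inversions n v)"
      using exists_reduced_word[OF v] by blast
    moreover have "card (inversions n v) \<le> card (roots n)"
      using inversions_roots[OF v] by (intro card_mono) auto
    ultimately show "v \<in> wact n ` {is. set is \<subseteq> {1..n} \<and> length is \<le> card (roots n)}" by force
  qed
qed (simp add: finite_lists_length_le)

lemma len_eq: "v \<in> Wfin n \<Longrightarrow> len n v = card (inversions n v)"
  using reduced_rword by (auto simp: len_def reduced_word_iff)

text \<open>The longest element in closed form. It is -1 on the span of the \<epsilon>_i but fixes
  coordinate 0, so it is not the map \<open>uminus\<close> on the whole lattice.\<close>

definition negation :: "nat \<Rightarrow> lat \<Rightarrow> lat" where
  "negation n \<mu> = (\<lambda>k. if k \<in> {1..n} then - \<mu> k else \<mu> k)"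

lemma negation_short_vec: "i \<in> {1..n} \<Longrightarrow> negation n (short_vec i a) = - short_vec i a"
  by (auto simp: negation_def short_vec_def fun_eq_iff)

lemma negation_long_vec: "i \<in> {1..n} \<Longrightarrow> j \<in> {1..n} \<Longrightarrow> negation n (long_vec i j a b) = - long_vec i j a b"
  by (auto simp: negation_def long_vec_def fun_eq_iff)

lemma negation_roots: "\<beta> \<in> roots n \<Longrightarrow> negation n \<beta> = - \<beta>"
  by (auto simp: roots_def short_roots_def long_roots_def negation_short_vec negation_long_vec)

lemma negation_negation [simp]: "negation n (negation n \<mu>) = \<mu>"
  by (auto simp: negation_def)

lemma signed_perm_negation: "signed_perm n (negation n)"
  unfolding signed_perm_def
  by (intro exI[of _ id] exI[of _ "\<lambda>k. if k \<in> {1..n} then -1 else 1"]) (auto simp: negation_def fun_eq_iff)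

text \<open>\<open>negation n\<close> acts as -1 on roots, so following v by it turns every descent
  into an ascent, and only the identity has no descent.\<close>

lemma all_descents_imp_negation:
  assumes v: "v \<in> Wfin n" and p: "\<And>i. i \<in> {1..n} \<Longrightarrow> \<not> pos (v (sroot n i))"
  shows "v = negation n"
proof -
  have "negation n \<circ> v = id"
  proof (rule no_descent_imp_id)
    show "signed_perm n (negation n \<circ> v)"
      by (intro signed_perm_comp signed_perm_negation signed_perm_Wfin[OF v])
    fix i assume i: "i \<in> {1..n}"
    have "v (sroot n i) \<in> roots n" using Wfin_roots[OF v sroot_roots[OF i]] .
    then show "pos ((negation n \<circ> v) (sroot n i))"
      using p[OF i] pos_or_pos_uminus negation_roots by auto
  qed
  then show ?thesis by (metis comp_apply eq_id_iff ext negation_negation)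
qed

lemma maximal_imp_negation:
  assumes "v \<in> Wfin n" "\<And>w. w \<in> Wfin n \<Longrightarrow> card (inversions n w) \<le> card (inversions n v)"
  shows "v = negation n"
proof (rule all_descents_imp_negation[OF assms(1)])
  fix i assume i: "i \<in> {1..n}"
  have "v \<circ> refl n i \<in> Wfin n" using assms(1) i by blast
  then show "\<not> pos (v (sroot n i))"
    using card_inversions_ascent[OF assms(1) i] assms(2)[of "v \<circ> refl n i"] by auto
qed

text \<open>No word for \<open>negation n\<close> is written down: a finite group has an element
  with the most inversions, every simple reflection is a descent of it, and so it must be
  \<open>negation n\<close>.\<close>

lemma negation_Wfin: "negation n \<in> Wfin n"
  and negation_maximal: "w \<in> Wfin n \<Longrightarrow> card (inversions n w) \<le> card (inversions n (negation n))"
proof -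
  define m where "m = Max ((\<lambda>w. card (inversions n w)) ` Wfin n)"
  have "m \<in> (\<lambda>w. card (inversions n w)) ` Wfin n"
    unfolding m_def using finite_Wfin Wfin_id by (intro Max_in) blast+
  then obtain v where v: "v \<in> Wfin n" "card (inversions n v) = m" by blast
  have mx: "w \<in> Wfin n \<Longrightarrow> card (inversions n w) \<le> card (inversions n v)" for w
    unfolding v(2) m_def using finite_Wfin by (intro Max_ge) auto
  have "v = negation n" using maximal_imp_negation[OF v(1) mx] by blast
  then show "negation n \<in> Wfin n" "w \<in> Wfin n \<Longrightarrow> card (inversions n w) \<le> card (inversions n (negation n))"
    using v(1) mx by blast+
qed

lemma w0_eq: "w0 n = negation n"
  unfolding w0_def
proof (rule the_equality)
  show "negation n \<in> Wfin n \<and> (\<forall>v\<in>Wfin n. len n v \<le> len n (negation n))"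
    using negation_Wfin negation_maximal by (auto simp: len_eq)
next
  fix w assume "w \<in> Wfin n \<and> (\<forall>v\<in>Wfin n. len n v \<le> len n w)"
  then show "w = negation n" by (intro maximal_imp_negation) (auto simp: len_eq)
qed

lemma inversions_w0: "inversions n (w0 n) = {\<beta> \<in> roots n. pos \<beta>}"
proof -
  have "negation n ` {\<gamma> \<in> roots n. \<not> pos \<gamma>} = {\<beta> \<in> roots n. pos \<beta>}"
  proof (intro equalityI subsetI)
    fix \<beta> assume b: "\<beta> \<in> {\<beta> \<in> roots n. pos \<beta>}"
    then have "- \<beta> \<in> {\<gamma> \<in> roots n. \<not> pos \<gamma>}" using uminus_roots pos_not_pos_uminus by auto
    moreover have "\<beta> = negation n (- \<beta>)" using negation_roots[of "- \<beta>" n] b uminus_roots by simp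
    ultimately show "\<beta> \<in> negation n ` {\<gamma> \<in> roots n. \<not> pos \<gamma>}" by blast
  qed (use negation_roots pos_or_pos_uminus uminus_roots in auto)
  then show ?thesis by (auto simp: inversions_def w0_eq)
qed

text \<open>Each letter of a reduced word contributes one inversion, the image of its simple root
  under the preceding prefix. A weight constant along such images therefore multiplies to a product
  over inversions. This is how characters and signs, defined through a chosen word, become
  intrinsic.\<close>

lemma prod_list_reduced_word:
  fixes F :: "nat \<Rightarrow> 'a::comm_monoid_mult"
  assumes "reduced_word n v is"
    and "\<And>u i. u \<in> Wfin n \<Longrightarrow> i \<in> {1..n} \<Longrightarrow> F' (u (sroot n i)) = F i"
  shows "prod_list (map F is) = (\<Prod>\<beta>\<in>inversions n v. F' \<beta>)"
  using assms(1)
proof (induction "is" arbitrary: v rule: rev_induct)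
  case Nil
  then have "inversions n v = {}" by (simp add: reduced_word_iff)
  then show ?case by simp
next
  case (snoc i js)
  then have *: "i \<in> {1..n}" "v \<in> Wfin n" "reduced_word n (v \<circ> refl n i) js" "\<not> pos (v (sroot n i))"
    by (simp_all add: reduced_word_snoc)
  define u where "u = v \<circ> refl n i"
  have W: "u \<in> Wfin n" using * unfolding u_def by blast
  have p: "pos (u (sroot n i))" using descent_comp_refl * unfolding u_def by blast
  have v: "v = u \<circ> refl n i"
    using comp_refl_refl[of i v n] *(1) unfolding u_def by (metis atLeastAtMost_iff)
  have "prod_list (map F js) = (\<Prod>\<beta>\<in>inversions n u. F' \<beta>)"
    using snoc.IH[OF *(3)] unfolding u_def .
  then show ?case
    unfolding v inversions_ascent(1)[OF W *(1) p]
    using inversions_ascent(2)[OF W *(1) p] assms(2)[OF W *(1)] by (simp add: mult.commute)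
qed


section \<open>Two-term operators and their braid relations\<close>

text \<open>The model of T acting on coefficient vectors. In the application c takes opposite roots
  to values with sum t + t^{-1}, so the second coefficient is the c-function at the opposite
  root.\<close>

definition two_term :: "('x \<Rightarrow> 'k) \<Rightarrow> ('x \<Rightarrow> 'x) \<Rightarrow> 'k \<Rightarrow> ('x \<Rightarrow> 'k) \<Rightarrow> 'x \<Rightarrow> 'k::field" where
  "two_term c s t H v = (c v - inverse t) * H v + (t + inverse t - c v) * H (s v)"

text \<open>Here c1 v, c2 v and r are the c-functions at two simple roots of A_2 and at their sum.
  The two threefold composites agree except in the values at v and its two neighbours, where their
  difference is a multiple of the relation \<open>rel\<close>.\<close>

lemma two_term_braid3:
  assumes s: "s1 (s1 v) = v" "s2 (s2 v) = v" "s1 (s1 (s2 v)) = s2 v" "s2 (s2 (s1 v)) = s1 v"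
     "s2 (s1 (s2 v)) = s1 (s2 (s1 v))"
    and c: "c1 (s1 v) = t + inverse t - c1 v" "c2 (s2 v) = t + inverse t - c2 v"
      "c2 (s1 v) = r" "c1 (s2 v) = r" "c1 (s2 (s1 v)) = c2 v" "c2 (s1 (s2 v)) = c1 v"
    and t0: "t \<noteq> 0"
    and rel: "c1 v * c2 v + r * (t + inverse t - c1 v - c2 v) = 1"
  shows "two_term c1 s1 t (two_term c2 s2 t (two_term c1 s1 t H)) v = two_term c2 s2 t (two_term c1 s1 t (two_term c2 s2 t H)) v"
proof -
  define it p q g0 g1 g2 g21 g12 g121
    where d: "it = inverse t" "p = c1 v" "q = c2 v" "g0 = H v" "g1 = H (s1 v)" "g2 = H (s2 v)" "g21 = H (s2 (s1 v))"
      "g12 = H (s1 (s2 v))" "g121 = H (s1 (s2 (s1 v)))"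
  have "p * q + r * (t + it - p - q) - t * it = 0"
    using rel t0 by (simp add: d)
  moreover have "two_term c1 s1 t (two_term c2 s2 t (two_term c1 s1 t H)) v - two_term c2 s2 t (two_term c1 s1 t (two_term c2 s2 t H)) v
    = (p * q + r * (t + it - p - q) - t * it) * ((p - q) * g0 + (t + it - p) * g1 - (t + it - q) * g2)"
    unfolding two_term_def s c d[symmetric] by (simp add: algebra_simps)
  ultimately show ?thesis by simp
qed

text \<open>The fourfold composites with all coefficients kept as independent symbols, which keeps
  the expansion small. Primes mark the coefficient of the reflected argument, a suffix b the
  coefficients at the opposite root. Half of the eight values cancel already at this level of
  generality.\<close>

lemma two_term_braid4_expand:
  fixes P P' Pb Pb' Q Q' Qb Qb' R R' Rb Rb' W W' Wb Wb' g0 g1 g2 g12 g21 g121 g212 g1212 :: "'a::comm_ring"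
  shows "P * (Q * (P * (Q * g0 + Q' * g2) + P' * (W * g1 + W' * g21))
          + Q' * (R * (Qb * g2 + Qb' * g0) + R' * (W * g12 + W' * g212)))
      + P' * (W * (Pb * (W * g1 + W' * g21) + Pb' * (Q * g0 + Q' * g2))
          + W' * (R * (Wb * g21 + Wb' * g1) + R' * (Q * g121 + Q' * g1212)))
    - (Q * (P * (Q * (P * g0 + P' * g1) + Q' * (R * g2 + R' * g12))
          + P' * (W * (Pb * g1 + Pb' * g0) + W' * (R * g21 + R' * g121)))
      + Q' * (R * (Qb * (R * g2 + R' * g12) + Qb' * (P * g0 + P' * g1))
          + R' * (W * (Rb * g12 + Rb' * g2) + W' * (P * g212 + P' * g1212))))
    = P' * (P * Q * W + W * Pb * W + W' * R * Wb' - Q * P * Q - Q * W * Pb - Q' * R * Qb') * g1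
      + Q' * (P * Q * P + P * R * Qb + P' * W * Pb' - Q * P * R - R * Qb * R - R' * W * Rb') * g2
      + P' * W' * (P * Q + W * Pb + R * Wb - Q * R) * g21
      + Q' * R' * (P * W - Q * P - R * Qb - W * Rb) * g12"
  by (simp add: algebra_simps)

text \<open>For B_2 with simple roots \<alpha> (long) and \<beta> (short), w and r are the
  c-functions at \<alpha> + \<beta> and \<alpha> + 2\<beta>. The four coefficients that survive the
  expansion are multiples of the defect \<rho> of the relation \<open>rel\<close>.\<close>

lemma two_term_braid4:
  assumes s: "s1 (s1 v) = v" "s2 (s2 v) = v" "s1 (s1 (s2 v)) = s2 v" "s2 (s2 (s1 v)) = s1 v"
     "s1 (s1 (s2 (s1 v))) = s2 (s1 v)" "s2 (s2 (s1 (s2 v))) = s1 (s2 v)"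
     "s2 (s1 (s2 (s1 v))) = s1 (s2 (s1 (s2 v)))"
    and c: "c1 (s1 v) = t + inverse t - c1 v" "c2 (s2 v) = u + inverse u - c2 v"
      "c2 (s1 v) = w" "c1 (s2 v) = r" "c1 (s2 (s1 v)) = r" "c2 (s1 (s2 v)) = w"
      "c2 (s2 (s1 v)) = u + inverse u - w" "c1 (s1 (s2 v)) = t + inverse t - r"
      "c2 (s1 (s2 (s1 v))) = c2 v" "c1 (s2 (s1 (s2 v))) = c1 v"
    and rel: "(t + inverse t - c1 v) * w + c1 v * c2 v + r * (u + inverse u - w - c2 v) = t * inverse u + u * inverse t"
  shows "two_term c1 s1 t (two_term c2 s2 u (two_term c1 s1 t (two_term c2 s2 u H))) v = two_term c2 s2 u (two_term c1 s1 t (two_term c2 s2 u (two_term c1 s1 t H))) v"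
proof -
  define it iu p q g0 g1 g2 g21 g12 g121 g212 g1212
    where d: "it = inverse t" "iu = inverse u" "p = c1 v" "q = c2 v" "g0 = H v" "g1 = H (s1 v)" "g2 = H (s2 v)" "g21 = H (s2 (s1 v))"
      "g12 = H (s1 (s2 v))" "g121 = H (s1 (s2 (s1 v)))" "g212 = H (s2 (s1 (s2 v)))" "g1212 = H (s1 (s2 (s1 (s2 v))))"
  define \<rho> where "\<rho> = (t + it - p) * w + p * q + r * (u + iu - w - q) - (t * iu + u * it)"
  have \<rho>0: "\<rho> = 0"
    using rel by (simp add: d \<rho>_def)
  define P P' Pb Pb' where P: "P = p - it" "P' = t + it - p" "Pb = t + it - p - it" "Pb' = t + it - (t + it - p)"
  define Q Q' Qb Qb' where Q: "Q = q - iu" "Q' = u + iu - q" "Qb = u + iu - q - iu" "Qb' = u + iu - (u + iu - q)"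
  define R R' Rb Rb' where R: "R = r - it" "R' = t + it - r" "Rb = t + it - r - it" "Rb' = t + it - (t + it - r)"
  define W W' Wb Wb' where W: "W = w - iu" "W' = u + iu - w" "Wb = u + iu - w - iu" "Wb' = u + iu - (u + iu - w)"
  have 1: "P * Q * W + W * Pb * W + W' * R * Wb' - Q * P * Q - Q * W * Pb - Q' * R * Qb' = (w - q) * \<rho>"
    unfolding P Q R W \<rho>_def by (simp add: algebra_simps)
  have 2: "P * Q * P + P * R * Qb + P' * W * Pb' - Q * P * R - R * Qb * R - R' * W * Rb' = (p - r) * \<rho>"
    unfolding P Q R W \<rho>_def by (simp add: algebra_simps)
  have 3: "P * Q + W * Pb + R * Wb - Q * R = \<rho>"
    unfolding P Q R W \<rho>_def by (simp add: algebra_simps)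
  have 4: "P * W - Q * P - R * Qb - W * Rb = - \<rho>"
    unfolding P Q R W \<rho>_def by (simp add: algebra_simps)
  have "two_term c1 s1 t (two_term c2 s2 u (two_term c1 s1 t (two_term c2 s2 u H))) v - two_term c2 s2 u (two_term c1 s1 t (two_term c2 s2 u (two_term c1 s1 t H))) v = 0"
    unfolding two_term_def s c d[symmetric]
    \<comment> \<open>The barred coefficients are folded first: their expressions contain those of
      the unbarred ones, which would otherwise match inside them.\<close>
    unfolding P(3,4)[symmetric] Q(3,4)[symmetric] R(3,4)[symmetric] W(3,4)[symmetric]
    unfolding P(1,2)[symmetric] Q(1,2)[symmetric] R(1,2)[symmetric] W(1,2)[symmetric]
    unfolding two_term_braid4_expand 1 2 3 4 \<rho>0 by simp
  then show ?thesis by simp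
qed


section \<open>The c-functions in rank two\<close>

text \<open>Both parameters are square roots: s stands for t^{1/2} and u for u^{1/2}. The field is
  arbitrary, so that the rank-two relations are plain identities of rational expressions.\<close>

definition c_quot :: "'k::field \<Rightarrow> 'k \<Rightarrow> 'k \<Rightarrow> 'k" where
  "c_quot s u z = inverse s * ((1 - s * u * z) * (1 + s * inverse u * z) / (1 - z ^ 2))"

text \<open>The c-functions at opposite roots add up to a constant; this is the quadratic Hecke
  relation in disguise.\<close>

lemma c_quot_inverse:
  assumes "z \<noteq> 0" "z ^ 2 \<noteq> 1" "s \<noteq> 0" "u \<noteq> 0"
  shows "c_quot s u (inverse z) = s + inverse s - c_quot s u z"
proof -
  have "1 - z ^ 2 \<noteq> 0" "z ^ 2 - 1 \<noteq> 0" using assms by auto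
  then show ?thesis using assms unfolding c_quot_def
    by (simp add: divide_simps power2_eq_square) (simp add: algebra_simps)
qed

text \<open>For equal parameters the second factor of the numerator is 1 + z and cancels against the
  denominator. This is the case of the long roots.\<close>

lemma c_quot_equal:
  assumes "z ^ 2 \<noteq> 1" "s \<noteq> 0"
  shows "c_quot s s z = (inverse s - s * z) / (1 - z)"
proof -
  have eq: "1 - z ^ 2 = (1 - z) * (1 + z)"
    by (simp add: power2_eq_square algebra_simps)
  then have "1 - z \<noteq> 0" "1 + z \<noteq> 0" using assms by auto
  then show ?thesis using assms unfolding c_quot_def
    unfolding eq by (simp add: divide_simps)
qed

text \<open>The A_2 relation required by \<open>two_term_braid3\<close>, with x and y the monomials
  of the two simple roots.\<close>

lemma c_quot_rel3:
  assumes "x ^ 2 \<noteq> 1" "y ^ 2 \<noteq> 1" "(x * y) ^ 2 \<noteq> 1" "s \<noteq> 0"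
  shows "c_quot s s x * c_quot s s y + c_quot s s (x * y) * (s + inverse s - c_quot s s x - c_quot s s y) = 1"
proof -
  have "1 - x \<noteq> 0" "1 - y \<noteq> 0" "1 - x * y \<noteq> 0" using assms by auto
  then show ?thesis unfolding c_quot_equal[OF assms(1,4)] c_quot_equal[OF assms(2,4)] c_quot_equal[OF assms(3,4)]
    using assms(4) by (simp add: divide_simps) (simp add: algebra_simps)
qed

lemma c_quot_short:
  assumes "s \<noteq> 0" "u \<noteq> 0"
  shows "c_quot s u z = (inverse s + (inverse u - u) * z - s * z ^ 2) / (1 - z ^ 2)"
  using assms unfolding c_quot_def by (simp add: field_simps power2_eq_square)

text \<open>The B_2 relation required by \<open>two_term_braid4\<close>: x and y belong to the long
  and the short simple root, x y and x y^2 to the other two positive roots.\<close>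

lemma c_quot_rel4:
  assumes "x ^ 2 \<noteq> 1" "y ^ 2 \<noteq> 1" "(x * y) ^ 2 \<noteq> 1" "(x * y ^ 2) ^ 2 \<noteq> 1"
    and "s \<noteq> 0" "t \<noteq> 0" "u \<noteq> 0"
  shows "(t + inverse t - c_quot t t x) * c_quot s u (x * y) + c_quot t t x * c_quot s u y
     + c_quot t t (x * y ^ 2) * (s + inverse s - c_quot s u (x * y) - c_quot s u y) = t * inverse s + s * inverse t"
proof -
  have nz: "1 - x \<noteq> 0" "1 - y ^ 2 \<noteq> 0" "1 - (x * y) ^ 2 \<noteq> 0" "1 - x * y ^ 2 \<noteq> 0" using assms by auto
  \<comment> \<open>The relation holds with t^{-1}, s^{-1} and u^{-1} - u as independent symbols, so
    after clearing denominators it is a polynomial identity.\<close>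
  define it "is" d where d: "it = inverse t" "is = inverse s" "d = inverse u - u"
  show ?thesis unfolding c_quot_equal[OF assms(1,6)] c_quot_equal[OF assms(4,6)] c_quot_short[OF assms(5,7)]
    d[symmetric]
    using nz apply (simp add: add_divide_eq_iff divide_add_eq_iff eq_divide_eq divide_eq_eq diff_divide_eq_iff divide_diff_eq_iff)
     apply (simp add: algebra_simps power2_eq_square)
    done
qed


section \<open>The theorem of Matsumoto\<close>

definition lat_add :: "lat \<Rightarrow> lat \<Rightarrow> lat" where
  "lat_add \<beta> \<gamma> = (\<lambda>k. \<beta> k + \<gamma> k)"

lemma Wfin_lat_add: "v \<in> Wfin n \<Longrightarrow> v (lat_add \<beta> \<gamma>) = lat_add (v \<beta>) (v \<gamma>)"
  unfolding lat_add_def by (rule Wfin_linear)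

lemma pos_uminus_lat_add: "pos (- \<beta>) \<Longrightarrow> pos (- \<gamma>) \<Longrightarrow> pos (- lat_add \<beta> \<gamma>)"
  using pos_add[of "- \<beta>" "- \<gamma>"] by (simp add: lat_add_def fun_Compl_def)

lemma refl_sroot_commute:
  "1 \<le> i \<Longrightarrow> i + 2 \<le> j \<Longrightarrow> j \<le> n \<Longrightarrow> refl n i (sroot n j) = sroot n j"
  "1 \<le> i \<Longrightarrow> i + 2 \<le> j \<Longrightarrow> j \<le> n \<Longrightarrow> refl n j (sroot n i) = sroot n i"
  by (auto simp: refl_def sroot_def fun_eq_iff)

lemma refl_commute:
  "1 \<le> i \<Longrightarrow> i + 2 \<le> j \<Longrightarrow> j \<le> n \<Longrightarrow> refl n i (refl n j \<mu>) = refl n j (refl n i \<mu>)"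
  by (auto simp: refl_def fun_eq_iff)

lemma refl_sroot_single:
  assumes "1 \<le> i" "i + 1 < n"
  shows "refl n i (sroot n (i + 1)) = lat_add (sroot n i) (sroot n (i + 1))"
    "refl n (i + 1) (sroot n i) = lat_add (sroot n i) (sroot n (i + 1))"
    "refl n i (lat_add (sroot n i) (sroot n (i + 1))) = sroot n (i + 1)"
    "refl n (i + 1) (lat_add (sroot n i) (sroot n (i + 1))) = sroot n i"
  using assms by (auto simp: refl_def sroot_def lat_add_def fun_eq_iff)

lemma refl_braid_single:
  assumes "1 \<le> i" "i + 1 < n"
  shows "refl n i (refl n (i + 1) (refl n i \<mu>)) = refl n (i + 1) (refl n i (refl n (i + 1) \<mu>))"
proof
  fix k
  have i: "1 \<le> i + 1" by simp
  consider "k = i" | "k = i + 1" | "k = i + 2" | "k \<noteq> i \<and> k \<noteq> i + 1 \<and> k \<noteq> i + 2" by blast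
  then show "refl n i (refl n (i + 1) (refl n i \<mu>)) k = refl n (i + 1) (refl n i (refl n (i + 1) \<mu>)) k"
    using assms by cases (simp_all add: refl_alt refl_index_def refl_sign_def)
qed

lemma refl_sroot_double:
  assumes "1 \<le> i" "i + 1 = n"
  defines "\<alpha> \<equiv> sroot n i" and "\<beta> \<equiv> sroot n n"
  shows "refl n i \<beta> = lat_add \<alpha> \<beta>" "refl n n \<alpha> = lat_add (lat_add \<alpha> \<beta>) \<beta>"
    "refl n i (lat_add \<alpha> \<beta>) = \<beta>" "refl n n (lat_add \<alpha> \<beta>) = lat_add \<alpha> \<beta>"
    "refl n i (lat_add (lat_add \<alpha> \<beta>) \<beta>) = lat_add (lat_add \<alpha> \<beta>) \<beta>" "refl n n (lat_add (lat_add \<alpha> \<beta>) \<beta>) = \<alpha>"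
  using assms(1,2) unfolding \<alpha>_def \<beta>_def by (auto simp: refl_def sroot_def lat_add_def fun_eq_iff)

lemma refl_braid_double:
  assumes "1 \<le> i" "i + 1 = n"
  shows "refl n i (refl n n (refl n i (refl n n \<mu>))) = refl n n (refl n i (refl n n (refl n i \<mu>)))"
proof
  fix k
  consider "k = i" | "k = i + 1" | "k \<noteq> i \<and> k \<noteq> i + 1" by blast
  then show "refl n i (refl n n (refl n i (refl n n \<mu>))) k = refl n n (refl n i (refl n n (refl n i \<mu>))) k"
    using assms by cases (auto simp add: refl_alt refl_index_def refl_sign_def)
qed

lemma reduced_word_snocI:
  assumes "v \<in> Wfin n" "i \<in> {1..n}" "pos (- v (sroot n i))" "reduced_word n (v \<circ> refl n i) is"
  shows "reduced_word n v (is @ [i])"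
  using assms pos_not_pos_uminus unfolding reduced_word_snoc by blast

text \<open>If v is negative on two simple roots, it is negative on all positive roots of the
  rank-two system they span. Those are exactly the roots met when the letters i and j are stripped
  alternately from the right, so the whole longest word of that system can be stripped, in either
  order, leaving a common prefix r.\<close>

lemma rank2_reduced_words:
  assumes v: "v \<in> Wfin n" and ij: "i \<in> {1..n}" "j \<in> {1..n}" "i < j"
    and neg: "\<not> pos (v (sroot n i))" "\<not> pos (v (sroot n j))"
  obtains r p q where "reduced_word n v ((r @ p) @ [i])" "reduced_word n v ((r @ q) @ [j])" "set r \<subseteq> {1..n}"
    "i + 2 \<le> j \<and> p = [j] \<and> q = [i] \<or> j = i + 1 \<and> j < n \<and> p = [i, j] \<and> q = [j, i] \<or>
     i + 1 = n \<and> j = n \<and> p = [j, i, j] \<and> q = [i, j, i]"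
proof -
  let ?a = "sroot n i" and ?b = "sroot n j" and ?s = "refl n i" and ?t = "refl n j"
  have a: "pos (- v ?a)" and b: "pos (- v ?b)"
    using neg pos_or_pos_uminus Wfin_roots[OF v] sroot_roots ij by blast+
  have ab: "pos (- v (lat_add ?a ?b))" "pos (- v (lat_add (lat_add ?a ?b) ?b))"
    unfolding Wfin_lat_add[OF v] using a b by (auto intro!: pos_uminus_lat_add)
  have W: "u \<in> Wfin n \<Longrightarrow> u \<circ> ?s \<in> Wfin n" "u \<in> Wfin n \<Longrightarrow> u \<circ> ?t \<in> Wfin n" for u
    using ij by blast+
  have r: "\<exists>r. reduced_word n u r \<and> set r \<subseteq> {1..n}" if "u \<in> Wfin n" for u
    using reduced_rword[OF that] unfolding reduced_word_def by blast
  have uminus: "u (- \<beta>) = - u \<beta>" if "u \<in> Wfin n" for u \<beta> using Wfin_uminus[OF that] .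
  consider (far) "i + 2 \<le> j" | (single) "j = i + 1" "j < n" | (double) "i + 1 = n" "j = n"
  proof -
    have "i + 2 \<le> j \<or> j = i + 1 \<and> j < n \<or> i + 1 = n \<and> j = n" using ij by auto
    then show ?thesis using that by blast
  qed
  then show ?thesis
  proof cases
    case far
    have i1: "1 \<le> i" "j \<le> n" using ij by auto
    note e = refl_sroot_commute[OF i1(1) far i1(2)]
    have c: "v \<circ> ?s \<circ> ?t = v \<circ> ?t \<circ> ?s" by (rule ext) (simp only: comp_apply refl_commute[OF i1(1) far i1(2)])
    obtain r where r: "reduced_word n (v \<circ> ?s \<circ> ?t) r" "set r \<subseteq> {1..n}"
      using r[OF W(2)[OF W(1)[OF v]]] by blast
    have "reduced_word n v ((r @ [j]) @ [i])"
      by (intro reduced_word_snocI W v ij a r) (simp_all only: comp_apply e b)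
    moreover have "reduced_word n v ((r @ [i]) @ [j])"
      by (intro reduced_word_snocI W v ij b r(1)[unfolded c]) (simp_all only: comp_apply e a)
    ultimately show ?thesis using that[of r "[j]" "[i]"] r(2) far by blast
  next
    case single
    have i1: "1 \<le> i" "i + 1 < n" using ij single by auto
    note e = refl_sroot_single[OF i1, folded single(1)]
    have c: "v \<circ> ?s \<circ> ?t \<circ> ?s = v \<circ> ?t \<circ> ?s \<circ> ?t"
      by (rule ext) (simp only: comp_apply refl_braid_single[OF i1, folded single(1)])
    obtain r where r: "reduced_word n (v \<circ> ?s \<circ> ?t \<circ> ?s) r" "set r \<subseteq> {1..n}"
      using r[OF W(1)[OF W(2)[OF W(1)[OF v]]]] by blast
    have "reduced_word n v (((r @ [i]) @ [j]) @ [i])"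
      by (intro reduced_word_snocI W v ij a r) (simp_all only: comp_apply e a b ab)
    moreover have "reduced_word n v (((r @ [j]) @ [i]) @ [j])"
      by (intro reduced_word_snocI W v ij b r(1)[unfolded c]) (simp_all only: comp_apply e a b ab)
    ultimately show ?thesis using that[of r "[i, j]" "[j, i]"] r(2) single by simp
  next
    case double
    have i1: "1 \<le> i" "i + 1 = n" using ij double by auto
    have e: "?s ?b = lat_add ?a ?b" "?t ?a = lat_add (lat_add ?a ?b) ?b" "?s (lat_add ?a ?b) = ?b"
      "?t (lat_add ?a ?b) = lat_add ?a ?b" "?s (lat_add (lat_add ?a ?b) ?b) = lat_add (lat_add ?a ?b) ?b"
      "?t (lat_add (lat_add ?a ?b) ?b) = ?a"
      unfolding double(2) by (fact refl_sroot_double[OF i1])+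
    have c: "v \<circ> ?s \<circ> ?t \<circ> ?s \<circ> ?t = v \<circ> ?t \<circ> ?s \<circ> ?t \<circ> ?s"
      unfolding double(2) by (rule ext) (simp only: comp_apply refl_braid_double[OF i1])
    obtain r where r: "reduced_word n (v \<circ> ?s \<circ> ?t \<circ> ?s \<circ> ?t) r" "set r \<subseteq> {1..n}"
      using r[OF W(2)[OF W(1)[OF W(2)[OF W(1)[OF v]]]]] by blast
    have "reduced_word n v ((((r @ [j]) @ [i]) @ [j]) @ [i])"
      by (intro reduced_word_snocI W v ij a r) (simp_all only: comp_apply e a b ab)
    moreover have "reduced_word n v ((((r @ [i]) @ [j]) @ [i]) @ [j])"
      by (intro reduced_word_snocI W v ij b r(1)[unfolded c]) (simp_all only: comp_apply e a b ab)
    ultimately show ?thesis using that[of r "[j, i, j]" "[i, j, i]"] r(2) double by simp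
  qed
qed

text \<open>The relation \<open>E\<close> is only a partial equivalence: below it is agreement on the Weyl group for operators
  on coefficient vectors, and equality in the quotient, restricted to its carrier, for words in the reflections.\<close>

lemma matsumoto:
  fixes op :: "nat \<Rightarrow> 'a \<Rightarrow> 'a" and E :: "'a \<Rightarrow> 'a \<Rightarrow> bool"
  assumes sym: "\<And>x y. E x y \<Longrightarrow> E y x" and trans: "\<And>x y z. E x y \<Longrightarrow> E y z \<Longrightarrow> E x z"
    and cong: "\<And>i x y. i \<in> {1..n} \<Longrightarrow> E x y \<Longrightarrow> E (op i x) (op i y)"
    and far: "\<And>i j x. 1 \<le> i \<Longrightarrow> i + 2 \<le> j \<Longrightarrow> j \<le> n \<Longrightarrow> E x x \<Longrightarrow> E (op i (op j x)) (op j (op i x))"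
    and single: "\<And>i x. 1 \<le> i \<Longrightarrow> i + 1 < n \<Longrightarrow> E x x \<Longrightarrow>
      E (op i (op (i + 1) (op i x))) (op (i + 1) (op i (op (i + 1) x)))"
    and double: "\<And>i x. 1 \<le> i \<Longrightarrow> i + 1 = n \<Longrightarrow> E x x \<Longrightarrow>
      E (op i (op n (op i (op n x)))) (op n (op i (op n (op i x))))"
    and x: "E x x" and words: "reduced_word n v is" "reduced_word n v js"
  shows "E (fold op is x) (fold op js x)"
proof -
  \<comment> \<open>Reflexivity of \<open>E\<close> is available only along words applied to x, by
    \<open>x\<close> and \<open>cong\<close>.\<close>
  have fold_refl: "E (fold op ks x) (fold op ks x)" if "set ks \<subseteq> {1..n}" for ks
    using that by (induction ks rule: rev_induct) (use x cong in auto)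
  show ?thesis using words
  proof (induction "length is" arbitrary: v "is" js rule: less_induct)
    case less
    have len: "length is = length js" using less.prems by (simp add: reduced_word_iff)
    show ?case
    proof (cases "is" rule: rev_cases)
      case Nil
      then show ?thesis using len x by simp
    next
      case (snoc is' i)
      note is_eq = this
      then obtain js' j where js: "js = js' @ [j]" using len by (cases js rule: rev_cases) auto
      have i: "i \<in> {1..n}" "v \<in> Wfin n" "reduced_word n (v \<circ> refl n i) is'" "\<not> pos (v (sroot n i))"
        using less.prems(1) unfolding is_eq reduced_word_snoc by auto
      have j: "j \<in> {1..n}" "reduced_word n (v \<circ> refl n j) js'" "\<not> pos (v (sroot n j))"
        using less.prems(2) unfolding js reduced_word_snoc by auto
      \<comment> \<open>Words with the same last letter are compared by induction on their common
        shorter element.\<close>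
      have reach: "E (fold op (ks @ [k]) x) (fold op (ks' @ [k]) x)"
        if "reduced_word n v (ks @ [k])" "reduced_word n v (ks' @ [k])" for ks ks' k
      proof -
        have *: "k \<in> {1..n}" "reduced_word n (v \<circ> refl n k) ks" "reduced_word n (v \<circ> refl n k) ks'"
          using that unfolding reduced_word_snoc by auto
        have "length ks < length is"
          using that(1) less.prems(1) by (simp add: reduced_word_iff)
        from less.hyps[OF this *(2,3)] show ?thesis using cong[OF *(1)] by simp
      qed
      \<comment> \<open>Different last letters are bridged by two intermediate words, which share a
        prefix and end in the two sides of a braid relation; each shares its last letter with one of
        the given words.\<close>
      have braid: "E (fold op is x) (fold op js x)"
        if r: "set r \<subseteq> {1..n}" "reduced_word n v ((r @ p) @ [i])" "reduced_word n v ((r @ q) @ [j])"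
          and pq: "\<And>y. E y y \<Longrightarrow> E (fold op (p @ [i]) y) (fold op (q @ [j]) y)" for r p q
      proof -
        have "E (fold op is x) (fold op ((r @ p) @ [i]) x)"
          using reach[of is' i] less.prems(1) r(2) unfolding is_eq by blast
        moreover have "E (fold op ((r @ p) @ [i]) x) (fold op ((r @ q) @ [j]) x)"
          using pq[OF fold_refl[OF r(1)]] by simp
        moreover have "E (fold op ((r @ q) @ [j]) x) (fold op js x)"
          using reach[of "r @ q" j js'] less.prems(2) r(3) unfolding js by blast
        ultimately show ?thesis using trans by blast
      qed
      consider "i = j" | "i < j" | "j < i" by linarith
      then show ?thesis
      proof cases
        case 1
        then show ?thesis using reach[of is' i js'] less.prems unfolding is_eq js by simp
      next
        case 2
        obtain r p q where r: "reduced_word n v ((r @ p) @ [i])" "reduced_word n v ((r @ q) @ [j])" "set r \<subseteq> {1..n}"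
          and pq: "i + 2 \<le> j \<and> p = [j] \<and> q = [i] \<or> j = i + 1 \<and> j < n \<and> p = [i, j] \<and> q = [j, i] \<or>
            i + 1 = n \<and> j = n \<and> p = [j, i, j] \<and> q = [i, j, i]"
          using rank2_reduced_words[OF i(2,1) j(1) 2 i(4) j(3)] .
        show ?thesis
        proof (rule braid[OF r(3,1,2)])
          fix y assume "E y y"
          then show "E (fold op (p @ [i]) y) (fold op (q @ [j]) y)"
            using pq i(1) j(1) far[of i j y] single[of i y] double[of i y] by auto
        qed
      next
        case 3
        obtain r p q where r: "reduced_word n v ((r @ p) @ [j])" "reduced_word n v ((r @ q) @ [i])" "set r \<subseteq> {1..n}"
          and pq: "j + 2 \<le> i \<and> p = [i] \<and> q = [j] \<or> i = j + 1 \<and> i < n \<and> p = [j, i] \<and> q = [i, j] \<or>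
            j + 1 = n \<and> i = n \<and> p = [i, j, i] \<and> q = [j, i, j]"
          using rank2_reduced_words[OF i(2) j(1) i(1) 3 j(3) i(4)] .
        show ?thesis
        proof (rule braid[OF r(3,2,1)])
          fix y assume "E y y"
          then show "E (fold op (q @ [i]) y) (fold op (p @ [j]) y)"
            using pq i(1) j(1) sym[OF far[of j i y]] sym[OF single[of j y]] sym[OF double[of j y]] by auto
        qed
      qed
    qed
  qed
qed


section \<open>The c-functions of the roots\<close>

lemma single_eq_single_iff: "Poly_Mapping.single k a = Poly_Mapping.single k b \<longleftrightarrow> a = b"
  by (metis lookup_single_eq)

lemma single_eq_0_iff [simp]: "Poly_Mapping.single k a = 0 \<longleftrightarrow> a = 0"
  by (metis single_eq_single_iff single_zero)

lemma rconst_1 [simp]: "rconst 1 = 1"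
  by (simp add: rconst_def One_fract_def)

lemma rconst_0 [simp]: "rconst 0 = 0"
  by (simp add: rconst_def Zero_fract_def)

lemma rconst_mult: "rconst (a * b) = rconst a * rconst b"
  by (simp add: rconst_def mult_single)

lemma rconst_uminus: "rconst (- a) = - rconst a"
  by (simp add: rconst_def single_uminus)

lemma rconst_power: "rconst (a ^ k) = rconst a ^ k"
  by (induction k) (simp_all add: rconst_mult)

lemma rconst_eq_iff: "rconst a = rconst b \<longleftrightarrow> a = b"
  by (auto simp: rconst_def eq_fract single_eq_single_iff)

lemma rconst_inverse: "rconst (inverse a) = inverse (rconst a)" for a :: "'k::field"
proof (cases "a = 0")
  case False
  then have "rconst a * rconst (inverse a) = (1 :: ('v::linorder, 'k) ratfun)"
    by (simp flip: rconst_mult)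
  then show ?thesis by (metis inverse_unique)
qed simp

lemma rvar_eq_0 [simp]: "rvar v \<noteq> 0"
  by (auto simp: rvar_def Zero_fract_def eq_fract)

lemma rvar_neq_rconst: "rvar v \<noteq> rconst c"
proof
  assume "rvar v = (rconst c :: ('a, 'b) ratfun)"
  then have "Poly_Mapping.single (Poly_Mapping.single v (1::nat)) (1::'b) = Poly_Mapping.single 0 c"
    by (simp add: rvar_def rconst_def eq_fract)
  from arg_cong[OF this, of "\<lambda>p. Poly_Mapping.lookup p (Poly_Mapping.single v 1)"]
  show False by (simp add: lookup_single when_def split: if_splits)
qed

lemma rvar_neq_rconst_mult_rvar: 
  assumes "v \<noteq> w" shows "rvar v \<noteq> rconst c * rvar w"
proof
  assume "rvar v = (rconst c * rvar w :: ('a, 'b) ratfun)"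
  then have "Poly_Mapping.single (Poly_Mapping.single v (1::nat)) (1::'b) = Poly_Mapping.single (Poly_Mapping.single w 1) c"
    by (simp add: rvar_def rconst_def eq_fract mult_single)
  from arg_cong[OF this, of "\<lambda>p. Poly_Mapping.lookup p (Poly_Mapping.single v 1)"]
  have "Poly_Mapping.single w (1::nat) = Poly_Mapping.single v 1" 
    by (simp add: lookup_single when_def split: if_splits)
  from arg_cong[OF this, of "\<lambda>p. Poly_Mapping.lookup p v"]
  show False using assms by (simp add: lookup_single when_def split: if_splits)
qed

lemma rvar_mult_rvar_neq_rconst: "rvar v * rvar w \<noteq> rconst c"
proof
  assume "rvar v * rvar w = (rconst c :: ('a, 'b) ratfun)"
  then have "Poly_Mapping.single (Poly_Mapping.single v (1::nat) + Poly_Mapping.single w 1) (1::'b) = Poly_Mapping.single 0 c"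
    by (simp add: rvar_def rconst_def eq_fract mult_single)
  from arg_cong[OF this, of "\<lambda>p. Poly_Mapping.lookup p (Poly_Mapping.single v (1::nat) + Poly_Mapping.single w 1)"]
  have "Poly_Mapping.single v (1::nat) + Poly_Mapping.single w 1 = 0"
    by (simp add: lookup_single when_def split: if_splits)
  from arg_cong[OF this, of "\<lambda>p. Poly_Mapping.lookup p v"]
  show False by (simp add: lookup_single lookup_add when_def split: if_splits)
qed

text \<open>Coordinate 0 is left out, so no power of q enters; for roots of the finite system this
  is the full monomial.\<close>

definition monomial :: "nat \<Rightarrow> (nat \<Rightarrow> KZ) \<Rightarrow> lat \<Rightarrow> KZ" where
  "monomial n z \<mu> = (\<Prod>i=1..n. z i powi \<mu> i)"

lemma monomial_lat_add: "(\<And>i. z i \<noteq> 0) \<Longrightarrow> monomial n z (lat_add \<mu> \<nu>) = monomial n z \<mu> * monomial n z \<nu>"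
  by (simp add: monomial_def lat_add_def power_int_add prod.distrib)

lemma monomial_uminus: "monomial n z (- \<mu>) = inverse (monomial n z \<mu>)"
  using prod_inversef[of "\<lambda>i. z i powi \<mu> i" "{1..n}"] by (simp add: monomial_def power_int_minus comp_def)

lemma monomial_nonzero: "(\<And>i. z i \<noteq> 0) \<Longrightarrow> monomial n z \<mu> \<noteq> 0"
  by (simp add: monomial_def)

lemma monomial_short_vec: "i \<in> {1..n} \<Longrightarrow> monomial n z (short_vec i a) = z i powi a"
proof -
  assume i: "i \<in> {1..n}"
  have "monomial n z (short_vec i a) = (\<Prod>k\<in>{i}. z k powi short_vec i a k)"
    unfolding monomial_def using i by (intro prod.mono_neutral_right) (auto simp: short_vec_def)
  then show ?thesis by (simp add: short_vec_def)
qed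

lemma monomial_long_vec: 
  assumes "i \<in> {1..n}" "j \<in> {1..n}" "i \<noteq> j"
  shows "monomial n z (long_vec i j a b) = z i powi a * z j powi b"
proof -
  have "monomial n z (long_vec i j a b) = (\<Prod>k\<in>{i, j}. z k powi long_vec i j a b k)"
    unfolding monomial_def using assms by (intro prod.mono_neutral_right) (auto simp: long_vec_def)
  then show ?thesis using assms by (simp add: long_vec_def)
qed

lemma monomial_rinv: "monomial n rinv \<mu> = monomial n rvar (- \<mu>)"
  by (simp add: monomial_def rinv_def power_int_minus power_int_inverse)

lemma inverse_eq_rconst: 
  fixes x :: "('v::linorder, 'k::field) ratfun"
  assumes "inverse x = rconst c" shows "x = rconst (inverse c)"
  unfolding rconst_inverse assms[symmetric] by simp

text \<open>All constants are excluded, not only \<plusminus>1: the denominators of c-functions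
  vanish only where the root monomial is \<plusminus>1, but their numerators vanish at further
  constants.\<close>

lemma monomial_root_not_const:
  assumes "\<beta> \<in> roots n" shows "monomial n rvar \<beta> \<noteq> rconst c"
proof
  assume eq: "monomial n rvar \<beta> = rconst c"
  show False
  proof (cases "\<beta> \<in> short_roots n")
    case True
    then obtain i a where "\<beta> = short_vec i a" "i \<in> {1..n}" "a = 1 \<or> a = -1"
      unfolding short_roots_def by blast
    then have "rvar i powi a = (rconst c :: KZ)" using eq by (simp add: monomial_short_vec)
    then consider "(rvar i :: KZ) = rconst c" | "inverse (rvar i :: KZ) = rconst c"
      using \<open>a = 1 \<or> a = -1\<close> by (auto simp: power_int_minus)
    then show False
    proof cases
      case 1 then show False using rvar_neq_rconst[of i c] by simp
    next
      case 2 from inverse_eq_rconst[OF this] show False using rvar_neq_rconst[of i "inverse c"] by simp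
    qed
  next
    case False
    then have "\<beta> \<in> long_roots n" using assms by (simp add: roots_def)
    then obtain i j a b where "\<beta> = long_vec i j a b" "i \<in> {1..n}" "j \<in> {1..n}" and ij: "i < j"
      and ab: "a = 1 \<or> a = -1" "b = 1 \<or> b = -1"
      by (rule long_roots_cases)
    then have eq: "(rvar i :: KZ) powi a * rvar j powi b = rconst c" using eq by (simp add: monomial_long_vec)
    consider "a = 1" "b = 1" | "a = 1" "b = -1" | "a = -1" "b = 1" | "a = -1" "b = -1" using ab by blast
    then show False
    proof cases
      case 1
      then show False using eq rvar_mult_rvar_neq_rconst[of i j c] by simp
    next
      case 2
      then have "(rvar i :: KZ) * inverse (rvar j) = rconst c" using eq by (simp add: power_int_minus)
      then have "(rvar i :: KZ) = rconst c * rvar j"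
        unfolding divide_inverse[symmetric] by (subst (asm) divide_eq_eq) simp
      then show False using rvar_neq_rconst_mult_rvar[of i j c] ij by simp
    next
      case 3
      then have "(rvar j :: KZ) * inverse (rvar i) = rconst c" using eq by (simp add: power_int_minus mult.commute)
      then have "(rvar j :: KZ) = rconst c * rvar i"
        unfolding divide_inverse[symmetric] by (subst (asm) divide_eq_eq) simp
      then show False using rvar_neq_rconst_mult_rvar[of j i c] ij by simp
    next
      case 4
      then have "inverse ((rvar i :: KZ) * rvar j) = rconst c" using eq by (simp add: power_int_minus)
      from inverse_eq_rconst[OF this] show False using rvar_mult_rvar_neq_rconst[of i j "inverse c"] by simp
    qed
  qed
qed

text \<open>The parameter \<open>U\<close> is $u_n^{1/2}$ for $Z = X^{-1}$ and $t_0^{1/2}$ for $Z = Y$.\<close>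

locale root_functions =
  fixes n :: nat and z :: "nat \<Rightarrow> KZ" and U :: KK
  assumes n: "1 \<le> n" and z: "z = rvar \<or> z = rinv" and U: "U \<noteq> 0"
begin

lemma z_nonzero: "z i \<noteq> 0"
  using z by (auto simp: rinv_def)

lemma root_not_const:
  assumes "\<beta> \<in> roots n" shows "monomial n z \<beta> \<noteq> rconst c"
  using z monomial_root_not_const[OF assms] monomial_root_not_const[OF uminus_roots[OF assms]]
  by (auto simp: monomial_rinv)

lemma root_square_not_1:
  assumes "\<beta> \<in> roots n" shows "monomial n z \<beta> ^ 2 \<noteq> 1"
proof
  assume "monomial n z \<beta> ^ 2 = 1"
  then have "monomial n z \<beta> = rconst 1 \<or> monomial n z \<beta> = rconst (- 1)"
    by (simp add: power2_eq_1_iff rconst_uminus)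
  then show False using root_not_const[OF assms] by blast
qed

definition t_root :: "lat \<Rightarrow> KK" where
  "t_root \<beta> = (if \<beta> \<in> short_roots n then tnh else th)"

definition u_root :: "lat \<Rightarrow> KK" where
  "u_root \<beta> = (if \<beta> \<in> short_roots n then U else th)"

definition c_root :: "lat \<Rightarrow> KZ" where
  "c_root \<beta> = c_quot (rconst (t_root \<beta>)) (rconst (u_root \<beta>)) (monomial n z \<beta>)"

text \<open>The factor t^{1/2} removes the leading t^{-1/2} of the c-function; what remains is one
  factor of a kappa-product.\<close>

definition kappa_root :: "lat \<Rightarrow> KZ" where
  "kappa_root \<beta> = rconst (t_root \<beta>) * c_root \<beta>"

lemma t_root_nonzero [simp]: "t_root \<beta> \<noteq> 0" and u_root_nonzero [simp]: "u_root \<beta> \<noteq> 0"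
  using U by (simp_all add: t_root_def u_root_def)

lemma rconst_nonzero: "a \<noteq> 0 \<Longrightarrow> rconst a \<noteq> 0"
  using rconst_eq_iff[of a 0] by simp

lemma t_root_Wfin: 
  assumes "v \<in> Wfin n" and i: "i \<in> {1..n}" shows "t_root (v (sroot n i)) = t_root (sroot n i)"
proof (cases "i = n")
  case True
  then show ?thesis using Wfin_short_roots[OF assms(1) sroot_short] n sroot_short by (simp add: t_root_def)
next
  case False
  then have long: "sroot n i \<in> long_roots n" using i by (intro sroot_long) auto
  show ?thesis using long Wfin_long_roots[OF assms(1) long] short_long_disjoint[of "sroot n i" n]
      short_long_disjoint[of "v (sroot n i)" n] unfolding t_root_def by auto
qed

lemma short_uminus: "- \<beta> \<in> short_roots n \<longleftrightarrow> \<beta> \<in> short_roots n"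
  using uminus_short_roots[of \<beta> n] uminus_short_roots[of "- \<beta>" n] by auto

lemma c_root_uminus:
  assumes "\<beta> \<in> roots n"
  shows "c_root (- \<beta>) = rconst (t_root \<beta>) + inverse (rconst (t_root \<beta>)) - c_root \<beta>"
  unfolding c_root_def monomial_uminus t_root_def[of "- \<beta>"] u_root_def[of "- \<beta>"] short_uminus
  unfolding t_root_def[symmetric] u_root_def[symmetric]
  by (rule c_quot_inverse) (use monomial_nonzero[of z n \<beta>] z_nonzero root_square_not_1[OF assms] in \<open>auto intro!: rconst_nonzero\<close>)

text \<open>A zero of the numerator would force the root monomial to be a constant built from the
  parameters. This permits the division in the recursion for the coefficients.\<close>

lemma c_root_nonzero:
  assumes "\<beta> \<in> roots n" shows "c_root \<beta> \<noteq> 0"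
proof
  assume "c_root \<beta> = 0"
  let ?x = "monomial n z \<beta>" and ?s = "rconst (t_root \<beta>) :: KZ" and ?u = "rconst (u_root \<beta>) :: KZ"
  have su: "?s \<noteq> 0" "?u \<noteq> 0" by (simp_all add: rconst_nonzero)
  have "1 - ?x ^ 2 \<noteq> 0" using root_square_not_1[OF assms] by simp
  then have "1 - ?s * ?u * ?x = 0 \<or> 1 + ?s * inverse ?u * ?x = 0"
    using \<open>c_root \<beta> = 0\<close> su by (auto simp: c_root_def c_quot_def)
  then have "?x = inverse (?s * ?u) \<or> ?x = - (?u * inverse ?s)"
  proof
    assume "1 - ?s * ?u * ?x = 0"
    then have "?s * ?u * ?x = 1" by simp
    then show ?thesis using inverse_unique[of "?s * ?u" ?x] by simp
  next
    assume "1 + ?s * inverse ?u * ?x = 0"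
    then have "?s * inverse ?u * ?x = - 1" by (simp add: add_eq_0_iff)
    then have "?s * ?x = - ?u" using su by (simp add: field_simps)
    then show ?thesis using su by (simp add: field_simps)
  qed
  then have "?x = rconst (inverse (t_root \<beta> * u_root \<beta>)) \<or> ?x = rconst (- (u_root \<beta> * inverse (t_root \<beta>)))"
    by (simp only: rconst_mult rconst_uminus rconst_inverse)
  then show False using root_not_const[OF assms] by blast
qed

end


section \<open>Operators on coefficient vectors\<close>

lemma two_term_commute:
  assumes "s1 (s2 v) = s2 (s1 v)" "c1 (s2 v) = c1 v" "c2 (s1 v) = c2 v"
  shows "two_term c1 s1 t (two_term c2 s2 u H) v = two_term c2 s2 u (two_term c1 s1 t H) v"
  using assms by (simp add: two_term_def algebra_simps)

text \<open>In T T H the coefficient of H at s v collects to t - t^{-1} times its coefficient in T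
  H, because the c-functions at v and s v have sum t + t^{-1}.\<close>

lemma two_term_quadratic:
  assumes "s (s v) = v" "c (s v) = t + inverse t - c v" "t \<noteq> 0"
  shows "two_term c s t (two_term c s t H) v = H v + (t - inverse t) * two_term c s t H v"
proof -
  define it where "it = inverse t"
  have "two_term c s t (two_term c s t H) v - (H v + (t - it) * two_term c s t H v) = (t * it - 1) * H v"
    unfolding two_term_def assms(1,2) it_def[symmetric] by (simp add: algebra_simps)
  moreover have "t * it = 1" using assms(3) by (simp add: it_def)
  ultimately show ?thesis by (simp add: it_def)
qed

lemma two_term_sum: "two_term c s t (\<lambda>v. \<Sum>w\<in>A. a w * H w v) v = (\<Sum>w\<in>A. a w * two_term c s t (H w) v)"
  by (simp add: two_term_def sum_distrib_left sum.distrib sum_subtractf algebra_simps)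

context root_functions
begin

definition T_op :: "nat \<Rightarrow> ((lat \<Rightarrow> lat) \<Rightarrow> KZ) \<Rightarrow> (lat \<Rightarrow> lat) \<Rightarrow> KZ" where
  "T_op i = two_term (\<lambda>v. c_root (v (sroot n i))) (\<lambda>v. v \<circ> refl n i) (rconst (t_root (sroot n i)))"

lemma T_op_apply:
  "T_op i G v = (c_root (v (sroot n i)) - inverse (rconst (t_root (sroot n i)))) * G v +
     (rconst (t_root (sroot n i)) + inverse (rconst (t_root (sroot n i))) - c_root (v (sroot n i))) * G (v \<circ> refl n i)"
  by (simp add: T_op_def two_term_def)

text \<open>Agreement is asked only on the Weyl group: elsewhere v need neither map roots to roots
  nor be additive, and the relations between c-functions fail to make sense.\<close>

definition eq_on_W :: "((lat \<Rightarrow> lat) \<Rightarrow> KZ) \<Rightarrow> ((lat \<Rightarrow> lat) \<Rightarrow> KZ) \<Rightarrow> bool" where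
  "eq_on_W G H \<longleftrightarrow> (\<forall>v\<in>Wfin n. G v = H v)"

lemma eq_on_W_refl: "eq_on_W G G" and eq_on_W_sym: "eq_on_W G H \<Longrightarrow> eq_on_W H G" and eq_on_W_trans: "eq_on_W G H \<Longrightarrow> eq_on_W H F \<Longrightarrow> eq_on_W G F"
  by (simp_all add: eq_on_W_def)

lemma c_root_comp_refl:
  assumes "v \<in> Wfin n" "i \<in> {1..n}"
  shows "c_root ((v \<circ> refl n i) (sroot n i)) = rconst (t_root (sroot n i)) + inverse (rconst (t_root (sroot n i))) - c_root (v (sroot n i))"
  unfolding comp_refl_sroot[OF assms] c_root_uminus[OF Wfin_roots[OF assms(1) sroot_roots[OF assms(2)]]]
  by (simp add: t_root_Wfin[OF assms])

lemma T_op_cong: "i \<in> {1..n} \<Longrightarrow> eq_on_W G H \<Longrightarrow> eq_on_W (T_op i G) (T_op i H)"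
  by (auto simp: eq_on_W_def T_op_def two_term_def)

lemma T_op_commute:
  assumes "1 \<le> i" "i + 2 \<le> j" "j \<le> n"
  shows "eq_on_W (T_op i (T_op j G)) (T_op j (T_op i G))"
  unfolding eq_on_W_def T_op_def
proof
  fix v assume "v \<in> Wfin n"
  show "two_term (\<lambda>v. c_root (v (sroot n i))) (\<lambda>v. v \<circ> refl n i) (rconst (t_root (sroot n i)))
      (two_term (\<lambda>v. c_root (v (sroot n j))) (\<lambda>v. v \<circ> refl n j) (rconst (t_root (sroot n j))) G) v =
    two_term (\<lambda>v. c_root (v (sroot n j))) (\<lambda>v. v \<circ> refl n j) (rconst (t_root (sroot n j)))
      (two_term (\<lambda>v. c_root (v (sroot n i))) (\<lambda>v. v \<circ> refl n i) (rconst (t_root (sroot n i))) G) v"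
  proof (rule two_term_commute)
    show "v \<circ> refl n j \<circ> refl n i = v \<circ> refl n i \<circ> refl n j"
      by (rule ext) (simp only: comp_apply refl_commute[OF assms])
  qed (simp_all only: comp_apply refl_sroot_commute[OF assms])
qed

lemma t_root_long: "\<beta> \<in> long_roots n \<Longrightarrow> t_root \<beta> = th" "\<beta> \<in> long_roots n \<Longrightarrow> u_root \<beta> = th"
  using short_long_disjoint[of \<beta> n] by (auto simp: t_root_def u_root_def)

lemma t_root_short: "\<beta> \<in> short_roots n \<Longrightarrow> t_root \<beta> = tnh" "\<beta> \<in> short_roots n \<Longrightarrow> u_root \<beta> = U"
  by (simp_all add: t_root_def u_root_def)

lemma roots_long_short: "\<beta> \<in> long_roots n \<Longrightarrow> \<beta> \<in> roots n" "\<beta> \<in> short_roots n \<Longrightarrow> \<beta> \<in> roots n"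
  by (simp_all add: roots_def)

text \<open>The roots involved are the images under v of \<alpha>_i, \<alpha>_{i+1} and their sum,
  all long, so \<open>c_quot_rel3\<close> applies to their monomials.\<close>

lemma T_op_braid_single:
  assumes i: "1 \<le> i" "i + 1 < n"
  shows "eq_on_W (T_op i (T_op (i + 1) (T_op i G))) (T_op (i + 1) (T_op i (T_op (i + 1) G)))"
  unfolding eq_on_W_def T_op_def
proof
  fix v assume v: "v \<in> Wfin n"
  let ?a = "sroot n i" and ?b = "sroot n (i + 1)" and ?s = "refl n i" and ?t = "refl n (i + 1)"
  have ij: "i \<in> {1..n}" "i + 1 \<in> {1..n}" "1 \<le> i + 1" using i by auto
  note e = refl_sroot_single[OF i]
  have long: "?a \<in> long_roots n" "?b \<in> long_roots n" using i by (auto intro!: sroot_long)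
  then have "lat_add ?a ?b \<in> long_roots n" using Wfin_long_roots[OF Wfin_refl[OF ij(1)] long(2)] e(1) by simp
  then have vl: "v ?a \<in> long_roots n" "v ?b \<in> long_roots n" "v (lat_add ?a ?b) \<in> long_roots n"
    using Wfin_long_roots[OF v] long by simp_all
  have tta: "t_root ?a = th" "t_root ?b = th" using t_root_long long by simp_all
  have cc: "c_root (v ?a) = c_quot (rconst th) (rconst th) (monomial n z (v ?a))" 
    "c_root (v ?b) = c_quot (rconst th) (rconst th) (monomial n z (v ?b))"
    "c_root (v (lat_add ?a ?b)) = c_quot (rconst th) (rconst th) (monomial n z (v ?a) * monomial n z (v ?b))"
    unfolding c_root_def t_root_long(1)[OF vl(1)] t_root_long(1)[OF vl(2)] t_root_long(1)[OF vl(3)] 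
      t_root_long(2)[OF vl(1)] t_root_long(2)[OF vl(2)] t_root_long(2)[OF vl(3)]
    by (simp_all add: Wfin_lat_add[OF v] monomial_lat_add[OF z_nonzero])
  have sq: "monomial n z (v ?a) ^ 2 \<noteq> 1" "monomial n z (v ?b) ^ 2 \<noteq> 1" "(monomial n z (v ?a) * monomial n z (v ?b)) ^ 2 \<noteq> 1"
    using vl[THEN roots_long_short(1), THEN root_square_not_1]
    by (simp_all add: Wfin_lat_add[OF v] monomial_lat_add[OF z_nonzero])
  show "two_term (\<lambda>v. c_root (v ?a)) (\<lambda>v. v \<circ> ?s) (rconst (t_root ?a))
     (two_term (\<lambda>v. c_root (v ?b)) (\<lambda>v. v \<circ> ?t) (rconst (t_root ?b))
       (two_term (\<lambda>v. c_root (v ?a)) (\<lambda>v. v \<circ> ?s) (rconst (t_root ?a)) G)) v =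
    two_term (\<lambda>v. c_root (v ?b)) (\<lambda>v. v \<circ> ?t) (rconst (t_root ?b))
     (two_term (\<lambda>v. c_root (v ?a)) (\<lambda>v. v \<circ> ?s) (rconst (t_root ?a))
       (two_term (\<lambda>v. c_root (v ?b)) (\<lambda>v. v \<circ> ?t) (rconst (t_root ?b)) G)) v"
    unfolding tta
  proof (rule two_term_braid3[where r = "c_root (v (lat_add ?a ?b))"])
    show "v \<circ> ?t \<circ> ?s \<circ> ?t = v \<circ> ?s \<circ> ?t \<circ> ?s"
      by (rule ext) (simp only: comp_apply refl_braid_single[OF i])
    show "c_root ((v \<circ> ?s) ?a) = rconst th + inverse (rconst th) - c_root (v ?a)"
      using c_root_comp_refl[OF v ij(1)] unfolding tta .
    show "c_root ((v \<circ> ?t) ?b) = rconst th + inverse (rconst th) - c_root (v ?b)"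
      using c_root_comp_refl[OF v ij(2)] unfolding tta .
    show "c_root (v ?a) * c_root (v ?b) + c_root (v (lat_add ?a ?b)) * (rconst th + inverse (rconst th) - c_root (v ?a) - c_root (v ?b)) = 1"
      unfolding cc by (rule c_quot_rel3[OF sq]) (simp add: rconst_nonzero)
  qed (simp_all only: comp_apply e comp_refl_refl[OF i(1)] comp_refl_refl[OF ij(3)] rconst_nonzero rvar_eq_0 simp_thms)
qed

text \<open>With \<alpha> = \<alpha>_i and \<beta> = \<alpha>_n, the images of \<alpha> and \<alpha>
  + 2\<beta> are long, those of \<beta> and \<alpha> + \<beta> short, which is the pattern of
  \<open>c_quot_rel4\<close>.\<close>

lemma T_op_braid_double:
  assumes i: "1 \<le> i" "i + 1 = n"
  shows "eq_on_W (T_op i (T_op n (T_op i (T_op n G)))) (T_op n (T_op i (T_op n (T_op i G))))"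
  unfolding eq_on_W_def T_op_def
proof
  fix v assume v: "v \<in> Wfin n"
  let ?a = "sroot n i" and ?b = "sroot n n" and ?s = "refl n i" and ?t = "refl n n"
  let ?ab = "lat_add ?a ?b" and ?abb = "lat_add (lat_add ?a ?b) ?b"
  have ij: "i \<in> {1..n}" "n \<in> {1..n}" using i by auto
  note e = refl_sroot_double[OF i]
  have long: "?a \<in> long_roots n" and short: "?b \<in> short_roots n" using i by (auto intro!: sroot_long sroot_short)
  have "?ab \<in> short_roots n" using Wfin_short_roots[OF Wfin_refl[OF ij(1)] short] e(1) by simp
  moreover have "?abb \<in> long_roots n" using Wfin_long_roots[OF Wfin_refl[OF ij(2)] long] e(2) by simp
  ultimately have vl: "v ?a \<in> long_roots n" "v ?abb \<in> long_roots n" and vs: "v ?b \<in> short_roots n" "v ?ab \<in> short_roots n"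
    using Wfin_long_roots[OF v] Wfin_short_roots[OF v] long short by simp_all
  have tta: "t_root ?a = th" "t_root ?b = tnh" using t_root_long long t_root_short short by simp_all
  have cc: "c_root (v ?a) = c_quot (rconst th) (rconst th) (monomial n z (v ?a))" 
    "c_root (v ?b) = c_quot (rconst tnh) (rconst U) (monomial n z (v ?b))"
    "c_root (v ?ab) = c_quot (rconst tnh) (rconst U) (monomial n z (v ?a) * monomial n z (v ?b))"
    "c_root (v ?abb) = c_quot (rconst th) (rconst th) (monomial n z (v ?a) * monomial n z (v ?b) ^ 2)"
    unfolding c_root_def t_root_long(1)[OF vl(1)] t_root_long(1)[OF vl(2)] t_root_short(1)[OF vs(1)] t_root_short(1)[OF vs(2)]
       t_root_long(2)[OF vl(1)] t_root_long(2)[OF vl(2)] t_root_short(2)[OF vs(1)] t_root_short(2)[OF vs(2)]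
    by (simp_all add: Wfin_lat_add[OF v] monomial_lat_add[OF z_nonzero] power2_eq_square mult.assoc)
  have sq: "monomial n z (v ?a) ^ 2 \<noteq> 1" "monomial n z (v ?b) ^ 2 \<noteq> 1" "(monomial n z (v ?a) * monomial n z (v ?b)) ^ 2 \<noteq> 1"
      "(monomial n z (v ?a) * monomial n z (v ?b) ^ 2) ^ 2 \<noteq> 1"
    using vl[THEN roots_long_short(1), THEN root_square_not_1] vs[THEN roots_long_short(2), THEN root_square_not_1]
    by (simp_all add: Wfin_lat_add[OF v] monomial_lat_add[OF z_nonzero] power2_eq_square[of "monomial n z (v ?b)"] mult.assoc)
  show "two_term (\<lambda>v. c_root (v ?a)) (\<lambda>v. v \<circ> ?s) (rconst (t_root ?a))
     (two_term (\<lambda>v. c_root (v ?b)) (\<lambda>v. v \<circ> ?t) (rconst (t_root ?b))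
       (two_term (\<lambda>v. c_root (v ?a)) (\<lambda>v. v \<circ> ?s) (rconst (t_root ?a))
         (two_term (\<lambda>v. c_root (v ?b)) (\<lambda>v. v \<circ> ?t) (rconst (t_root ?b)) G))) v =
    two_term (\<lambda>v. c_root (v ?b)) (\<lambda>v. v \<circ> ?t) (rconst (t_root ?b))
     (two_term (\<lambda>v. c_root (v ?a)) (\<lambda>v. v \<circ> ?s) (rconst (t_root ?a))
       (two_term (\<lambda>v. c_root (v ?b)) (\<lambda>v. v \<circ> ?t) (rconst (t_root ?b))
         (two_term (\<lambda>v. c_root (v ?a)) (\<lambda>v. v \<circ> ?s) (rconst (t_root ?a)) G))) v"
    unfolding tta
  proof (rule two_term_braid4[where r = "c_root (v ?abb)" and w = "c_root (v ?ab)"])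
    show "v \<circ> ?s \<circ> ?t \<circ> ?s \<circ> ?t = v \<circ> ?t \<circ> ?s \<circ> ?t \<circ> ?s"
      by (rule ext) (simp only: comp_apply refl_braid_double[OF i])
    show "c_root ((v \<circ> ?s) ?a) = rconst th + inverse (rconst th) - c_root (v ?a)"
      using c_root_comp_refl[OF v ij(1)] unfolding tta .
    show "c_root ((v \<circ> ?t) ?b) = rconst tnh + inverse (rconst tnh) - c_root (v ?b)"
      using c_root_comp_refl[OF v ij(2)] unfolding tta .
    have vs': "v \<circ> ?s \<in> Wfin n" "v \<circ> ?t \<in> Wfin n" using v ij by blast+
    show "c_root ((v \<circ> ?s \<circ> ?t) ?b) = rconst tnh + inverse (rconst tnh) - c_root (v ?ab)"
      using c_root_comp_refl[OF vs'(1) ij(2)] unfolding tta by (simp only: comp_apply e)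
    show "c_root ((v \<circ> ?t \<circ> ?s) ?a) = rconst th + inverse (rconst th) - c_root (v ?abb)"
      using c_root_comp_refl[OF vs'(2) ij(1)] unfolding tta by (simp only: comp_apply e)
    show "(rconst th + inverse (rconst th) - c_root (v ?a)) * c_root (v ?ab) + c_root (v ?a) * c_root (v ?b) +
        c_root (v ?abb) * (rconst tnh + inverse (rconst tnh) - c_root (v ?ab) - c_root (v ?b)) =
       rconst th * inverse (rconst tnh) + rconst tnh * inverse (rconst th)"
      unfolding cc by (rule c_quot_rel4[OF sq]) (simp_all add: rconst_nonzero U)
  qed (simp_all only: comp_apply e comp_refl_refl[OF i(1)] comp_refl_refl[OF n])
qed

lemma T_op_reduced_words:
  assumes "reduced_word n v is" "reduced_word n v js"
  shows "eq_on_W (fold T_op is G) (fold T_op js G)"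
  by (rule matsumoto[where op = T_op and E = eq_on_W, OF eq_on_W_sym eq_on_W_trans T_op_cong T_op_commute T_op_braid_single
        T_op_braid_double eq_on_W_refl assms])

definition delta :: "(lat \<Rightarrow> lat) \<Rightarrow> KZ" where
  "delta v = (if v = id then 1 else 0)"

text \<open>\<open>fold\<close> applies the first letter first, so the last letter of the word is
  outermost. Hence this is the coefficient vector of T for the inverse of w, while ascents w s_i
  correspond to applying \<open>T_op i\<close>.\<close>

definition T_vec :: "(lat \<Rightarrow> lat) \<Rightarrow> (lat \<Rightarrow> lat) \<Rightarrow> KZ" where
  "T_vec w = fold T_op (rword n w) delta"

lemma T_vec_ascent:
  assumes "w \<in> Wfin n" "i \<in> {1..n}" "pos (w (sroot n i))"
  shows "eq_on_W (T_vec (w \<circ> refl n i)) (T_op i (T_vec w))"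
proof -
  define u where "u = w \<circ> refl n i"
  have u: "u \<in> Wfin n" unfolding u_def using assms by (intro Wfin_comp Wfin_refl)
  have "u \<circ> refl n i = w" unfolding u_def using assms(2) by (intro comp_refl_refl) simp
  moreover have "\<not> pos (u (sroot n i))" 
    using pos_not_pos_uminus[OF assms(3)] unfolding u_def comp_refl_sroot[OF assms(1,2)] .
  ultimately have "reduced_word n u (rword n w @ [i])"
    unfolding reduced_word_snoc using u assms reduced_rword by simp
  from T_op_reduced_words[OF reduced_rword[OF u] this, of delta]
  show ?thesis by (simp add: T_vec_def u_def)
qed

text \<open>Triangularity: \<open>T_op i\<close> mixes only the values at v and v s_i, whose
  inversion numbers differ by one, so k operators carry the support from the identity to at most k
  inversions.\<close>

lemma fold_T_op_zero:
  assumes "set is \<subseteq> {1..n}" "v \<in> Wfin n" "length is < card (inversions n v)"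
  shows "fold T_op is delta v = 0"
  using assms
proof (induction "is" arbitrary: v rule: rev_induct)
  case Nil
  then have "v \<noteq> id" by (metis card.empty inversions_id less_irrefl list.size(3))
  then show ?case by (simp add: delta_def)
next
  case (snoc i js)
  have i: "i \<in> {1..n}" using snoc by simp
  define u where "u = v \<circ> refl n i"
  have u: "u \<in> Wfin n" unfolding u_def using i snoc.prems by (intro Wfin_comp Wfin_refl)
  have "u \<circ> refl n i = v" unfolding u_def using i by (intro comp_refl_refl) simp
  then have "card (inversions n v) \<le> Suc (card (inversions n u))"
    using card_inversions_le[OF u i] by simp
  then have "fold T_op js delta v = 0" "fold T_op js delta u = 0"
    using snoc.IH[of v] snoc.IH[of u] snoc.prems u by auto
  then show ?case unfolding fold_append comp_apply fold_simps id_apply T_op_apply u_def[symmetric] by simp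
qed

text \<open>At the top element the diagonal term vanishes by triangularity. The other term
  contributes the c-function at the opposite of v \<alpha>_i, which is the root gained by the last
  letter.\<close>

lemma fold_T_op_leading:
  assumes "reduced_word n v is"
  shows "fold T_op is delta v = (\<Prod>\<beta>\<in>inversions n v. c_root \<beta>)"
  using assms
proof (induction "is" arbitrary: v rule: rev_induct)
  case Nil
  then have "v = id" by (simp add: reduced_word_iff)
  then show ?case unfolding \<open>v = id\<close> inversions_id by (simp add: delta_def id_def)
next
  case (snoc i js)
  then have *: "i \<in> {1..n}" "v \<in> Wfin n" "reduced_word n (v \<circ> refl n i) js" "\<not> pos (v (sroot n i))"
    by (simp_all add: reduced_word_snoc)
  define u where "u = v \<circ> refl n i"
  have W: "u \<in> Wfin n" using * unfolding u_def by (intro Wfin_comp Wfin_refl)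
  have p: "pos (u (sroot n i))" using descent_comp_refl[OF *(2,1)] *(4) unfolding u_def by simp
  have v: "v = u \<circ> refl n i" unfolding u_def using *(1) by (intro comp_refl_refl[symmetric]) simp
  have js: "set js \<subseteq> {1..n}" "length js < card (inversions n v)"
    using snoc.prems by (auto simp: reduced_word_iff)
  have "fold T_op (js @ [i]) delta v = (rconst (t_root (sroot n i)) + inverse (rconst (t_root (sroot n i))) - c_root (v (sroot n i))) * fold T_op js delta u"
    using fold_T_op_zero[OF js(1) *(2) js(2)]
    unfolding fold_append comp_apply fold_simps id_apply T_op_apply u_def[symmetric] by simp
  also have "\<dots> = c_root (u (sroot n i)) * (\<Prod>\<beta>\<in>inversions n u. c_root \<beta>)"
    using snoc.IH[OF *(3)] c_root_comp_refl[OF *(2,1)] unfolding u_def[symmetric] by simp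
  also have "\<dots> = (\<Prod>\<beta>\<in>inversions n v. c_root \<beta>)"
    unfolding v inversions_ascent(1)[OF W *(1) p] using inversions_ascent(2)[OF W *(1) p] by simp
  finally show ?case .
qed

end


section \<open>The coefficients of the symmetrizers\<close>

text \<open>Tells whether the character takes its value -t^{-1/2} on generators of the length of
  \<beta>; short roots belong to T_n, long roots to the other T_i.\<close>

definition minus_type :: "nat \<Rightarrow> sym_type \<Rightarrow> lat \<Rightarrow> bool" where
  "minus_type n S \<beta> \<longleftrightarrow> (if \<beta> \<in> short_roots n then S \<in> {PlusMinus, Minus} else S \<in> {MinusPlus, Minus})"

lemma not_minus_type_Plus [simp]: "\<not> minus_type n Plus \<beta>"
  by (auto simp: minus_type_def)

definition root_sign :: "nat \<Rightarrow> sym_type \<Rightarrow> lat \<Rightarrow> KK" where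
  "root_sign n S \<beta> = (if minus_type n S \<beta> then -1 else 1)"

lemma minus_type_Wfin:
  assumes "1 \<le> n" "v \<in> Wfin n" "i \<in> {1..n}"
  shows "minus_type n S (v (sroot n i)) = minus_type n S (sroot n i)"
proof (cases "i = n")
  case True
  then show ?thesis using Wfin_short_roots[OF assms(2) sroot_short[OF assms(1)]] sroot_short[OF assms(1)]
    by (simp add: minus_type_def)
next
  case False
  then have long: "sroot n i \<in> long_roots n" using assms(3) by (intro sroot_long) auto
  show ?thesis
    using long Wfin_long_roots[OF assms(2) long] short_long_disjoint[of "sroot n i" n]
      short_long_disjoint[of "v (sroot n i)" n] by (auto simp: minus_type_def)
qed

lemma minus_type_sroot:
  assumes "i \<in> {1..n}"
  shows "minus_type n S (sroot n i) \<longleftrightarrow> (if i = n then S \<in> {PlusMinus, Minus} else S \<in> {MinusPlus, Minus})"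
proof (cases "i = n")
  case True
  then show ?thesis using sroot_short[of n] assms by (simp add: minus_type_def)
next
  case False
  then have "sroot n i \<in> long_roots n" using assms by (intro sroot_long) auto
  then show ?thesis using False short_long_disjoint[of "sroot n i" n] by (auto simp: minus_type_def)
qed

lemma power_length_filter:
  "s ^ length (filter P xs) = prod_list (map (\<lambda>i. if P i then s else 1) xs)" for s :: "'a::monoid_mult"
  by (induction xs) auto

lemma prod_list_map_mult: "prod_list (map (\<lambda>i. f i * g i) xs) = prod_list (map f xs) * prod_list (map g xs)"
  for f g :: "'b \<Rightarrow> 'a::comm_monoid_mult"
  by (induction xs) (auto simp: mult_ac)

lemma sgn_w_eq:
  assumes n: "1 \<le> n" and v: "v \<in> Wfin n"
  shows "sgn_w n S v = (\<Prod>\<beta>\<in>inversions n v. root_sign n S \<beta>)"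
proof -
  let ?w = "rword n v"
  have w: "reduced_word n v ?w" using reduced_rword[OF v] .
  then have set: "set ?w \<subseteq> {1..n}" by (simp add: reduced_word_def)
  define s d :: KK where "s = (if S \<in> {MinusPlus, Minus} then - 1 else 1)" and "d = (if S \<in> {PlusMinus, Minus} then - 1 else 1)"
  have "sgn_w n S v = s ^ len_s n v * d ^ len_d n v"
    by (cases S) (simp_all add: sgn_w_def s_def d_def power_add)
  also have "s ^ len_s n v = prod_list (map (\<lambda>i. if i < n then s else 1) ?w)"
    by (simp add: len_s_def power_length_filter)
  also have "d ^ len_d n v = prod_list (map (\<lambda>i. if i = n then d else 1) ?w)"
    by (simp add: len_d_def power_length_filter)
  also have "prod_list (map (\<lambda>i. if i < n then s else 1) ?w) * prod_list (map (\<lambda>i. if i = n then d else 1) ?w)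
     = prod_list (map (\<lambda>i. root_sign n S (sroot n i)) ?w)"
    unfolding prod_list_map_mult[symmetric]
  proof (intro arg_cong[where f = prod_list] map_cong refl)
    fix i assume "i \<in> set ?w"
    then have "i \<in> {1..n}" using set by blast
    then show "(if i < n then s else 1) * (if i = n then d else 1) = root_sign n S (sroot n i)"
      by (auto simp: root_sign_def minus_type_sroot s_def d_def)
  qed
  also have "\<dots> = (\<Prod>\<beta>\<in>inversions n v. root_sign n S \<beta>)"
    by (rule prod_list_reduced_word[OF w]) (simp add: root_sign_def minus_type_Wfin[OF n])
  finally show ?thesis .
qed

context root_functions
begin

definition chi_root :: "sym_type \<Rightarrow> lat \<Rightarrow> KK" where
  "chi_root S \<beta> = (if minus_type n S \<beta> then - inverse (t_root \<beta>) else t_root \<beta>)"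

lemma chi_root_Wfin: "v \<in> Wfin n \<Longrightarrow> i \<in> {1..n} \<Longrightarrow> chi_root S (v (sroot n i)) = chi_root S (sroot n i)"
  by (simp add: chi_root_def t_root_Wfin minus_type_Wfin n)

lemma chi_gen_eq:
  assumes "i \<in> {1..n}" shows "chi_gen n S i = chi_root S (sroot n i)"
proof (cases "i = n")
  case True
  then have "t_root (sroot n i) = tnh" using t_root_short sroot_short[OF n] by simp
  then show ?thesis using True assms by (cases S) (auto simp: chi_gen_def chi_root_def minus_type_sroot)
next
  case False
  then have "t_root (sroot n i) = th" using t_root_long sroot_long assms by simp
  then show ?thesis using False assms by (cases S) (auto simp: chi_gen_def chi_root_def minus_type_sroot)
qed

lemma chi_eq:
  assumes "v \<in> Wfin n" shows "chi n S v = (\<Prod>\<beta>\<in>inversions n v. chi_root S \<beta>)"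
proof -
  have w: "reduced_word n v (rword n v)" using reduced_rword[OF assms] .
  have "chi n S v = prod_list (map (\<lambda>i. chi_root S (sroot n i)) (rword n v))"
    unfolding chi_def using w by (intro arg_cong[where f = prod_list] map_cong refl chi_gen_eq) (auto simp: reduced_word_def)
  also have "\<dots> = (\<Prod>\<beta>\<in>inversions n v. chi_root S \<beta>)"
    by (rule prod_list_reduced_word[OF w chi_root_Wfin])
  finally show ?thesis .
qed

lemma chi_nonzero: "v \<in> Wfin n \<Longrightarrow> chi n S v \<noteq> 0"
  by (simp add: chi_eq chi_root_def)

lemma chi_ascent:
  assumes "w \<in> Wfin n" "i \<in> {1..n}" "pos (w (sroot n i))"
  shows "chi n S (w \<circ> refl n i) = chi_root S (sroot n i) * chi n S w"
proof -
  have W: "w \<circ> refl n i \<in> Wfin n" using assms by (intro Wfin_comp Wfin_refl)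
  show ?thesis
    unfolding chi_eq[OF W] chi_eq[OF assms(1)] inversions_ascent(1)[OF assms]
    using inversions_ascent(2)[OF assms] chi_root_Wfin[OF assms(1,2)] by simp
qed

text \<open>The group is cut into the cosets {w, w s_i}, each represented by its shorter
  element.\<close>

lemma sum_Wfin_ascents:
  fixes f :: "(lat \<Rightarrow> lat) \<Rightarrow> 'a::comm_monoid_add"
  assumes i: "i \<in> {1..n}"
  shows "(\<Sum>w\<in>Wfin n. f w) = (\<Sum>w\<in>{w \<in> Wfin n. pos (w (sroot n i))}. f w + f (w \<circ> refl n i))"
proof -
  let ?A = "{w \<in> Wfin n. pos (w (sroot n i))}" and ?B = "{w \<in> Wfin n. \<not> pos (w (sroot n i))}"
  have W: "w \<circ> refl n i \<in> Wfin n" if "w \<in> Wfin n" for w using i that by (intro Wfin_comp Wfin_refl)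
  have inv: "w \<circ> refl n i \<circ> refl n i = w" for w using i by (intro comp_refl_refl) simp
  have "(\<Sum>w\<in>Wfin n. f w) = (\<Sum>w\<in>?A \<union> ?B. f w)" by (rule sum.cong) auto
  also have "\<dots> = (\<Sum>w\<in>?A. f w) + (\<Sum>w\<in>?B. f w)"
    using finite_Wfin by (intro sum.union_disjoint) auto
  also have "(\<Sum>w\<in>?B. f w) = (\<Sum>w\<in>?A. f (w \<circ> refl n i))"
    by (rule sum.reindex_bij_witness[where i = "\<lambda>w. w \<circ> refl n i" and j = "\<lambda>w. w \<circ> refl n i"])
      (simp_all only: mem_Collect_eq inv W descent_comp_refl[OF _ i] simp_thms)
  finally show ?thesis by (simp add: sum.distrib)
qed

text \<open>The sum of \<chi>(T_w) T_w in coefficients. \<open>T_vec w\<close> belongs to the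
  inverse of w, which is harmless since \<chi> takes the same value on w and its inverse.\<close>

definition S_vec :: "sym_type \<Rightarrow> (lat \<Rightarrow> lat) \<Rightarrow> KZ" where
  "S_vec S v = (\<Sum>w\<in>Wfin n. rconst (chi n S w) * T_vec w v)"

text \<open>On a coset {w, w s_i} the operator acts by the regular representation of a rank-one
  Hecke algebra, and the weights of the two elements have ratio X, the character value. The
  contribution of each coset is then an eigenvector for X.\<close>

lemma S_vec_eigen:
  assumes i: "i \<in> {1..n}" and v: "v \<in> Wfin n"
  shows "T_op i (S_vec S) v = rconst (chi_root S (sroot n i)) * S_vec S v"
proof -
  let ?A = "{w \<in> Wfin n. pos (w (sroot n i))}"
  define t X :: KZ where "t = rconst (t_root (sroot n i))" and "X = rconst (chi_root S (sroot n i))"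
  have t0: "t \<noteq> 0" unfolding t_def by (simp add: rconst_nonzero)
  have X: "X = t \<or> X = - inverse t"
    unfolding X_def t_def chi_root_def by (simp add: rconst_uminus rconst_inverse)
  \<comment> \<open>Both possible character values are roots of the quadratic Hecke
    relation.\<close>
  then have X2: "X * X = 1 + (t - inverse t) * X" using t0 by (auto simp: algebra_simps)
  have T: "T_op i (T_vec (w \<circ> refl n i)) v = T_vec w v + (t - inverse t) * T_op i (T_vec w) v" 
    "T_vec (w \<circ> refl n i) v = T_op i (T_vec w) v" if w: "w \<in> ?A" for w
  proof -
    have *: "eq_on_W (T_vec (w \<circ> refl n i)) (T_op i (T_vec w))" using T_vec_ascent i w by blast
    then show "T_vec (w \<circ> refl n i) v = T_op i (T_vec w) v" using v by (simp add: eq_on_W_def)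
    have "T_op i (T_vec (w \<circ> refl n i)) v = T_op i (T_op i (T_vec w)) v"
      using T_op_cong[OF i *] v by (simp add: eq_on_W_def)
    also have "\<dots> = T_vec w v + (t - inverse t) * T_op i (T_vec w) v"
      unfolding T_op_def t_def
    proof (rule two_term_quadratic)
      show "v \<circ> refl n i \<circ> refl n i = v" using i by (intro comp_refl_refl) simp
      show "c_root ((v \<circ> refl n i) (sroot n i)) = rconst (t_root (sroot n i)) + inverse (rconst (t_root (sroot n i))) - c_root (v (sroot n i))"
        by (rule c_root_comp_refl[OF v i])
    qed (simp add: rconst_nonzero)
    finally show "T_op i (T_vec (w \<circ> refl n i)) v = T_vec w v + (t - inverse t) * T_op i (T_vec w) v" .
  qed
  have chi: "rconst (chi n S (w \<circ> refl n i)) = (X * rconst (chi n S w) :: KZ)" if "w \<in> ?A" for w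
    using chi_ascent[of w i S] i that by (simp add: X_def rconst_mult)
  have "T_op i (S_vec S) v = (\<Sum>w\<in>Wfin n. rconst (chi n S w) * T_op i (T_vec w) v)"
    unfolding S_vec_def T_op_def by (rule two_term_sum)
  also have "\<dots> = (\<Sum>w\<in>?A. rconst (chi n S w) * T_op i (T_vec w) v
      + rconst (chi n S (w \<circ> refl n i)) * T_op i (T_vec (w \<circ> refl n i)) v)"
    by (rule sum_Wfin_ascents[OF i])
  also have "\<dots> = (\<Sum>w\<in>?A. X * (rconst (chi n S w) * T_vec w v + rconst (chi n S (w \<circ> refl n i)) * T_vec (w \<circ> refl n i) v))"
  proof (rule sum.cong[OF HOL.refl])
    fix w assume w: "w \<in> ?A"
    define a M N :: KZ where "a = rconst (chi n S w)" and "M = T_vec w v" and "N = T_op i (T_vec w) v"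
    have "a * N + X * a * (M + (t - inverse t) * N) = a * (X * M) + a * N * (1 + (t - inverse t) * X)"
      by (simp add: algebra_simps)
    also have "\<dots> = X * (a * M + X * a * N)" unfolding X2[symmetric] by (simp add: algebra_simps)
    finally show "rconst (chi n S w) * T_op i (T_vec w) v + rconst (chi n S (w \<circ> refl n i)) * T_op i (T_vec (w \<circ> refl n i)) v
      = X * (rconst (chi n S w) * T_vec w v + rconst (chi n S (w \<circ> refl n i)) * T_vec (w \<circ> refl n i) v)"
      unfolding T[OF w] chi[OF w] a_def M_def N_def .
  qed
  also have "\<dots> = X * S_vec S v"
    unfolding S_vec_def sum_Wfin_ascents[OF i] by (simp add: sum_distrib_left)
  finally show ?thesis unfolding X_def .
qed

text \<open>Every w other than w_0 has fewer inversions, so its word is too short to reach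
  w_0.\<close>

lemma S_vec_w0: "S_vec S (w0 n) = rconst (chi n S (w0 n)) * (\<Prod>\<beta>\<in>{\<beta> \<in> roots n. pos \<beta>}. c_root \<beta>)"
proof -
  have w0: "w0 n \<in> Wfin n" using negation_Wfin by (simp add: w0_eq)
  have "T_vec w (w0 n) = 0" if w: "w \<in> Wfin n" "w \<noteq> w0 n" for w
  proof -
    have r: "reduced_word n w (rword n w)" by (rule reduced_rword[OF w(1)])
    have "card (inversions n w) \<noteq> card (inversions n (w0 n))"
    proof
      assume eq: "card (inversions n w) = card (inversions n (w0 n))"
      have "w = negation n"
        by (rule maximal_imp_negation[OF w(1)]) (use negation_maximal eq in \<open>simp add: w0_eq\<close>)
      then show False using w by (simp add: w0_eq)
    qed
    moreover have "card (inversions n w) \<le> card (inversions n (w0 n))"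
      using negation_maximal[OF w(1)] by (simp add: w0_eq)
    ultimately have "length (rword n w) < card (inversions n (w0 n))"
      using r by (simp add: reduced_word_iff)
    then show ?thesis unfolding T_vec_def using r by (intro fold_T_op_zero w0) (simp_all add: reduced_word_iff)
  qed
  then have "S_vec S (w0 n) = (\<Sum>w\<in>{w0 n}. rconst (chi n S w) * T_vec w (w0 n))"
    unfolding S_vec_def using w0 finite_Wfin by (intro sum.mono_neutral_right) auto
  then show ?thesis
    using fold_T_op_leading[OF reduced_rword[OF w0]] by (simp add: T_vec_def inversions_w0)
qed

text \<open>For each type, \<open>Kminus\<close> collects the factors that stand to the left of the symmetrizer: those of the root
  lengths on which the character takes the value $-t^{-1/2}$. Moving them past $\xi_w$ replaces them by their value at $w^{-1}$.\<close>

definition Kminus :: "sym_type \<Rightarrow> (lat \<Rightarrow> lat) \<Rightarrow> KZ" where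
  "Kminus S v = (\<Prod>\<beta>\<in>{\<beta> \<in> roots n. pos \<beta> \<and> minus_type n S \<beta>}. kappa_root (- v \<beta>))"

definition Kplus :: "sym_type \<Rightarrow> KZ" where
  "Kplus S = (\<Prod>\<beta>\<in>{\<beta> \<in> roots n. pos \<beta> \<and> \<not> minus_type n S \<beta>}. kappa_root \<beta>)"

text \<open>The coefficients of the symmetrizer placed between its kappa-products, as
  \<open>symmetrizer_psi\<close> shows.\<close>

definition R_vec :: "sym_type \<Rightarrow> (lat \<Rightarrow> lat) \<Rightarrow> KZ" where
  "R_vec S v = rconst (sgn_w n S v) * Kminus S v * Kplus S"

lemma minus_type_refl:
  assumes "i \<in> {1..n}" "\<beta> \<in> roots n" shows "minus_type n S (refl n i \<beta>) = minus_type n S \<beta>"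
proof -
  note W = Wfin_refl[OF assms(1)]
  consider "\<beta> \<in> short_roots n" | "\<beta> \<in> long_roots n" using assms by (auto simp: roots_def)
  then show ?thesis
  proof cases
    case 1 then show ?thesis using Wfin_short_roots[OF W 1] by (simp add: minus_type_def)
  next
    case 2 then show ?thesis using Wfin_long_roots[OF W 2] short_long_disjoint[of \<beta> n] short_long_disjoint[of "refl n i \<beta>" n]
      by (auto simp: minus_type_def)
  qed
qed

text \<open>s_i permutes the positive roots other than \<alpha>_i and keeps their lengths. So
  replacing v by v s_i can alter only the factor of \<alpha>_i, if that factor occurs, and Q is the
  product of all others.\<close>

lemma Kminus_step:
  assumes i: "i \<in> {1..n}" and v: "v \<in> Wfin n"
  obtains Q where "\<not> minus_type n S (sroot n i) \<Longrightarrow> Kminus S (v \<circ> refl n i) = Kminus S v"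
    "minus_type n S (sroot n i) \<Longrightarrow> Kminus S (v \<circ> refl n i) = kappa_root (v (sroot n i)) * Q"
    "minus_type n S (sroot n i) \<Longrightarrow> Kminus S v = kappa_root (- v (sroot n i)) * Q"
proof -
  let ?a = "sroot n i" and ?P = "{\<beta> \<in> roots n. pos \<beta> \<and> minus_type n S \<beta>}"
  define Q where "Q = (\<Prod>\<beta>\<in>?P - {?a}. kappa_root (- v \<beta>))"
  have r: "refl n i \<beta> \<in> ?P - {?a}" if b: "\<beta> \<in> ?P - {?a}" for \<beta>
  proof -
    have "pos (refl n i \<beta>)" using pos_refl[OF i] b by blast
    moreover have "refl n i \<beta> \<noteq> ?a"
    proof
      assume "refl n i \<beta> = ?a"
      then have "refl n i (refl n i \<beta>) = - ?a" using refl_sroot[OF i] by simp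
      then have "\<beta> = - ?a" using i by simp
      then show False using b pos_not_pos_uminus[OF pos_sroot[OF i]] by simp
    qed
    ultimately show ?thesis using b minus_type_refl[OF i] Wfin_roots[OF Wfin_refl[OF i]] by simp
  qed
  have Q: "(\<Prod>\<beta>\<in>?P - {?a}. kappa_root (- (v \<circ> refl n i) \<beta>)) = Q"
    unfolding Q_def comp_apply
    by (rule prod.reindex_bij_witness[where i = "refl n i" and j = "refl n i"]) (use r i in simp_all)
  show ?thesis
  proof (rule that[of Q])
    assume "\<not> minus_type n S ?a"
    then have "?P - {?a} = ?P" by auto
    then show "Kminus S (v \<circ> refl n i) = Kminus S v" using Q unfolding Kminus_def Q_def by simp
  next
    assume "minus_type n S ?a"
    then have P: "?P = insert ?a (?P - {?a})" using sroot_roots[OF i] pos_sroot[OF i] by auto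
    have fin: "finite (?P - {?a})" by simp
    show "Kminus S (v \<circ> refl n i) = kappa_root (v ?a) * Q"
      unfolding Kminus_def by (subst P, subst prod.insert[OF fin]) (simp_all only: Q comp_refl_sroot[OF v i] lat_uminus_uminus Diff_iff singleton_iff simp_thms)
    show "Kminus S v = kappa_root (- v ?a) * Q"
      unfolding Kminus_def by (subst P, subst prod.insert[OF fin]) (simp_all only: Q_def Diff_iff singleton_iff simp_thms)
  qed
qed

text \<open>For an ascent one inversion is added. A descent is an ascent read backwards, and the
  sign of a root is its own inverse.\<close>

lemma sgn_w_step:
  assumes i: "i \<in> {1..n}" and v: "v \<in> Wfin n"
  shows "sgn_w n S (v \<circ> refl n i) = root_sign n S (sroot n i) * sgn_w n S v"
proof -
  have asc: "sgn_w n S (w \<circ> refl n i) = root_sign n S (sroot n i) * sgn_w n S w"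
    if w: "w \<in> Wfin n" "pos (w (sroot n i))" for w
  proof -
    have W: "w \<circ> refl n i \<in> Wfin n" using w i by (intro Wfin_comp Wfin_refl)
    show ?thesis
      unfolding sgn_w_eq[OF n W] sgn_w_eq[OF n w(1)] inversions_ascent(1)[OF w(1) i w(2)]
      using inversions_ascent(2)[OF w(1) i w(2)] minus_type_Wfin[OF n w(1) i] by (simp add: root_sign_def)
  qed
  show ?thesis
  proof (cases "pos (v (sroot n i))")
    case False
    define u where "u = v \<circ> refl n i"
    have u: "u \<in> Wfin n" using v i unfolding u_def by (intro Wfin_comp Wfin_refl)
    have "pos (u (sroot n i))" using descent_comp_refl[OF v i] False unfolding u_def by simp
    note a = asc[OF u this]
    have vu: "u \<circ> refl n i = v" unfolding u_def using i by (intro comp_refl_refl) simp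
    have "root_sign n S (sroot n i) * root_sign n S (sroot n i) = 1" by (simp add: root_sign_def)
    then show ?thesis using a unfolding vu u_def[symmetric] by (simp add: mult.assoc[symmetric])
  qed (rule asc[OF v])
qed

text \<open>The scalar is fixed at w_0, where both sides are known. There R has the sign of w_0 and
  the factor \<chi>^+(T_{w_0}) from the kappa-factors, while S has the factor \<chi>(T_{w_0}).
  Simple reflections then carry the equality to the whole group.\<close>

lemma S_vec_eq_R_vec:
  assumes "v \<in> Wfin n"
  shows "rconst (sgn_w n S (w0 n) * chi n Plus (w0 n) * inverse (chi n S (w0 n))) * S_vec S v = R_vec S v"
proof -
  define a :: KZ where "a = rconst (sgn_w n S (w0 n) * chi n Plus (w0 n) * inverse (chi n S (w0 n)))"
  have w0: "w0 n \<in> Wfin n" using negation_Wfin by (simp add: w0_eq)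
  have step: "a * S_vec S (v \<circ> refl n i) = R_vec S (v \<circ> refl n i)"
    if i: "i \<in> {1..n}" and v: "v \<in> Wfin n" and eq: "a * S_vec S v = R_vec S v" for v i
  proof -
    define u where "u = v \<circ> refl n i"
    define t c d :: KZ where "t = rconst (t_root (sroot n i))" and "c = c_root (v (sroot n i))" and "d = c_root (- v (sroot n i))"
    have root: "v (sroot n i) \<in> roots n" using Wfin_roots[OF v sroot_roots[OF i]] .
    have d: "t + inverse t - c = d"
      unfolding t_def c_def d_def c_root_uminus[OF root] t_root_Wfin[OF v i] ..
    have d0: "d \<noteq> 0" unfolding d_def using c_root_nonzero uminus_roots[OF root] by blast
    obtain Q where Q: "\<not> minus_type n S (sroot n i) \<Longrightarrow> Kminus S u = Kminus S v"
      "minus_type n S (sroot n i) \<Longrightarrow> Kminus S u = kappa_root (v (sroot n i)) * Q"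
      "minus_type n S (sroot n i) \<Longrightarrow> Kminus S v = kappa_root (- v (sroot n i)) * Q"
      unfolding u_def using Kminus_step[OF i v, of S] by blast
    have eig: "(c - inverse t) * S_vec S v + d * S_vec S u = rconst (chi_root S (sroot n i)) * S_vec S v"
      using S_vec_eigen[OF i v, of S] unfolding T_op_apply t_def[symmetric] c_def[symmetric] u_def[symmetric] d .
    have sgn: "sgn_w n S u = root_sign n S (sroot n i) * sgn_w n S v"
      unfolding u_def by (rule sgn_w_step[OF i v])
    show ?thesis
    proof (cases "minus_type n S (sroot n i)")
      case False
      then have t: "rconst (chi_root S (sroot n i)) = t" by (simp add: chi_root_def t_def)
      have c: "c = t + inverse t - d" unfolding d[symmetric] by simp
      \<comment> \<open>With eigenvalue t, the coefficient of the value at v becomes t - (c -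
        t^{-1}) = d.\<close>
      have "d * S_vec S u = d * S_vec S v" using eig unfolding t c by (simp add: algebra_simps)
      then have "S_vec S u = S_vec S v" using d0 by simp
      moreover have "R_vec S u = R_vec S v"
        using False by (simp add: R_vec_def sgn root_sign_def Q(1))
      ultimately show ?thesis using eq unfolding u_def by simp
    next
      case True
      then have t: "rconst (chi_root S (sroot n i)) = - inverse t"
        by (simp add: chi_root_def t_def rconst_uminus rconst_inverse)
      \<comment> \<open>The eigenvalue -t^{-1} cancels the constant term of the operator, so only
        the two c-functions remain.\<close>
      have "d * S_vec S u = - (c * S_vec S v)" using eig unfolding t by (simp add: algebra_simps eq_neg_iff_add_eq_0)
      then have "a * (d * S_vec S u) = a * (- (c * S_vec S v))" by simp
      then have "d * (a * S_vec S u) = - (c * R_vec S v)" unfolding eq[symmetric] by (simp add: mult_ac)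
      also have "\<dots> = d * R_vec S u"
      proof -
        \<comment> \<open>Opposite roots have the same t, so the kappa-factors at them stand in the
          ratio of the c-functions.\<close>
        have "t_root (- v (sroot n i)) = t_root (v (sroot n i))" by (simp add: t_root_def short_uminus)
        then have "c * kappa_root (- v (sroot n i)) = d * kappa_root (v (sroot n i))"
          by (simp add: kappa_root_def c_def d_def)
        then have "c * (kappa_root (- v (sroot n i)) * Q) = d * (kappa_root (v (sroot n i)) * Q)"
          by (simp add: mult.assoc[symmetric])
        then have "c * Kminus S v = d * Kminus S u" using Q(2,3)[OF True] by simp
        then show ?thesis
          using True by (simp add: R_vec_def sgn root_sign_def rconst_uminus rconst_mult)
      qed
      finally show ?thesis using d0 unfolding u_def by simp
    qed
  qed
  have words: "set is \<subseteq> {1..n} \<Longrightarrow> a * S_vec S (w0 n \<circ> wact n is) = R_vec S (w0 n \<circ> wact n is)" for "is"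
  proof (induction "is" rule: rev_induct)
    case Nil
    let ?R = "{\<beta> \<in> roots n. pos \<beta>}"
    \<comment> \<open>Since w_0 is -1 on roots, the factors at - w_0 \<beta> are those at \<beta>,
      and they complete \<open>Kplus S\<close> to the product over all positive roots.\<close>
    have "Kminus S (w0 n) = (\<Prod>\<beta>\<in>{\<beta> \<in> roots n. pos \<beta> \<and> minus_type n S \<beta>}. kappa_root \<beta>)"
      unfolding Kminus_def by (rule prod.cong) (simp_all add: w0_eq negation_roots)
    also have "\<dots> * Kplus S = (\<Prod>\<beta>\<in>{\<beta> \<in> roots n. pos \<beta> \<and> minus_type n S \<beta>} \<union> {\<beta> \<in> roots n. pos \<beta> \<and> \<not> minus_type n S \<beta>}. kappa_root \<beta>)"
      unfolding Kplus_def by (rule prod.union_disjoint[symmetric]) auto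
    also have "\<dots> = (\<Prod>\<beta>\<in>?R. kappa_root \<beta>)" by (rule prod.cong) auto
    also have "\<dots> = rconst (chi n Plus (w0 n)) * (\<Prod>\<beta>\<in>?R. c_root \<beta>)"
    proof -
      have "chi n Plus (w0 n) = (\<Prod>\<beta>\<in>?R. t_root \<beta>)"
        unfolding chi_eq[OF w0] inversions_w0 by (simp add: chi_root_def)
      moreover have "rconst (\<Prod>\<beta>\<in>A. t_root \<beta>) = (\<Prod>\<beta>\<in>A. rconst (t_root \<beta>) :: KZ)" for A
        by (induction A rule: infinite_finite_induct) (simp_all add: rconst_mult)
      ultimately show ?thesis by (simp add: kappa_root_def prod.distrib)
    qed
    finally have R: "R_vec S (w0 n) = rconst (sgn_w n S (w0 n)) * (rconst (chi n Plus (w0 n)) * (\<Prod>\<beta>\<in>?R. c_root \<beta>))"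
      by (simp add: R_vec_def mult.assoc)
    have "rconst (inverse (chi n S (w0 n))) * rconst (chi n S (w0 n)) = (1 :: KZ)"
      using chi_nonzero[OF w0, of S] by (simp flip: rconst_mult)
    moreover have "x * y * w * (u * p) = x * (y * p) * (w * u)" for x y w u p :: KZ
      by (simp add: mult_ac)
    ultimately show ?case unfolding wact_Nil comp_id R S_vec_w0 a_def rconst_mult by simp
  next
    case (snoc i js)
    then have i: "i \<in> {1..n}" and js: "set js \<subseteq> {1..n}" by simp_all
    have eq: "w0 n \<circ> wact n (js @ [i]) = (w0 n \<circ> wact n js) \<circ> refl n i"
      by (rule ext) simp
    show ?case unfolding eq by (rule step[OF i Wfin_comp[OF w0 Wfin_wact[OF js]] snoc.IH[OF js]])
  qed
  \<comment> \<open>w_0 is an involution, so a word for w_0 v leads from w_0 to v.\<close>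
  have "w0 n \<circ> (w0 n \<circ> v) = v" by (rule ext) (simp add: w0_eq)
  moreover obtain "is" where "w0 n \<circ> v = wact n is" "set is \<subseteq> {1..n}"
    using Wfin_comp[OF w0 assms] unfolding Wfin_def by blast
  ultimately show ?thesis using words[of "is"] unfolding a_def by simp
qed

end


section \<open>The kappa-products as products over positive roots\<close>

lemma prod_positive_short_roots:
  "(\<Prod>\<beta>\<in>{\<beta> \<in> roots n. pos \<beta> \<and> \<beta> \<in> short_roots n}. f \<beta>) = (\<Prod>i=1..n. f (short_vec i 1))"
proof -
  have eq: "{\<beta> \<in> roots n. pos \<beta> \<and> \<beta> \<in> short_roots n} = (\<lambda>i. short_vec i 1) ` {1..n}"
  proof (intro equalityI subsetI)
    fix \<beta> assume "\<beta> \<in> {\<beta> \<in> roots n. pos \<beta> \<and> \<beta> \<in> short_roots n}"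
    then obtain i a where "\<beta> = short_vec i a" "i \<in> {1..n}" "a = 1 \<or> a = -1" "pos \<beta>"
      unfolding short_roots_def by blast
    then show "\<beta> \<in> (\<lambda>i. short_vec i 1) ` {1..n}" by auto
  qed (auto simp: roots_def intro: short_rootsI)
  have "inj_on (\<lambda>i. short_vec i 1) {1..n}"
    by (rule inj_onI) (metis short_vec_def zero_neq_one)
  then show ?thesis unfolding eq by (simp add: prod.reindex)
qed

lemma prod_positive_long_roots:
  "(\<Prod>\<beta>\<in>{\<beta> \<in> roots n. pos \<beta> \<and> \<beta> \<in> long_roots n}. f \<beta>) =
   (\<Prod>(i, j)\<in>{(i, j). 1 \<le> i \<and> i < j \<and> j \<le> n}. f (long_vec i j 1 (- 1)) * f (long_vec i j 1 1))"
proof -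
  let ?I = "{(i, j). 1 \<le> i \<and> i < j \<and> j \<le> n}"
  let ?g = "\<lambda>((i, j), b). long_vec i j 1 b"
  have fin: "finite ?I" by (rule finite_subset[of _ "{1..n} \<times> {1..n}"]) auto
  have eq: "{\<beta> \<in> roots n. pos \<beta> \<and> \<beta> \<in> long_roots n} = ?g ` (?I \<times> {-1, 1})"
  proof (intro equalityI subsetI)
    fix \<beta> assume "\<beta> \<in> {\<beta> \<in> roots n. pos \<beta> \<and> \<beta> \<in> long_roots n}"
    then have "\<beta> \<in> long_roots n" "pos \<beta>" by simp_all
    from this(1) obtain i j a b where *: "\<beta> = long_vec i j a b" "i \<in> {1..n}" "j \<in> {1..n}" "i < j" "a = 1 \<or> a = -1" "b = 1 \<or> b = -1"
      by (rule long_roots_cases)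
    then have "a = 1" using \<open>pos \<beta>\<close> by (auto simp: pos_long_vec)
    then have "\<beta> = ?g ((i, j), b)" "((i, j), b) \<in> ?I \<times> {-1, 1}" using * by auto
    then show "\<beta> \<in> ?g ` (?I \<times> {-1, 1})" by (rule image_eqI)
  next
    fix \<beta> assume "\<beta> \<in> ?g ` (?I \<times> {-1, 1})"
    then obtain i j b where *: "\<beta> = long_vec i j 1 b" "1 \<le> i" "i < j" "j \<le> n" "b = 1 \<or> b = -1" by auto
    then have "\<beta> \<in> long_roots n" by (auto intro!: long_rootsI)
    then show "\<beta> \<in> {\<beta> \<in> roots n. pos \<beta> \<and> \<beta> \<in> long_roots n}"
      using * by (simp add: roots_def pos_long_vec)
  qed
  have inj: "inj_on ?g (?I \<times> {-1, 1})"
  proof (rule inj_onI)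
    fix p q assume "p \<in> ?I \<times> {-1, 1}" "q \<in> ?I \<times> {-1, 1}" and pq: "?g p = ?g q"
    then obtain i j b k l c where *: "p = ((i, j), b)" "q = ((k, l), c)" "i < j" "k < l" "b \<noteq> 0" "c \<noteq> 0"
      by auto
    then have e: "long_vec i j 1 b m = long_vec k l 1 c m" for m using pq by simp
    have "i = k \<and> j = l" using e[of i] e[of j] e[of k] e[of l] * by (auto simp: long_vec_def split: if_splits)
    moreover from this have "b = c" using e[of j] * by (auto simp: long_vec_def split: if_splits)
    ultimately show "p = q" using * by simp
  qed
  have "(\<Prod>\<beta>\<in>?g ` (?I \<times> {-1, 1}). f \<beta>) = (\<Prod>p\<in>?I \<times> {-1, 1}. f (?g p))"
    unfolding prod.reindex[OF inj] comp_def ..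
  also have "\<dots> = (\<Prod>p\<in>?I. \<Prod>b\<in>{-1, 1}. f (?g (p, b)))"
    by (subst prod.Sigma) (use fin in \<open>auto simp: case_prod_unfold\<close>)
  also have "\<dots> = (\<Prod>(i, j)\<in>?I. f (long_vec i j 1 (- 1)) * f (long_vec i j 1 1))"
    by (rule prod.cong) auto
  finally show ?thesis unfolding eq .
qed

lemma cfun_eq_c_quot: "cfun s u x = c_quot (rconst s) (rconst u) x"
  by (simp add: cfun_def c_quot_def rconst_mult rconst_inverse)

context root_functions
begin

definition kap_dr :: "(nat \<Rightarrow> KZ) \<Rightarrow> KZ" where
  "kap_dr y = (\<Prod>i=1..n. (1 - rconst (tnh * U) * y i) * (1 + rconst (tnh * inverse U) * y i) / (1 - y i ^ 2))"

lemma kappa_root_short: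
  assumes "\<beta> \<in> short_roots n"
  shows "kappa_root \<beta> = (1 - rconst (tnh * U) * monomial n z \<beta>) * (1 + rconst (tnh * inverse U) * monomial n z \<beta>) / (1 - monomial n z \<beta> ^ 2)"
proof -
  have "rconst tnh \<noteq> (0 :: KZ)" by (simp add: rconst_nonzero)
  then have "rconst tnh * (inverse (rconst tnh) * x) = x" for x :: KZ
    by simp
  then show ?thesis unfolding kappa_root_def c_root_def t_root_short[OF assms] c_quot_def rconst_mult rconst_inverse .
qed

lemma kappa_root_long:
  assumes "\<beta> \<in> long_roots n"
  shows "kappa_root \<beta> = (1 - rconst (th ^ 2) * monomial n z \<beta>) / (1 - monomial n z \<beta>)"
proof -
  have th: "rconst th \<noteq> (0 :: KZ)" by (simp add: rconst_nonzero)
  have "rconst th * ((inverse (rconst th) - rconst th * x) / y) = (1 - rconst th ^ 2 * x) / y" for x y :: KZ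
    using th by (simp add: power2_eq_square right_diff_distrib mult.assoc)
  then show ?thesis
    unfolding kappa_root_def c_root_def t_root_long[OF assms] c_quot_equal[OF root_square_not_1[OF roots_long_short(1)[OF assms]] th] rconst_power .
qed

lemma prod_kappa_root_short:
  "(\<Prod>\<beta>\<in>{\<beta> \<in> roots n. pos \<beta> \<and> \<beta> \<in> short_roots n}. kappa_root \<beta>) = kap_dr z"
  "(\<Prod>\<beta>\<in>{\<beta> \<in> roots n. pos \<beta> \<and> \<beta> \<in> short_roots n}. kappa_root (- \<beta>)) = kap_dr (\<lambda>i. inverse (z i))"
  unfolding prod_positive_short_roots kap_dr_def
  by (auto intro!: prod.cong simp: kappa_root_short short_rootsI monomial_short_vec uminus_short_vec power_int_minus)

lemma prod_kappa_root_long: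
  "(\<Prod>\<beta>\<in>{\<beta> \<in> roots n. pos \<beta> \<and> \<beta> \<in> long_roots n}. kappa_root \<beta>) = kap_st n z"
  "(\<Prod>\<beta>\<in>{\<beta> \<in> roots n. pos \<beta> \<and> \<beta> \<in> long_roots n}. kappa_root (- \<beta>)) = kap_st n (\<lambda>i. inverse (z i))"
  unfolding prod_positive_long_roots kap_st_def
  by (auto intro!: prod.cong simp: kappa_root_long long_rootsI monomial_long_vec uminus_long_vec power_int_minus times_divide_times_eq mult.assoc)

end

section \<open>Congruences in the localized algebra\<close>

text \<open>Membership in the carrier is built in because \<open>hcls n\<close> is a homomorphism
  only there; chains of congruences then carry their side conditions along.\<close>

definition hcong :: "nat \<Rightarrow> dfree \<Rightarrow> dfree \<Rightarrow> bool" where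
  "hcong n a b \<longleftrightarrow> a \<in> carrier (dfree_alg n) \<and> b \<in> carrier (dfree_alg n) \<and> hcls n a = hcls n b"

lemma hcong_refl: "a \<in> carrier (dfree_alg n) \<Longrightarrow> hcong n a a"
  by (simp add: hcong_def)

lemma hcong_sym: "hcong n a b \<Longrightarrow> hcong n b a"
  by (simp add: hcong_def)

lemma hcong_trans [trans]: "hcong n a b \<Longrightarrow> hcong n b c \<Longrightarrow> hcong n a c"
  by (simp add: hcong_def)

lemma hcong_carrier: "hcong n a b \<Longrightarrow> a \<in> carrier (dfree_alg n)" "hcong n a b \<Longrightarrow> b \<in> carrier (dfree_alg n)"
  by (simp_all add: hcong_def)

lemma hcls_mult:
  assumes "1 \<le> n" "a \<in> carrier (dfree_alg n)" "b \<in> carrier (dfree_alg n)"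
  shows "hcls n (a * b) = hcls n a \<otimes>\<^bsub>Hloc n\<^esub> hcls n b"
  using ring_hom_mult[OF hcls_ring_hom(2)[OF assms(1)] assms(2,3)] by (simp add: free_alg_def)

lemma hcls_add:
  assumes "1 \<le> n" "a \<in> carrier (dfree_alg n)" "b \<in> carrier (dfree_alg n)"
  shows "hcls n (a + b) = hcls n a \<oplus>\<^bsub>Hloc n\<^esub> hcls n b"
  using ring_hom_add[OF hcls_ring_hom(2)[OF assms(1)] assms(2,3)] by (simp add: free_alg_def)

lemma hcong_mult: "1 \<le> n \<Longrightarrow> hcong n a b \<Longrightarrow> hcong n c d \<Longrightarrow> hcong n (a * c) (b * d)"
  by (simp add: hcong_def hcls_mult free_alg_mult)

lemma hcong_add: "1 \<le> n \<Longrightarrow> hcong n a b \<Longrightarrow> hcong n c d \<Longrightarrow> hcong n (a + c) (b + d)"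
  by (simp add: hcong_def hcls_add free_alg_add)

lemma scal_mult: "scal (a * b) = scal a * scal b"
  by (simp add: scal_def mult_single)

lemma scal_1 [simp]: "scal 1 = 1" by (simp add: scal_def)
lemma scal_0 [simp]: "scal 0 = 0" by (simp add: scal_def)
lemma scal_uminus: "scal (- a) = - scal a" by (simp add: scal_def single_uminus)

lemma scal_commute: "scal c * p = p * scal c" for c :: "'k::comm_ring_1"
proof (induction p rule: update_induct)
  case const
  then show ?case by simp
next
  case (update f k v)
  \<comment> \<open>The key k is fresh, so updating is the same as adding a monomial.\<close>
  have "Poly_Mapping.update k v f = f + Poly_Mapping.single k v"
    using update(1) by (intro poly_mapping_eqI) (auto simp: lookup_update lookup_add lookup_single in_keys_iff when_def)
  moreover have "scal c * Poly_Mapping.single k v = Poly_Mapping.single k v * scal c"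
    by (simp add: scal_def mult_single mult.commute)
  ultimately show ?case using update(3) by (simp add: distrib_left distrib_right)
qed

lemma free_alg_sum: "(\<And>i. i \<in> I \<Longrightarrow> f i \<in> carrier (free_alg G)) \<Longrightarrow> sum f I \<in> carrier (free_alg G)"
  for f :: "'i \<Rightarrow> ('g, 'k::ring_1) free"
  by (induction I rule: infinite_finite_induct) (auto intro!: free_alg_add simp: free_alg_scal[of 0, simplified])

lemma free_alg_prod_list: "set xs \<subseteq> carrier (free_alg G) \<Longrightarrow> prod_list xs \<in> carrier (free_alg G)"
  for xs :: "('g, 'k::ring_1) free list"
  by (induction xs) (auto intro: free_alg_one free_alg_mult)

lemma hcong_uminus: "1 \<le> n \<Longrightarrow> hcong n a b \<Longrightarrow> hcong n (- a) (- b)"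
  using hcong_mult[of n "scal (- 1)" "scal (- 1)" a b] hcong_refl[OF free_alg_scal[of "- 1" "dgens n"]]
  by (simp add: scal_uminus)

lemma hcong_diff: "1 \<le> n \<Longrightarrow> hcong n a b \<Longrightarrow> hcong n c d \<Longrightarrow> hcong n (a - c) (b - d)"
  using hcong_add[of n a b "- c" "- d"] hcong_uminus[of n c d] by simp

lemma hcong_sum: "1 \<le> n \<Longrightarrow> (\<And>i. i \<in> I \<Longrightarrow> hcong n (f i) (g i)) \<Longrightarrow> hcong n (sum f I) (sum g I)"
  by (induction I rule: infinite_finite_induct)
     (auto intro!: hcong_add hcong_refl simp: free_alg_scal[of 0, simplified])

lemma hcong_drel:
  assumes n: "1 \<le> n" and ab: "drel n a b" shows "hcong n a b"
proof -
  interpret ring "dfree_alg n" by (rule ring_free_alg)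
  have car: "a \<in> carrier (dfree_alg n)" "b \<in> carrier (dfree_alg n)" using drel_carrier[OF n ab] by simp_all
  have "{a - b | a b. drel n a b} \<subseteq> carrier (dfree_alg n)"
  proof safe
    fix c d assume "drel n c d"
    from free_alg_add[OF drel_carrier(1)[OF n this] free_alg_uminus[OF drel_carrier(2)[OF n this]]]
    show "c - d \<in> carrier (dfree_alg n)" by simp
  qed
  then have "a - b \<in> dideal n"
    unfolding dideal_def using genideal_self ab by blast
  \<comment> \<open>The quotient compares elements by the subtraction of the ring record, which has
    to be identified with that of the type.\<close>
  moreover have "\<ominus>\<^bsub>dfree_alg n\<^esub> b = - b"
    by (rule minus_equality) (use car free_alg_uminus in \<open>auto simp: free_alg_def\<close>)
  then have "a \<ominus>\<^bsub>dfree_alg n\<^esub> b = a - b"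
    by (simp add: a_minus_def) (simp add: free_alg_def)
  ultimately have "hcls n a = hcls n b"
    unfolding hcls_def using quotient_eq_iff_same_a_r_cos[OF dideal_ideal[OF n] car] by simp
  then show ?thesis using car by (simp add: hcong_def)
qed


section \<open>Inverses, and the setting shared by the X- and the Y-side\<close>

lemma winv_comp_refl:
  assumes "w \<in> Wfin n" "i \<in> {1..n}" shows "winv (refl n i \<circ> w) = winv w \<circ> refl n i"
  using o_inv_distrib[OF bij_Wfin[OF Wfin_refl[OF assms(2)]] bij_Wfin[OF assms(1)]] inv_refl[OF assms(2)] by simp

lemma winv_winv: "w \<in> Wfin n \<Longrightarrow> winv (winv w) = w"
  using bij_Wfin by (rule inv_inv_eq)

lemma comp_winv: "w \<in> Wfin n \<Longrightarrow> w \<circ> winv w = id"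
  using bij_is_surj[OF bij_Wfin] by (simp add: surj_iff)

lemma bij_betw_winv_Wfin: "bij_betw winv (Wfin n) (Wfin n)"
  by (rule bij_betwI[where g = winv]) (auto simp: winv_winv)

lemma prod_list_map_rword_winv:
  fixes F :: "nat \<Rightarrow> 'a::comm_monoid_mult"
  assumes v: "v \<in> Wfin n"
    and F: "\<And>u i. u \<in> Wfin n \<Longrightarrow> i \<in> {1..n} \<Longrightarrow> F' (u (sroot n i)) = F i"
  shows "(\<Prod>\<beta>\<in>inversions n (winv v). F' \<beta>) = (\<Prod>\<beta>\<in>inversions n v. F' \<beta>)"
proof -
  have rev: "prod_list (map F (rev js)) = prod_list (map F js)" for js
    by (induction js) (simp_all add: mult.commute)
  note r = reduced_rword[OF v]
  have "(\<Prod>\<beta>\<in>inversions n (winv v). F' \<beta>) = prod_list (map F (rev (rword n v)))"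
    by (rule prod_list_reduced_word[OF reduced_word_rev[OF r] F, symmetric])
  also have "\<dots> = (\<Prod>\<beta>\<in>inversions n v. F' \<beta>)"
    unfolding rev by (rule prod_list_reduced_word[OF r F])
  finally show ?thesis .
qed

text \<open>\<open>K\<close> embeds the function field as \<bbbK>(X) or \<bbbK>(Y), and
  \<open>x\<close> stands for \<xi> or \<eta>. The assumptions are the relations at the finite
  nodes, with z chosen such that T_i involves the c-function of z at \<alpha>_i itself: z is X^{-1}
  on one side and Y on the other.\<close>

locale hecke_side = root_functions +
  fixes K :: "KZ \<Rightarrow> dfree" and x :: "nat \<Rightarrow> dfree"
  assumes K_carrier: "f \<in> ratfuns {1..n} \<Longrightarrow> K f \<in> carrier (dfree_alg n)"
    and x_carrier: "i \<in> {1..n} \<Longrightarrow> x i \<in> carrier (dfree_alg n)"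
    and K_const: "hcong n (K (rconst c)) (scal c)"
    and K_add: "f \<in> ratfuns {1..n} \<Longrightarrow> g \<in> ratfuns {1..n} \<Longrightarrow> hcong n (K (f + g)) (K f + K g)"
    and K_mult: "f \<in> ratfuns {1..n} \<Longrightarrow> g \<in> ratfuns {1..n} \<Longrightarrow> hcong n (K (f * g)) (K f * K g)"
    and x_invol: "i \<in> {1..n} \<Longrightarrow> hcong n (x i * x i) 1"
    and x_far: "1 \<le> i \<Longrightarrow> i + 2 \<le> j \<Longrightarrow> j \<le> n \<Longrightarrow> hcong n (x i * x j) (x j * x i)"
    and x_single: "1 \<le> i \<Longrightarrow> i + 1 < n \<Longrightarrow> hcong n (x i * x (i + 1) * x i) (x (i + 1) * x i * x (i + 1))"
    and x_double: "1 \<le> i \<Longrightarrow> i + 1 = n \<Longrightarrow> hcong n (x i * x n * x i * x n) (x n * x i * x n * x i)"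
    and x_monomial: "i \<in> {1..n} \<Longrightarrow> \<beta> \<in> roots n \<Longrightarrow>
      hcong n (x i * K (monomial n z \<beta>)) (K (monomial n z (refl n i \<beta>)) * x i)"
    and T_x: "i \<in> {1..n} \<Longrightarrow> hcong n (TX i + scal (inverse (t_root (sroot n i)))) ((1 + x i) * K (c_root (sroot n i)))"
begin

abbreviation cong (infix "\<approx>" 50) where "a \<approx> b \<equiv> hcong n a b"
abbreviation C where "C \<equiv> carrier (dfree_alg n)"
abbreviation R where "R \<equiv> ratfuns {1..n}"

lemmas c_mult = hcong_mult[OF n] and c_add = hcong_add[OF n] and c_diff = hcong_diff[OF n] and c_sum = hcong_sum[OF n]
lemmas car = free_alg_mult free_alg_add free_alg_scal free_alg_one K_carrier x_carrier

lemma mult_left: "a \<in> C \<Longrightarrow> b \<approx> c \<Longrightarrow> a * b \<approx> a * c"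
  by (intro c_mult hcong_refl)

lemma mult_right: "a \<in> C \<Longrightarrow> b \<approx> c \<Longrightarrow> b * a \<approx> c * a"
  by (intro c_mult hcong_refl)

lemma TX_carrier: "i \<in> {1..n} \<Longrightarrow> TX i \<in> C"
  by (intro free_alg_gen) (auto simp: dgens_def)

lemma rconst_R: "rconst c \<in> R" by (rule ratfuns_const)

lemma monomial_R: "monomial n z \<mu> \<in> R"
proof -
  have "z i \<in> R" if "i \<in> {1..n}" for i
    using z that by (auto simp: rinv_def intro!: ratfuns_inverse ratfuns_var)
  then show ?thesis unfolding monomial_def by (intro ratfuns_prod ratfuns_powi)
qed

lemma c_root_R: "c_root \<beta> \<in> R" and kappa_root_R: "kappa_root \<beta> \<in> R"
proof -
  show "c_root \<beta> \<in> R" unfolding c_root_def c_quot_def by (intro ratfuns_intros monomial_R)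
  then show "kappa_root \<beta> \<in> R" unfolding kappa_root_def by (intro ratfuns_intros)
qed

text \<open>A relation between f and its reflected function g takes the place of an automorphism of
  the field. It is given on root monomials and closed under the field operations, which is enough to
  reach c-functions and kappa-products.\<close>

definition intertwines :: "nat \<Rightarrow> KZ \<Rightarrow> KZ \<Rightarrow> bool" where
  "intertwines i f g \<longleftrightarrow> f \<in> R \<and> g \<in> R \<and> x i * K f \<approx> K g * x i"

lemma intertwines_const: "i \<in> {1..n} \<Longrightarrow> intertwines i (rconst c) (rconst c)"
proof -
  assume i: "i \<in> {1..n}"
  have "x i * K (rconst c) \<approx> x i * scal c" by (intro mult_left x_carrier i K_const)
  also have "x i * scal c = scal c * x i" by (rule scal_commute[symmetric])
  also have "scal c * x i \<approx> K (rconst c) * x i" by (intro mult_right x_carrier i hcong_sym[OF K_const])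
  finally show ?thesis unfolding intertwines_def using rconst_R by simp
qed

lemma intertwines_add:
  assumes "i \<in> {1..n}" "intertwines i f g" "intertwines i f' g'" shows "intertwines i (f + f') (g + g')"
proof -
  have R: "f \<in> R" "f' \<in> R" "g \<in> R" "g' \<in> R" using assms by (simp_all add: intertwines_def)
  have "x i * K (f + f') \<approx> x i * (K f + K f')" by (intro mult_left x_carrier assms K_add R)
  also have "x i * (K f + K f') = x i * K f + x i * K f'" by (rule distrib_left)
  also have "\<dots> \<approx> K g * x i + K g' * x i" using assms by (intro c_add) (simp_all add: intertwines_def)
  also have "\<dots> = (K g + K g') * x i" by (rule distrib_right[symmetric])
  also have "\<dots> \<approx> K (g + g') * x i" by (intro mult_right x_carrier assms hcong_sym[OF K_add] R)
  finally show ?thesis unfolding intertwines_def using R by (simp add: ratfuns_add)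
qed

lemma intertwines_mult:
  assumes "i \<in> {1..n}" "intertwines i f g" "intertwines i f' g'" shows "intertwines i (f * f') (g * g')"
proof -
  have R: "f \<in> R" "f' \<in> R" "g \<in> R" "g' \<in> R" and t: "x i * K f \<approx> K g * x i" "x i * K f' \<approx> K g' * x i"
    using assms by (simp_all add: intertwines_def)
  have "x i * K (f * f') \<approx> x i * (K f * K f')" by (intro mult_left x_carrier assms K_mult R)
  also have "x i * (K f * K f') = (x i * K f) * K f'" by (rule mult.assoc[symmetric])
  also have "\<dots> \<approx> (K g * x i) * K f'" by (intro mult_right K_carrier R t)
  also have "\<dots> = K g * (x i * K f')" by (rule mult.assoc)
  also have "\<dots> \<approx> K g * (K g' * x i)" by (intro mult_left K_carrier R t)
  also have "\<dots> = (K g * K g') * x i" by (rule mult.assoc[symmetric])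
  also have "\<dots> \<approx> K (g * g') * x i" by (intro mult_right x_carrier assms hcong_sym[OF K_mult] R)
  finally show ?thesis unfolding intertwines_def using R by (simp add: ratfuns_mult)
qed

lemma K_inverse: "f \<in> R \<Longrightarrow> f \<noteq> 0 \<Longrightarrow> K f * K (inverse f) \<approx> 1"
proof -
  assume "f \<in> R" "f \<noteq> 0"
  then have "K (f * inverse f) \<approx> K f * K (inverse f)" by (intro K_mult ratfuns_inverse)
  moreover have "f * inverse f = rconst 1" using \<open>f \<noteq> 0\<close> by simp
  ultimately have "K f * K (inverse f) \<approx> K (rconst 1)" by (simp only: hcong_sym)
  also have "K (rconst 1) \<approx> scal 1" by (rule K_const)
  finally show ?thesis by simp
qed

lemma intertwines_inverse:
  assumes "i \<in> {1..n}" "intertwines i f g" "f \<noteq> 0" "g \<noteq> 0" shows "intertwines i (inverse f) (inverse g)"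
proof -
  have R: "f \<in> R" "g \<in> R" "inverse f \<in> R" "inverse g \<in> R" and t: "x i * K f \<approx> K g * x i"
    using assms by (simp_all add: intertwines_def ratfuns_inverse)
  have "K (inverse g) * x i \<approx> K (inverse g) * x i * (K f * K (inverse f))"
    using mult_left[OF _ K_inverse[OF R(1) assms(3)], of "K (inverse g) * x i"] assms(1) R
    by (simp add: car hcong_sym)
  also have "\<dots> = K (inverse g) * ((x i * K f) * K (inverse f))" by (simp add: mult.assoc)
  also have "\<dots> \<approx> K (inverse g) * ((K g * x i) * K (inverse f))"
    by (intro mult_left mult_right K_carrier R t)
  \<comment> \<open>g is written as a double inverse so that \<open>K_inverse\<close>, applied to
    \<open>inverse g\<close>, cancels from the left.\<close>
  also have "\<dots> = (K (inverse g) * K (inverse (inverse g))) * (x i * K (inverse f))" by (simp add: mult.assoc)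
  also have "\<dots> \<approx> 1 * (x i * K (inverse f))"
    by (intro mult_right free_alg_mult x_carrier assms K_carrier R K_inverse) (use assms in simp)
  finally show ?thesis unfolding intertwines_def using R hcong_sym by simp
qed

lemma intertwines_c_quot:
  assumes i: "i \<in> {1..n}" and y: "intertwines i y y'" "y ^ 2 \<noteq> 1" "y' ^ 2 \<noteq> 1"
  shows "intertwines i (c_quot (rconst s) (rconst u) y) (c_quot (rconst s) (rconst u) y')"
proof -
  \<comment> \<open>Differences and the quotient are rewritten through constants, sums, products and
    one inverse, the operations for which closure is established.\<close>
  have eq: "c_quot (rconst s) (rconst u) w = rconst (inverse s) * (((rconst 1 + rconst (- (s * u)) * w) *
      (rconst 1 + rconst (s * inverse u) * w)) * inverse (rconst 1 + rconst (- 1) * (w * w)))" for w :: KZ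
    by (simp add: c_quot_def divide_inverse power2_eq_square rconst_uminus rconst_mult rconst_inverse)
  have nz: "rconst 1 + rconst (- 1) * (w * w) \<noteq> 0" if "w ^ 2 \<noteq> 1" for w :: KZ
    using that by (simp add: rconst_uminus power2_eq_square)
  show ?thesis unfolding eq
    by (intro intertwines_mult intertwines_add intertwines_inverse intertwines_const i y nz)
qed

lemma intertwines_c_root:
  assumes "i \<in> {1..n}" "\<beta> \<in> roots n" shows "intertwines i (c_root \<beta>) (c_root (refl n i \<beta>))"
proof -
  have r: "refl n i \<beta> \<in> roots n" using Wfin_roots[OF Wfin_refl[OF assms(1)] assms(2)] .
  have "refl n i \<beta> \<in> short_roots n \<longleftrightarrow> \<beta> \<in> short_roots n"
    using Wfin_short_roots[OF Wfin_refl[OF assms(1)], of \<beta>] Wfin_short_roots[OF Wfin_refl[OF assms(1)], of "refl n i \<beta>"]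
      assms(1) by auto
  then have "t_root (refl n i \<beta>) = t_root \<beta>" "u_root (refl n i \<beta>) = u_root \<beta>" by (simp_all add: t_root_def u_root_def)
  moreover have "intertwines i (monomial n z \<beta>) (monomial n z (refl n i \<beta>))"
    unfolding intertwines_def using monomial_R x_monomial[OF assms] by simp
  ultimately show ?thesis unfolding c_root_def
    using intertwines_c_quot[OF assms(1) _ root_square_not_1[OF assms(2)] root_square_not_1[OF r]] by simp
qed

lemma intertwines_kappa_root: "i \<in> {1..n} \<Longrightarrow> \<beta> \<in> roots n \<Longrightarrow> intertwines i (kappa_root \<beta>) (kappa_root (refl n i \<beta>))"
proof -
  assume a: "i \<in> {1..n}" "\<beta> \<in> roots n"
  have "refl n i \<beta> \<in> short_roots n \<longleftrightarrow> \<beta> \<in> short_roots n"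
    using Wfin_short_roots[OF Wfin_refl[OF a(1)], of \<beta>] Wfin_short_roots[OF Wfin_refl[OF a(1)], of "refl n i \<beta>"]
      a(1) by auto
  then have "t_root (refl n i \<beta>) = t_root \<beta>" by (simp add: t_root_def)
  then show ?thesis unfolding kappa_root_def using intertwines_mult[OF a(1) intertwines_const[OF a(1)] intertwines_c_root[OF a]] by simp
qed

lemma intertwines_prod:
  assumes "i \<in> {1..n}" "\<And>\<beta>. \<beta> \<in> A \<Longrightarrow> intertwines i (f \<beta>) (g \<beta>)" shows "intertwines i (\<Prod>\<beta>\<in>A. f \<beta>) (\<Prod>\<beta>\<in>A. g \<beta>)"
  using assms(2)
  by (induction A rule: infinite_finite_induct) (use intertwines_const[OF assms(1), of 1] intertwines_mult[OF assms(1)] in auto)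

definition x_word :: "nat list \<Rightarrow> dfree" where
  "x_word js = prod_list (map x js)"

definition x_elem :: "(lat \<Rightarrow> lat) \<Rightarrow> dfree" where
  "x_elem w = x_word (rword n w)"

lemma x_word_carrier: "set js \<subseteq> {1..n} \<Longrightarrow> x_word js \<in> C"
  unfolding x_word_def by (rule free_alg_prod_list) (use x_carrier in auto)

lemma rword_set: "w \<in> Wfin n \<Longrightarrow> set (rword n w) \<subseteq> {1..n}"
  using reduced_rword by (simp add: reduced_word_iff)

lemma wact_rword: "w \<in> Wfin n \<Longrightarrow> wact n (rword n w) = w"
  using reduced_rword by (simp add: reduced_word_iff)

lemma x_elem_carrier: "w \<in> Wfin n \<Longrightarrow> x_elem w \<in> C"
  unfolding x_elem_def by (intro x_word_carrier rword_set)

text \<open>\<phi> is a family of functions along which each simple reflection acts by left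
  translation of the index. Pushing a word through then moves the index from the identity to the
  element of the word.\<close>

lemma x_word_intertwines:
  assumes "\<And>v i. v \<in> Wfin n \<Longrightarrow> i \<in> {1..n} \<Longrightarrow> intertwines i (\<phi> v) (\<phi> (refl n i \<circ> v))" "set js \<subseteq> {1..n}" "\<phi> id \<in> R"
  shows "x_word js * K (\<phi> id) \<approx> K (\<phi> (wact n js)) * x_word js"
  using assms(2)
proof (induction js)
  case Nil
  show ?case unfolding wact_Nil x_word_def list.map prod_list.Nil mult_1 mult_1_right
    by (rule hcong_refl[OF K_carrier[OF assms(3)]])
next
  case (Cons i js)
  then have i: "i \<in> {1..n}" and js: "set js \<subseteq> {1..n}" by simp_all
  have W: "wact n js \<in> Wfin n" using js by (rule Wfin_wact)
  note t = assms(1)[OF W i, unfolded intertwines_def]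
  have "x_word (i # js) * K (\<phi> id) = x i * (x_word js * K (\<phi> id))" by (simp add: x_word_def mult.assoc)
  also have "\<dots> \<approx> x i * (K (\<phi> (wact n js)) * x_word js)" by (intro mult_left x_carrier i Cons.IH js)
  also have "\<dots> = (x i * K (\<phi> (wact n js))) * x_word js" by (rule mult.assoc[symmetric])
  also have "\<dots> \<approx> (K (\<phi> (refl n i \<circ> wact n js)) * x i) * x_word js" using t by (intro mult_right x_word_carrier js) blast
  also have "\<dots> = K (\<phi> (wact n (i # js))) * x_word (i # js)" by (simp add: x_word_def mult.assoc)
  finally show ?case .
qed

lemma x_elem_c_root:
  assumes w: "w \<in> Wfin n" and \<beta>: "\<beta> \<in> roots n"
  shows "K (c_root \<beta>) * x_elem w \<approx> x_elem w * K (c_root (winv w \<beta>))"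
proof -
  have u: "winv w \<beta> \<in> roots n" using Wfin_roots[OF inv_Wfin[OF w] \<beta>] .
  have "x_word (rword n w) * K (c_root (id (winv w \<beta>))) \<approx> K (c_root (wact n (rword n w) (winv w \<beta>))) * x_word (rword n w)"
  \<comment> \<open>The family starts at the inverse image of \<beta> and ends at \<beta>
    itself.\<close>
  proof (rule x_word_intertwines[where \<phi> = "\<lambda>v. c_root (v (winv w \<beta>))"])
    show "intertwines i (c_root (v (winv w \<beta>))) (c_root ((refl n i \<circ> v) (winv w \<beta>)))" if "v \<in> Wfin n" "i \<in> {1..n}" for v i
      using intertwines_c_root[OF that(2) Wfin_roots[OF that(1) u]] by simp
  qed (rule rword_set[OF w], rule c_root_R)
  moreover have "wact n (rword n w) (winv w \<beta>) = \<beta>"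
    using fun_cong[OF comp_winv[OF w], of \<beta>] unfolding wact_rword[OF w] by (simp only: comp_apply id_apply)
  ultimately show ?thesis unfolding x_elem_def by (simp only: id_apply hcong_sym)
qed

lemma Kminus_R: "Kminus S v \<in> R" and Kplus_R: "Kplus S \<in> R"
  unfolding Kminus_def Kplus_def by (intro ratfuns_prod kappa_root_R)+

lemma x_elem_Kminus:
  assumes w: "w \<in> Wfin n"
  shows "K (Kminus S id) * x_elem w \<approx> x_elem w * K (Kminus S (winv w))"
proof -
  have "x_word (rword n w) * K (Kminus S (id \<circ> winv w)) \<approx> K (Kminus S (wact n (rword n w) \<circ> winv w)) * x_word (rword n w)"
  proof (rule x_word_intertwines[where \<phi> = "\<lambda>v. Kminus S (v \<circ> winv w)"])
    fix v i assume v: "v \<in> Wfin n" and i: "i \<in> {1..n}"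
    have W: "v \<circ> winv w \<in> Wfin n" using v inv_Wfin[OF w] by (rule Wfin_comp)
    show "intertwines i (Kminus S (v \<circ> winv w)) (Kminus S (refl n i \<circ> v \<circ> winv w))"
      unfolding Kminus_def
    proof (rule intertwines_prod[OF i])
      fix \<beta> assume "\<beta> \<in> {\<beta> \<in> roots n. pos \<beta> \<and> minus_type n S \<beta>}"
      then have "- (v \<circ> winv w) \<beta> \<in> roots n" by (intro uminus_roots Wfin_roots[OF W]) simp
      from intertwines_kappa_root[OF i this] show "intertwines i (kappa_root (- (v \<circ> winv w) \<beta>)) (kappa_root (- (refl n i \<circ> v \<circ> winv w) \<beta>))"
        unfolding Wfin_uminus[OF Wfin_refl[OF i]] by simp
    qed
  qed (rule rword_set[OF w], rule Kminus_R)
  then show ?thesis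
    unfolding x_elem_def wact_rword[OF w] comp_winv[OF w] id_comp by (rule hcong_sym)
qed

lemma fold_x_x_word: "fold (\<lambda>i a. x i * a) js 1 = x_word (rev js)"
  by (induction js rule: rev_induct) (simp_all add: x_word_def)

text \<open>Matsumoto's theorem for left multiplications; \<open>fold\<close> prepends the letters
  one by one, hence the reversed words.\<close>

lemma x_reduced_words:
  assumes "reduced_word n v is" "reduced_word n v js" shows "x_word (rev is) \<approx> x_word (rev js)"
proof -
  have "fold (\<lambda>i a. x i * a) is 1 \<approx> fold (\<lambda>i a. x i * a) js 1"
  proof (rule matsumoto[where E = cong and op = "\<lambda>i a. x i * a", OF _ _ _ _ _ _ _ assms])
    show "b \<approx> a" if "a \<approx> b" for a b using that by (rule hcong_sym)
    show "a \<approx> c" if "a \<approx> b" "b \<approx> c" for a b c using that by (rule hcong_trans)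
  next
    fix i j a assume *: "1 \<le> i" "i + 2 \<le> j" "j \<le> n" "a \<approx> a"
    show "x i * (x j * a) \<approx> x j * (x i * a)"
      unfolding mult.assoc[symmetric] by (intro mult_right x_far * hcong_carrier(1)[OF *(4)])
  next
    fix i a assume *: "1 \<le> i" "i + 1 < n" "a \<approx> a"
    show "x i * (x (i + 1) * (x i * a)) \<approx> x (i + 1) * (x i * (x (i + 1) * a))"
      unfolding mult.assoc[symmetric] by (intro mult_right x_single * hcong_carrier(1)[OF *(3)])
  next
    fix i a assume *: "1 \<le> i" "i + 1 = n" "a \<approx> a"
    show "x i * (x n * (x i * (x n * a))) \<approx> x n * (x i * (x n * (x i * a)))"
      unfolding mult.assoc[symmetric] by (intro mult_right x_double * hcong_carrier(1)[OF *(3)])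
  next
    show "x i * a \<approx> x i * b" if "i \<in> {1..n}" "a \<approx> b" for i a b
      using that by (intro mult_left x_carrier)
  qed (rule hcong_refl[OF free_alg_one])
  then show ?thesis by (simp only: fold_x_x_word)
qed

lemma x_x_elem_ascent:
  assumes w: "w \<in> Wfin n" and i: "i \<in> {1..n}" and p: "pos (winv w (sroot n i))"
  shows "x i * x_elem w \<approx> x_elem (refl n i \<circ> w)"
proof -
  define u where "u = winv w \<circ> refl n i"
  have W: "refl n i \<circ> w \<in> Wfin n" using w i by (intro Wfin_comp Wfin_refl)
  have u: "u = winv (refl n i \<circ> w)" unfolding u_def winv_comp_refl[OF w i] ..
  have "u \<in> Wfin n" unfolding u using W by (rule inv_Wfin)
  moreover have "u \<circ> refl n i = winv w" unfolding u_def using i by (intro comp_refl_refl) simp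
  moreover have "\<not> pos (u (sroot n i))"
    using p unfolding u_def comp_refl_sroot[OF inv_Wfin[OF w] i] by (rule pos_not_pos_uminus)
  ultimately have "reduced_word n u (rev (rword n w) @ [i])"
    unfolding reduced_word_snoc using i reduced_word_rev[OF reduced_rword[OF w]] by (simp only: simp_thms)
  from x_reduced_words[OF this reduced_word_rev[OF reduced_rword[OF W], folded u]]
  show ?thesis by (simp only: x_elem_def x_word_def rev_append rev_rev_ident rev.simps append_Nil append_Cons list.map prod_list.Cons)
qed

text \<open>\<open>x_elem\<close> uses one chosen reduced word for each element. For an ascent the
  extended word is again reduced; a descent reduces to this by x_i^2 = 1.\<close>

lemma x_x_elem:
  assumes w: "w \<in> Wfin n" and i: "i \<in> {1..n}"
  shows "x i * x_elem w \<approx> x_elem (refl n i \<circ> w)"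
proof (cases "pos (winv w (sroot n i))")
  case True
  then show ?thesis by (rule x_x_elem_ascent[OF w i])
next
  case False
  define u where "u = refl n i \<circ> w"
  have W: "u \<in> Wfin n" unfolding u_def using w i by (intro Wfin_comp Wfin_refl)
  have w_eq: "refl n i \<circ> u = w" unfolding u_def using i by (intro refl_comp_refl) simp
  have "pos (winv u (sroot n i))"
    unfolding u_def winv_comp_refl[OF w i] using descent_comp_refl[OF inv_Wfin[OF w] i] False by (simp only: simp_thms)
  from x_x_elem_ascent[OF W i this] have a: "x i * x_elem u \<approx> x_elem w" unfolding w_eq .
  have "x i * x_elem w \<approx> x i * (x i * x_elem u)" by (intro mult_left x_carrier i hcong_sym[OF a])
  also have "x i * (x i * x_elem u) = (x i * x i) * x_elem u" by (rule mult.assoc[symmetric])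
  also have "\<dots> \<approx> 1 * x_elem u" by (intro mult_right x_elem_carrier W x_invol i)
  finally show ?thesis unfolding u_def by simp
qed

section \<open>Realizing coefficient vectors in the algebra\<close>

lemma K_uminus: "f \<in> R \<Longrightarrow> K (- f) \<approx> - K f"
proof -
  assume f: "f \<in> R"
  have "K (rconst (- 1) * f) \<approx> K (rconst (- 1)) * K f" by (intro K_mult f rconst_R)
  also have "\<dots> \<approx> scal (- 1) * K f" by (intro mult_right K_carrier f K_const)
  finally show ?thesis by (simp add: rconst_uminus scal_uminus)
qed

lemma K_diff: "f \<in> R \<Longrightarrow> g \<in> R \<Longrightarrow> K (f - g) \<approx> K f - K g"
proof -
  assume f: "f \<in> R" "g \<in> R"
  have "K (f + - g) \<approx> K f + K (- g)" by (intro K_add f ratfuns_uminus)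
  also have "\<dots> \<approx> K f + - K g" by (intro c_add hcong_refl K_carrier f K_uminus)
  finally show ?thesis by simp
qed

lemma scal_K: "f \<in> R \<Longrightarrow> scal c * K f \<approx> K (rconst c * f)"
proof -
  assume f: "f \<in> R"
  have "scal c * K f \<approx> K (rconst c) * K f" by (intro mult_right K_carrier f hcong_sym[OF K_const])
  also have "\<dots> \<approx> K (rconst c * f)" by (intro hcong_sym[OF K_mult] f rconst_R)
  finally show ?thesis .
qed

text \<open>The passage from vectors to the algebra. Equal vectors give equal elements; every
  argument uses this direction only.\<close>

definition psi :: "((lat \<Rightarrow> lat) \<Rightarrow> KZ) \<Rightarrow> dfree" where
  "psi G = (\<Sum>w\<in>Wfin n. x_elem w * K (G (winv w)))"

definition rational_vec :: "((lat \<Rightarrow> lat) \<Rightarrow> KZ) \<Rightarrow> bool" where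
  "rational_vec G \<longleftrightarrow> (\<forall>v\<in>Wfin n. G v \<in> R)"

lemma psi_carrier: "rational_vec G \<Longrightarrow> psi G \<in> C"
  unfolding psi_def by (intro free_alg_sum free_alg_mult x_elem_carrier K_carrier) (auto simp: rational_vec_def)

lemma psi_eq_on_W: "eq_on_W G H \<Longrightarrow> psi G = psi H"
  unfolding psi_def by (rule sum.cong) (simp_all add: eq_on_W_def inv_Wfin)

lemma rational_vec_T_op:
  assumes "i \<in> {1..n}" "rational_vec G" shows "rational_vec (T_op i G)"
  unfolding rational_vec_def
proof
  fix v assume v: "v \<in> Wfin n"
  have W: "v \<circ> refl n i \<in> Wfin n" using v assms by (intro Wfin_comp Wfin_refl)
  have "G v \<in> R" "G (v \<circ> refl n i) \<in> R" using assms(2) v W by (auto simp: rational_vec_def)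
  then show "T_op i G v \<in> R" unfolding T_op_apply
    by (intro ratfuns_add ratfuns_mult ratfuns_diff ratfuns_inverse c_root_R rconst_R)
qed

text \<open>T_i is (1 + x_i) times the c-function at \<alpha>_i, minus t^{-1/2}. Past x_w the
  c-function moves to the root w^{-1} \<alpha>_i, and x_i x_w is the element of s_i w.\<close>

lemma TX_term:
  assumes i: "i \<in> {1..n}" and w: "w \<in> Wfin n" and g: "g \<in> R"
  defines "c \<equiv> c_root (winv w (sroot n i))" and "b \<equiv> inverse (t_root (sroot n i))"
  shows "TX i * (x_elem w * K g) \<approx> x_elem w * K (c * g) + x_elem (refl n i \<circ> w) * K (c * g) - x_elem w * K (rconst b * g)"
proof -
  let ?d = "c_root (sroot n i)"
  note cars = x_elem_carrier[OF w] K_carrier[OF g] K_carrier[OF c_root_R] x_carrier[OF i]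
  have W: "refl n i \<circ> w \<in> Wfin n" using w i by (intro Wfin_comp Wfin_refl)
  have cg: "c * g \<in> R" unfolding c_def by (intro ratfuns_mult c_root_R g)
  have "(TX i + scal b) - scal b \<approx> (1 + x i) * K ?d - scal b"
    unfolding b_def by (intro c_diff T_x i hcong_refl free_alg_scal)
  then have T: "TX i \<approx> (1 + x i) * K ?d - scal b" by simp
  have Kc: "(K ?d * x_elem w) * K g \<approx> x_elem w * K (c * g)"
  proof -
    have "(K ?d * x_elem w) * K g \<approx> (x_elem w * K c) * K g"
      unfolding c_def by (intro mult_right cars x_elem_c_root w sroot_roots i)
    also have "\<dots> = x_elem w * (K c * K g)" by (rule mult.assoc)
    also have "\<dots> \<approx> x_elem w * K (c * g)"
      unfolding c_def by (intro mult_left cars hcong_sym[OF K_mult] c_root_R g)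
    finally show ?thesis .
  qed
  have "TX i * (x_elem w * K g) \<approx> ((1 + x i) * K ?d - scal b) * (x_elem w * K g)"
    by (intro mult_right free_alg_mult cars T)
  also have "\<dots> = (K ?d * x_elem w) * K g + x i * ((K ?d * x_elem w) * K g) - scal b * x_elem w * K g"
    by (simp add: algebra_simps)
  also have "\<dots> = (K ?d * x_elem w) * K g + x i * ((K ?d * x_elem w) * K g) - x_elem w * (scal b * K g)"
    by (simp add: scal_commute[of b "x_elem w"] mult.assoc)
  also have "\<dots> \<approx> x_elem w * K (c * g) + x i * (x_elem w * K (c * g)) - x_elem w * K (rconst b * g)"
    by (intro c_diff c_add mult_left cars Kc scal_K g)
  also have "\<dots> = x_elem w * K (c * g) + (x i * x_elem w) * K (c * g) - x_elem w * K (rconst b * g)"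
    by (simp add: mult.assoc)
  also have "\<dots> \<approx> x_elem w * K (c * g) + x_elem (refl n i \<circ> w) * K (c * g) - x_elem w * K (rconst b * g)"
    by (intro c_diff c_add mult_right hcong_refl free_alg_mult cars K_carrier[OF cg] x_x_elem w i
        K_carrier[OF ratfuns_mult[OF rconst_R g]])
  finally show ?thesis .
qed

lemma TX_psi:
  assumes i: "i \<in> {1..n}" and G: "rational_vec G"
  shows "TX i * psi G \<approx> psi (T_op i G)"
proof -
  let ?a = "sroot n i"
  define b where "b = inverse (t_root ?a)"
  define A where "A u = c_root (u ?a) * G u" for u
  have GR: "G u \<in> R" if "u \<in> Wfin n" for u using G that by (simp add: rational_vec_def)
  have AR: "A u \<in> R" if "u \<in> Wfin n" for u unfolding A_def by (intro ratfuns_mult c_root_R GR that)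
  have W: "refl n i \<circ> w \<in> Wfin n" if "w \<in> Wfin n" for w using that i by (intro Wfin_comp Wfin_refl)
  have inv: "refl n i \<circ> (refl n i \<circ> w) = w" for w using i by (intro refl_comp_refl) simp
  have "TX i * psi G = (\<Sum>w\<in>Wfin n. TX i * (x_elem w * K (G (winv w))))"
    unfolding psi_def by (rule sum_distrib_left)
  also have "\<dots> \<approx> (\<Sum>w\<in>Wfin n. x_elem w * K (A (winv w)) + x_elem (refl n i \<circ> w) * K (A (winv w)) - x_elem w * K (rconst b * G (winv w)))"
    unfolding A_def b_def by (intro c_sum TX_term i GR inv_Wfin)
  also have "\<dots> = (\<Sum>w\<in>Wfin n. x_elem w * K (A (winv w))) + (\<Sum>w\<in>Wfin n. x_elem (refl n i \<circ> w) * K (A (winv w)))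
      - (\<Sum>w\<in>Wfin n. x_elem w * K (rconst b * G (winv w)))"
    by (simp add: sum.distrib sum_subtractf)
  \<comment> \<open>Substituting s_i w for w replaces u = w^{-1} by u s_i. The c-function at u s_i
    \<alpha>_i = - u \<alpha>_i is the second coefficient of \<open>T_op\<close>.\<close>
  also have "(\<Sum>w\<in>Wfin n. x_elem (refl n i \<circ> w) * K (A (winv w))) = (\<Sum>w\<in>Wfin n. x_elem w * K (A (winv w \<circ> refl n i)))"
  proof (rule sum.reindex_bij_witness[where i = "\<lambda>w. refl n i \<circ> w" and j = "\<lambda>w. refl n i \<circ> w"])
    fix w assume w: "w \<in> Wfin n"
    have "winv (refl n i \<circ> w) \<circ> refl n i = winv w"
      unfolding winv_comp_refl[OF w i] using i by (intro comp_refl_refl) simp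
    then show "x_elem (refl n i \<circ> w) * K (A (winv (refl n i \<circ> w) \<circ> refl n i)) = x_elem (refl n i \<circ> w) * K (A (winv w))"
      by (rule arg_cong)
  qed (simp_all only: inv W)
  also have "(\<Sum>w\<in>Wfin n. x_elem w * K (A (winv w))) + (\<Sum>w\<in>Wfin n. x_elem w * K (A (winv w \<circ> refl n i)))
      - (\<Sum>w\<in>Wfin n. x_elem w * K (rconst b * G (winv w)))
    = (\<Sum>w\<in>Wfin n. x_elem w * (K (A (winv w)) + K (A (winv w \<circ> refl n i)) - K (rconst b * G (winv w))))"
    by (simp add: sum.distrib sum_subtractf distrib_left right_diff_distrib)
  also have "\<dots> \<approx> (\<Sum>w\<in>Wfin n. x_elem w * K (T_op i G (winv w)))"
  proof (rule c_sum, rule mult_left)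
    fix w assume w: "w \<in> Wfin n"
    show "x_elem w \<in> C" by (rule x_elem_carrier[OF w])
    define u where "u = winv w"
    have u: "u \<in> Wfin n" unfolding u_def by (rule inv_Wfin[OF w])
    have us: "u \<circ> refl n i \<in> Wfin n" using u i by (intro Wfin_comp Wfin_refl)
    have bR: "rconst b * G u \<in> R" by (intro ratfuns_mult rconst_R GR u)
    have "K (A u) + K (A (u \<circ> refl n i)) - K (rconst b * G u) \<approx> K (A u + A (u \<circ> refl n i)) - K (rconst b * G u)"
      by (intro c_diff hcong_sym[OF K_add] AR u us hcong_refl K_carrier bR)
    also have "\<dots> \<approx> K (A u + A (u \<circ> refl n i) - rconst b * G u)"
      by (intro hcong_sym[OF K_diff] ratfuns_add AR u us bR)
    also have "A u + A (u \<circ> refl n i) - rconst b * G u = T_op i G u"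
      unfolding A_def T_op_apply c_root_comp_refl[OF u i] b_def rconst_inverse by (simp add: algebra_simps)
    finally show "K (A (winv w)) + K (A (winv w \<circ> refl n i)) - K (rconst b * G (winv w)) \<approx> K (T_op i G (winv w))"
      unfolding u_def .
  qed
  finally show ?thesis unfolding psi_def .
qed

lemma TX_word_psi:
  assumes "set js \<subseteq> {1..n}" "rational_vec G"
  shows "prod_list (map TX js) * psi G \<approx> psi (fold T_op (rev js) G)" "rational_vec (fold T_op (rev js) G)"
  using assms(1)
proof (induction js)
  case Nil
  {
    case 1 then show ?case using hcong_refl[OF psi_carrier[OF assms(2)]] by simp
  next
    case 2 then show ?case using assms(2) by simp
  }
next
  case (Cons i js)
  {
    case 1
    then have i: "i \<in> {1..n}" and js: "set js \<subseteq> {1..n}" by simp_all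
    have "prod_list (map TX (i # js)) * psi G = TX i * (prod_list (map TX js) * psi G)" by (simp add: mult.assoc)
    also have "\<dots> \<approx> TX i * psi (fold T_op (rev js) G)" by (intro mult_left TX_carrier i Cons.IH(1) js)
    also have "\<dots> \<approx> psi (T_op i (fold T_op (rev js) G))" by (intro TX_psi i Cons.IH(2) js)
    finally show ?case by simp
  next
    case 2
    then show ?case using rational_vec_T_op[of i] Cons.IH(2) by simp
  }
qed

lemma rational_vec_delta: "rational_vec delta"
proof -
  have "(0 :: KZ) \<in> R" "(1 :: KZ) \<in> R" using rconst_R[of 0] rconst_R[of 1] by simp_all
  then show ?thesis by (simp add: rational_vec_def delta_def)
qed

lemma psi_delta: "psi delta \<approx> 1"
proof -
  \<comment> \<open>The chosen word of the identity must be empty because the identity has no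
    inversions.\<close>
  have rid: "rword n id = []"
    using reduced_rword[OF Wfin_id, of n] by (simp only: reduced_word_iff inversions_id card.empty length_0_conv)
  have W: "x_elem w * K (delta (winv w)) \<approx> (if w = id then 1 else 0)" if w: "w \<in> Wfin n" for w
  proof (cases "w = id")
    case True
    have "delta (winv w) = rconst 1" unfolding True by (simp add: delta_def)
    moreover have "x_elem w = 1" unfolding True by (simp add: x_elem_def x_word_def rid)
    ultimately show ?thesis using K_const[of 1] True by simp
  next
    case False
    then have "winv w \<noteq> id" using winv_winv[OF w] by (metis inv_id)
    then have d: "delta (winv w) = rconst 0" by (simp add: delta_def)
    have "x_elem w * K (rconst 0) \<approx> x_elem w * scal 0" by (intro mult_left x_elem_carrier w K_const)
    then show ?thesis using False unfolding d by simp
  qed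
  have "psi delta \<approx> (\<Sum>w\<in>Wfin n. if w = id then 1 else 0)"
    unfolding psi_def by (intro c_sum W)
  then show ?thesis using finite_Wfin by simp
qed

text \<open>T_w acts on the vector of 1 with its last letter first, that is, along the reversed
  word. This is reduced for the inverse of w but may differ from the word chosen there, and
  Matsumoto's theorem reconciles the two.\<close>

lemma Tw_psi:
  assumes w: "w \<in> Wfin n" shows "Tw n w \<approx> psi (T_vec (winv w))"
proof -
  have car: "Tw n w \<in> C" unfolding Tw_def
    by (rule free_alg_prod_list) (use rword_set[OF w] TX_carrier in auto)
  have "Tw n w * 1 \<approx> Tw n w * psi delta" by (intro mult_left car hcong_sym[OF psi_delta])
  also have "\<dots> \<approx> psi (fold T_op (rev (rword n w)) delta)"
    unfolding Tw_def by (rule TX_word_psi(1)[OF rword_set[OF w] rational_vec_delta])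
  also have "psi (fold T_op (rev (rword n w)) delta) = psi (T_vec (winv w))"
    unfolding T_vec_def
    by (intro psi_eq_on_W T_op_reduced_words[OF reduced_word_rev[OF reduced_rword[OF w]] reduced_rword[OF inv_Wfin[OF w]]])
  finally show ?thesis by simp
qed

lemma scal_psi:
  assumes "rational_vec G" shows "scal c * psi G \<approx> psi (\<lambda>v. rconst c * G v)"
proof -
  have "scal c * psi G = (\<Sum>w\<in>Wfin n. x_elem w * (scal c * K (G (winv w))))"
    unfolding psi_def sum_distrib_left
    by (rule sum.cong) (simp_all add: scal_commute[of c "x_elem _"] flip: mult.assoc)
  also have "\<dots> \<approx> psi (\<lambda>v. rconst c * G v)"
    unfolding psi_def by (intro c_sum mult_left x_elem_carrier scal_K) (use assms inv_Wfin in \<open>auto simp: rational_vec_def\<close>)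
  finally show ?thesis .
qed

lemma ratfuns_sum: "(\<And>i. i \<in> I \<Longrightarrow> f i \<in> R) \<Longrightarrow> sum f I \<in> R"
  by (induction I rule: infinite_finite_induct) (use ratfuns_const[of 0] in \<open>auto intro!: ratfuns_add\<close>)

lemma K_sum: "(\<And>k. k \<in> I \<Longrightarrow> f k \<in> R) \<Longrightarrow> K (\<Sum>k\<in>I. f k) \<approx> (\<Sum>k\<in>I. K (f k))"
proof (induction I rule: infinite_finite_induct)
  case (insert a I)
  have "K (f a + sum f I) \<approx> K (f a) + K (sum f I)"
    using insert.prems by (intro K_add ratfuns_sum) auto
  also have "\<dots> \<approx> K (f a) + (\<Sum>k\<in>I. K (f k))"
    using insert by (intro c_add hcong_refl K_carrier) auto
  finally show ?case using insert.hyps by simp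
qed (use K_const[of 0] in simp_all)

lemma psi_sum:
  assumes "\<And>k. k \<in> I \<Longrightarrow> rational_vec (G k)" shows "(\<Sum>k\<in>I. psi (G k)) \<approx> psi (\<lambda>v. \<Sum>k\<in>I. G k v)"
proof -
  have "(\<Sum>k\<in>I. psi (G k)) = (\<Sum>w\<in>Wfin n. x_elem w * (\<Sum>k\<in>I. K (G k (winv w))))"
    unfolding psi_def sum_distrib_left by (rule sum.swap)
  also have "\<dots> \<approx> psi (\<lambda>v. \<Sum>k\<in>I. G k v)"
    unfolding psi_def by (intro c_sum mult_left x_elem_carrier hcong_sym[OF K_sum]) (use assms inv_Wfin in \<open>auto simp: rational_vec_def\<close>)
  finally show ?thesis .
qed

lemma rational_vec_T_vec: "v \<in> Wfin n \<Longrightarrow> rational_vec (T_vec v)"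
  using TX_word_psi(2)[of "rev (rword n v)", OF _ rational_vec_delta] rword_set[of v] by (simp add: T_vec_def)

lemma rational_vec_rconst_mult: "rational_vec G \<Longrightarrow> rational_vec (\<lambda>v. rconst c * G v)"
  unfolding rational_vec_def by (intro ballI ratfuns_mult rconst_R) blast

lemma chi_winv:
  assumes "w \<in> Wfin n" shows "chi n S (winv w) = chi n S w"
  unfolding chi_eq[OF inv_Wfin[OF assms]] chi_eq[OF assms]
  by (rule prod_list_map_rword_winv[where F = "\<lambda>i. chi_root S (sroot n i)", OF assms chi_root_Wfin])

lemma sgn_w_winv:
  assumes "w \<in> Wfin n" shows "sgn_w n S (winv w) = sgn_w n S w"
  unfolding sgn_w_eq[OF n inv_Wfin[OF assms]] sgn_w_eq[OF n assms]
  by (rule prod_list_map_rword_winv[where F = "\<lambda>i. root_sign n S (sroot n i)", OF assms])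
     (simp add: root_sign_def minus_type_Wfin[OF n])

lemma sum_chi_Tw: "(\<Sum>w\<in>Wfin n. scal (chi n S w) * Tw n w) \<approx> psi (S_vec S)"
proof -
  have "(\<Sum>w\<in>Wfin n. scal (chi n S w) * Tw n w) \<approx> (\<Sum>w\<in>Wfin n. scal (chi n S w) * psi (T_vec (winv w)))"
    by (intro c_sum mult_left free_alg_scal Tw_psi)
  also have "\<dots> \<approx> (\<Sum>w\<in>Wfin n. psi (\<lambda>v. rconst (chi n S w) * T_vec (winv w) v))"
    by (intro c_sum scal_psi rational_vec_T_vec inv_Wfin)
  also have "\<dots> \<approx> psi (\<lambda>v. \<Sum>w\<in>Wfin n. rconst (chi n S w) * T_vec (winv w) v)"
    by (intro psi_sum rational_vec_rconst_mult rational_vec_T_vec inv_Wfin)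
  also have "(\<lambda>v. \<Sum>w\<in>Wfin n. rconst (chi n S w) * T_vec (winv w) v) = S_vec S"
  proof
    fix v
    have "(\<Sum>w\<in>Wfin n. rconst (chi n S w) * T_vec (winv w) v) = (\<Sum>w\<in>Wfin n. rconst (chi n S (winv w)) * T_vec (winv w) v)"
      by (rule sum.cong) (simp_all add: chi_winv)
    also have "\<dots> = S_vec S v"
      unfolding S_vec_def by (rule sum.reindex_bij_betw[OF bij_betw_winv_Wfin])
    finally show "(\<Sum>w\<in>Wfin n. rconst (chi n S w) * T_vec (winv w) v) = S_vec S v" .
  qed
  finally show ?thesis .
qed

lemma rational_vec_S_vec: "rational_vec (S_vec S)"
  unfolding rational_vec_def S_vec_def
proof (intro ballI ratfuns_sum ratfuns_mult rconst_R)
  fix v w assume "v \<in> Wfin n" "w \<in> Wfin n"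
  then show "T_vec w v \<in> R" using rational_vec_T_vec by (simp add: rational_vec_def)
qed

lemma psi_S_vec:
  "psi (\<lambda>v. rconst (sgn_w n S (w0 n) * chi n Plus (w0 n) * inverse (chi n S (w0 n))) * S_vec S v) = psi (R_vec S)"
proof (rule psi_eq_on_W)
  show "eq_on_W (\<lambda>v. rconst (sgn_w n S (w0 n) * chi n Plus (w0 n) * inverse (chi n S (w0 n))) * S_vec S v) (R_vec S)"
    unfolding eq_on_W_def using S_vec_eq_R_vec by blast
qed

lemma hecke_sym_psi:
  "scal (sgn_w n S (w0 n) * chi n Plus (w0 n)) * hecke_sym n S \<approx> psi (R_vec S)"
proof -
  define c d e where "c = sgn_w n S (w0 n) * chi n Plus (w0 n)" and "d = inverse (chi n S (w0 n))" and "e = c * d"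
  have "scal c * hecke_sym n S = scal e * (\<Sum>w\<in>Wfin n. scal (chi n S w) * Tw n w)"
    by (simp only: hecke_sym_def e_def d_def scal_mult mult.assoc)
  also have "\<dots> \<approx> scal e * psi (S_vec S)" by (intro mult_left free_alg_scal sum_chi_Tw)
  also have "\<dots> \<approx> psi (\<lambda>v. rconst e * S_vec S v)" by (intro scal_psi rational_vec_S_vec)
  also have "psi (\<lambda>v. rconst e * S_vec S v) = psi (R_vec S)"
    unfolding e_def c_def d_def by (rule psi_S_vec)
  finally show ?thesis unfolding c_def .
qed

text \<open>Moving the left factor past x_w evaluates it at w^{-1}, the index used by
  \<open>psi\<close>; the sign may be read at w^{-1} as well.\<close>

lemma symmetrizer_psi:
  "K (Kminus S id) * (\<Sum>w\<in>Wfin n. scal (sgn_w n S w) * x_elem w) * K (Kplus S) \<approx> psi (R_vec S)"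
proof -
  note cars = K_carrier[OF Kminus_R] K_carrier[OF Kplus_R]
  have "K (Kminus S id) * (\<Sum>w\<in>Wfin n. scal (sgn_w n S w) * x_elem w) * K (Kplus S)
    = (\<Sum>w\<in>Wfin n. scal (sgn_w n S w) * (K (Kminus S id) * x_elem w) * K (Kplus S))"
    unfolding sum_distrib_left sum_distrib_right
    by (rule sum.cong) (simp_all only: mult.assoc[symmetric] scal_commute[of _ "K (Kminus S id)"])
  also have "\<dots> \<approx> (\<Sum>w\<in>Wfin n. x_elem w * K (R_vec S (winv w)))"
  proof (rule c_sum)
    fix w assume w: "w \<in> Wfin n"
    let ?s = "sgn_w n S w" and ?k = "Kminus S (winv w)"
    have "scal ?s * (K (Kminus S id) * x_elem w) * K (Kplus S) \<approx> scal ?s * (x_elem w * K ?k) * K (Kplus S)"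
      by (intro mult_right mult_left cars free_alg_scal x_elem_Kminus w)
    also have "\<dots> = x_elem w * (scal ?s * (K ?k * K (Kplus S)))"
      by (simp only: mult.assoc[symmetric] scal_commute[of ?s "x_elem w"])
    also have "\<dots> \<approx> x_elem w * (scal ?s * K (?k * Kplus S))"
      by (intro mult_left x_elem_carrier w free_alg_scal hcong_sym[OF K_mult] Kminus_R Kplus_R)
    also have "\<dots> \<approx> x_elem w * K (rconst ?s * (?k * Kplus S))"
      by (intro mult_left x_elem_carrier w scal_K ratfuns_mult Kminus_R Kplus_R)
    finally show "scal ?s * (K (Kminus S id) * x_elem w) * K (Kplus S) \<approx> x_elem w * K (R_vec S (winv w))"
      by (simp only: R_vec_def sgn_w_winv[OF w] mult.assoc)
  qed
  finally show ?thesis unfolding psi_def .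
qed

theorem hecke_sym_eq:
  "scal (sgn_w n S (w0 n) * chi n Plus (w0 n)) * hecke_sym n S \<approx>
    K (Kminus S id) * (\<Sum>w\<in>Wfin n. scal (sgn_w n S w) * prod_list (map x (rword n w))) * K (Kplus S)"
  using hcong_trans[OF hecke_sym_psi hcong_sym[OF symmetrizer_psi]] by (simp add: x_elem_def x_word_def)

end


section \<open>The four types, evaluated\<close>

context root_functions
begin

lemma minus_type_sets:
  "{\<beta> \<in> roots n. pos \<beta> \<and> minus_type n Plus \<beta>} = {}"
  "{\<beta> \<in> roots n. pos \<beta> \<and> \<not> minus_type n Plus \<beta>} = {\<beta> \<in> roots n. pos \<beta>}"
  "{\<beta> \<in> roots n. pos \<beta> \<and> minus_type n Minus \<beta>} = {\<beta> \<in> roots n. pos \<beta>}"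
  "{\<beta> \<in> roots n. pos \<beta> \<and> \<not> minus_type n Minus \<beta>} = {}"
  "{\<beta> \<in> roots n. pos \<beta> \<and> minus_type n PlusMinus \<beta>} = {\<beta> \<in> roots n. pos \<beta> \<and> \<beta> \<in> short_roots n}"
  "{\<beta> \<in> roots n. pos \<beta> \<and> \<not> minus_type n PlusMinus \<beta>} = {\<beta> \<in> roots n. pos \<beta> \<and> \<beta> \<in> long_roots n}"
  "{\<beta> \<in> roots n. pos \<beta> \<and> minus_type n MinusPlus \<beta>} = {\<beta> \<in> roots n. pos \<beta> \<and> \<beta> \<in> long_roots n}"
  "{\<beta> \<in> roots n. pos \<beta> \<and> \<not> minus_type n MinusPlus \<beta>} = {\<beta> \<in> roots n. pos \<beta> \<and> \<beta> \<in> short_roots n}"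
  using short_long_disjoint by (auto simp: minus_type_def roots_def)

lemma prod_positive_roots:
  "(\<Prod>\<beta>\<in>{\<beta> \<in> roots n. pos \<beta>}. f \<beta>) =
    (\<Prod>\<beta>\<in>{\<beta> \<in> roots n. pos \<beta> \<and> \<beta> \<in> long_roots n}. f \<beta>) *
    (\<Prod>\<beta>\<in>{\<beta> \<in> roots n. pos \<beta> \<and> \<beta> \<in> short_roots n}. f \<beta>)"
proof -
  have eq: "{\<beta> \<in> roots n. pos \<beta>} = {\<beta> \<in> roots n. pos \<beta> \<and> \<beta> \<in> long_roots n} \<union> {\<beta> \<in> roots n. pos \<beta> \<and> \<beta> \<in> short_roots n}"
    by (auto simp: roots_def)
  show ?thesis unfolding eq by (rule prod.union_disjoint) (use short_long_disjoint in auto)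
qed

abbreviation zinv :: "nat \<Rightarrow> KZ" where
  "zinv \<equiv> \<lambda>i. inverse (z i)"

lemma Kplus_eq:
  "Kplus Plus = kap_st n z * kap_dr z" "Kplus Minus = 1"
  "Kplus PlusMinus = kap_st n z" "Kplus MinusPlus = kap_dr z"
  unfolding Kplus_def minus_type_sets prod_positive_roots prod_kappa_root_short prod_kappa_root_long by simp_all

lemma Kminus_eq:
  "Kminus Plus id = 1" "Kminus Minus id = kap_st n zinv * kap_dr zinv"
  "Kminus PlusMinus id = kap_dr zinv" "Kminus MinusPlus id = kap_st n zinv"
  unfolding Kminus_def minus_type_sets id_apply prod_positive_roots prod_kappa_root_short prod_kappa_root_long by simp_all

text \<open>The long positive roots come in pairs \<epsilon>_i \<plusminus> \<epsilon>_j of equal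
  sign and contribute 1. Only the n short positive roots can leave a sign.\<close>

lemma sgn_w_w0: "sgn_w n S (w0 n) = (if S \<in> {PlusMinus, Minus} then (- 1) ^ n else 1)"
proof -
  have w0: "w0 n \<in> Wfin n" using negation_Wfin by (simp add: w0_eq)
  have "root_sign n S (long_vec i j 1 (- 1)) = root_sign n S (long_vec i j 1 1)" if "1 \<le> i" "i < j" "j \<le> n" for i j
    using that short_long_disjoint[of "long_vec i j 1 1" n] short_long_disjoint[of "long_vec i j 1 (- 1)" n]
    by (auto simp: root_sign_def minus_type_def long_rootsI)
  moreover have "root_sign n S \<beta> * root_sign n S \<beta> = 1" for \<beta> by (simp add: root_sign_def)
  ultimately have "(\<Prod>(i, j)\<in>{(i, j). 1 \<le> i \<and> i < j \<and> j \<le> n}. root_sign n S (long_vec i j 1 (- 1)) * root_sign n S (long_vec i j 1 1)) = 1"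
    by (intro prod.neutral) auto
  moreover have "(\<Prod>i=1..n. root_sign n S (short_vec i 1)) = (\<Prod>i=1..n. if S \<in> {PlusMinus, Minus} then - 1 else 1)"
    by (rule prod.cong) (simp_all add: root_sign_def minus_type_def short_rootsI)
  ultimately show ?thesis
    unfolding sgn_w_eq[OF n w0] inversions_w0 prod_positive_roots prod_positive_short_roots prod_positive_long_roots
    by simp
qed

end

context hecke_side
begin

definition e_sym :: "sym_type \<Rightarrow> dfree" where
  "e_sym S = (\<Sum>w\<in>Wfin n. scal (sgn_w n S w) * prod_list (map x (rword n w)))"

lemma e_sym_carrier: "e_sym S \<in> C"
proof -
  have "prod_list (map x (rword n w)) \<in> C" if "w \<in> Wfin n" for w
    using x_elem_carrier[OF that] by (simp only: x_elem_def x_word_def)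
  then show ?thesis unfolding e_sym_def by (intro free_alg_sum free_alg_mult free_alg_scal)
qed

lemma kap_R: "kap_dr z \<in> R" "kap_st n z \<in> R" "kap_dr zinv \<in> R" "kap_st n zinv \<in> R"
  unfolding prod_kappa_root_short[symmetric] prod_kappa_root_long[symmetric] by (intro ratfuns_prod kappa_root_R)+

lemma K_1: "K 1 \<approx> 1"
  using K_const[of 1] by simp

lemma hecke_sym_Plus:
  "scal (chi n Plus (w0 n)) * hecke_sym n Plus \<approx> e_sym Plus * K (kap_st n z) * K (kap_dr z)"
proof -
  have "scal (chi n Plus (w0 n)) * hecke_sym n Plus \<approx> K 1 * e_sym Plus * K (kap_st n z * kap_dr z)"
    using hecke_sym_eq[of Plus] unfolding e_sym_def[symmetric] Kplus_eq Kminus_eq by (simp add: sgn_w_w0)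
  also have "\<dots> \<approx> 1 * e_sym Plus * (K (kap_st n z) * K (kap_dr z))"
    by (intro c_mult K_1 hcong_refl e_sym_carrier K_mult kap_R)
  finally show ?thesis by (simp add: mult.assoc)
qed

lemma hecke_sym_Minus:
  "scal ((- 1) ^ n * chi n Plus (w0 n)) * hecke_sym n Minus \<approx> K (kap_st n zinv) * K (kap_dr zinv) * e_sym Minus"
proof -
  have "scal ((- 1) ^ n * chi n Plus (w0 n)) * hecke_sym n Minus \<approx> K (kap_st n zinv * kap_dr zinv) * e_sym Minus * K 1"
    using hecke_sym_eq[of Minus] unfolding e_sym_def[symmetric] Kplus_eq Kminus_eq by (simp add: sgn_w_w0)
  also have "\<dots> \<approx> K (kap_st n zinv) * K (kap_dr zinv) * e_sym Minus * 1"
    by (intro c_mult K_1 hcong_refl e_sym_carrier K_mult kap_R)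
  finally show ?thesis by simp
qed

lemma hecke_sym_PlusMinus:
  "scal ((- 1) ^ n * chi n Plus (w0 n)) * hecke_sym n PlusMinus \<approx> K (kap_dr zinv) * e_sym PlusMinus * K (kap_st n z)"
  using hecke_sym_eq[of PlusMinus] unfolding e_sym_def[symmetric] Kplus_eq Kminus_eq by (simp add: sgn_w_w0)

lemma hecke_sym_MinusPlus:
  "scal (chi n Plus (w0 n)) * hecke_sym n MinusPlus \<approx> K (kap_st n zinv) * e_sym MinusPlus * K (kap_dr z)"
  using hecke_sym_eq[of MinusPlus] unfolding e_sym_def[symmetric] Kplus_eq Kminus_eq by (simp add: sgn_w_w0)

end

section \<open>The instances for X and Y, and the conclusion\<close>

lemma root_coord_outside:
  assumes "\<beta> \<in> roots n" "k \<notin> {1..n}" shows "\<beta> k = 0"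
  using assms by (auto simp: roots_def short_roots_def long_roots_def short_vec_def long_vec_def)

lemma root_lattice: "\<beta> \<in> roots n \<Longrightarrow> \<beta> \<in> lattice n"
  using root_coord_outside by (auto simp: lattice_def)

lemma Ymon_root: "\<beta> \<in> roots n \<Longrightarrow> Ymon n \<beta> = monomial n rvar \<beta>"
  using root_coord_outside[of \<beta> n 0] by (simp add: Ymon_def monomial_def)

lemma Xmon_root: "\<beta> \<in> roots n \<Longrightarrow> Xmon n (- \<beta>) = monomial n rinv \<beta>"
  using root_coord_outside[of \<beta> n 0] by (simp add: Xmon_def monomial_rinv) (simp add: monomial_def)

lemma braid_relations:
  assumes n: "1 \<le> n" and rel: "\<And>a b. braid n s a b \<Longrightarrow> hcong n a b"
  shows "1 \<le> i \<Longrightarrow> i + 2 \<le> j \<Longrightarrow> j \<le> n \<Longrightarrow> hcong n (s i * s j) (s j * s i)"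
    "1 \<le> i \<Longrightarrow> i + 1 < n \<Longrightarrow> hcong n (s i * s (i + 1) * s i) (s (i + 1) * s i * s (i + 1))"
    "1 \<le> i \<Longrightarrow> i + 1 = n \<Longrightarrow> hcong n (s i * s n * s i * s n) (s n * s i * s n * s i)"
proof -
  show "1 \<le> i \<Longrightarrow> i + 2 \<le> j \<Longrightarrow> j \<le> n \<Longrightarrow> hcong n (s i * s j) (s j * s i)"
    by (intro rel braid.commute)
  show "1 \<le> i \<Longrightarrow> i + 1 < n \<Longrightarrow> hcong n (s i * s (i + 1) * s i) (s (i + 1) * s i * s (i + 1))"
    by (intro rel braid.single_bond)
  assume i: "1 \<le> i" "i + 1 = n"
  have "braid n s (s i * s (i + 1) * s i * s (i + 1)) (s (i + 1) * s i * s (i + 1) * s i)"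
    by (rule braid.double_bond) (use i in auto)
  from rel[OF this] show "hcong n (s i * s n * s i * s n) (s n * s i * s n * s i)" unfolding i(2) .
qed

lemma root_functions_X: "1 \<le> n \<Longrightarrow> root_functions n rinv unh"
  by unfold_locales simp_all

lemma root_functions_Y: "1 \<le> n \<Longrightarrow> root_functions n rvar t0h"
  by unfold_locales simp_all

text \<open>The c-functions are given in X^{-\<alpha>}, so the variables are the inverses of the
  X_i, and the relation between \<xi>_i and X is applied to negatives of roots.\<close>

lemma hecke_side_X:
  assumes n: "1 \<le> n" shows "hecke_side n rinv unh KX xi"
proof -
  interpret root_functions n rinv unh by (rule root_functions_X[OF n])
  note d = hcong_drel[OF n]
  show ?thesis
  proof (intro hecke_side.intro hecke_side_axioms.intro root_functions_X[OF n])
    fix i assume i: "i \<in> {1..n}"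
    then have i': "i \<le> n" by simp
    show "xi i \<in> carrier (dfree_alg n)" using i by (intro free_alg_gen) (auto simp: dgens_def)
    show "hcong n (xi i * xi i) 1" by (intro d xi_invol i')
    have "cXinv n i = c_root (sroot n i)"
    proof (cases "i = n")
      case True
      then show ?thesis using n Xmon_root[OF sroot_roots[OF i]] t_root_short[OF sroot_short[OF n]]
        by (simp add: cXinv_def cfun_eq_c_quot c_root_def tr_def ur_def)
    next
      case False
      then have "sroot n i \<in> long_roots n" using i by (intro sroot_long) auto
      then show ?thesis using i False Xmon_root[OF sroot_roots[OF i]] t_root_long[of "sroot n i"]
        by (simp add: cXinv_def cfun_eq_c_quot c_root_def tr_def ur_def)
    qed
    moreover have "tr n i = t_root (sroot n i)"
      using i sroot_short[OF n] t_root_short[of "sroot n n"] t_root_long[OF sroot_long[of i n]] by (auto simp: tr_def)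
    ultimately show "hcong n (TX i + scal (inverse (t_root (sroot n i)))) ((1 + xi i) * KX (c_root (sroot n i)))"
      using d[OF TX_xi[OF i']] by simp
    fix \<beta> assume b: "\<beta> \<in> roots n"
    have "refl n i (- \<beta>) = - refl n i \<beta>" using Wfin_uminus[OF Wfin_refl[OF i]] .
    then show "hcong n (xi i * KX (monomial n rinv \<beta>)) (KX (monomial n rinv (refl n i \<beta>)) * xi i)"
      using d[OF xi_X[OF i' root_lattice[OF uminus_roots[OF b]]]]
      by (simp add: Xmon_root b Wfin_roots[OF Wfin_refl[OF i]])
  next
    fix f :: KZ assume "f \<in> ratfuns {1..n}"
    then show "KX f \<in> carrier (dfree_alg n)" by (intro free_alg_gen) (auto simp: dgens_def)
  qed (rule braid_relations[where s = xi, OF n d[OF xi_braid]] d[OF X_const] d[OF X_add] d[OF X_mult]; assumption)+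
qed

text \<open>The relation with \<eta>_i is given for the letter of the coroot. The identification of
  the two letters at nodes 1 to n transfers it to \<open>TX i\<close>.\<close>

lemma hecke_side_Y:
  assumes n: "1 \<le> n" shows "hecke_side n rvar t0h KY eta"
proof -
  interpret root_functions n rvar t0h by (rule root_functions_Y[OF n])
  note d = hcong_drel[OF n]
  show ?thesis
  proof (intro hecke_side.intro hecke_side_axioms.intro root_functions_Y[OF n])
    fix i assume i: "i \<in> {1..n}"
    then have i': "i \<le> n" "1 \<le> i" by simp_all
    show "eta i \<in> carrier (dfree_alg n)" using i by (intro free_alg_gen) (auto simp: dgens_def)
    show "hcong n (eta i * eta i) 1" by (intro d eta_invol i')
    have "cY n i = c_root (sroot n i)"
    proof (cases "i = n")
      case True
      then show ?thesis using n Ymon_root[OF sroot_roots[OF i]] t_root_short[OF sroot_short[OF n]]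
        by (simp add: cY_def cfun_eq_c_quot c_root_def tc_def uc_def)
    next
      case False
      then have "sroot n i \<in> long_roots n" using i by (intro sroot_long) auto
      then show ?thesis using i False Ymon_root[OF sroot_roots[OF i]] t_root_long[of "sroot n i"]
        by (simp add: cY_def cfun_eq_c_quot c_root_def tc_def uc_def)
    qed
    moreover have "tc n i = t_root (sroot n i)"
      using i sroot_short[OF n] t_root_short[of "sroot n n"] t_root_long[OF sroot_long[of i n]] by (auto simp: tc_def)
    moreover have "hcong n (TX i + scal (inverse (tc n i))) (TY i + scal (inverse (tc n i)))"
      by (intro hcong_add[OF n] d TX_TY i' hcong_refl free_alg_scal)
    ultimately show "hcong n (TX i + scal (inverse (t_root (sroot n i)))) ((1 + eta i) * KY (c_root (sroot n i)))"
      using hcong_trans[OF _ d[OF TY_eta[OF i'(1)]]] by simp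
    fix \<beta> assume b: "\<beta> \<in> roots n"
    show "hcong n (eta i * KY (monomial n rvar \<beta>)) (KY (monomial n rvar (refl n i \<beta>)) * eta i)"
      using d[OF eta_Y[OF i'(1) root_lattice[OF b]]]
      by (simp add: Ymon_root b Wfin_roots[OF Wfin_refl[OF i]])
  next
    fix f :: KZ assume "f \<in> ratfuns {1..n}"
    then show "KY f \<in> carrier (dfree_alg n)" by (intro free_alg_gen) (auto simp: dgens_def)
  qed (rule braid_relations[where s = eta, OF n d[OF eta_braid]] d[OF Y_const] d[OF Y_add] d[OF Y_mult]; assumption)+
qed

theorem proposition2p3:
  fixes n :: nat
  assumes "n \<ge> 1"
  shows
    "hcls n (scal (chi n Plus (w0 n)) * hecke_sym n Plus)
       = hcls n (eX n Plus * KX (kap_st n rinv) * KX (kap_dr_X n rinv))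
     \<and> hcls n (eX n Plus * KX (kap_st n rinv) * KX (kap_dr_X n rinv))
       = hcls n (eY n Plus * KY (kap_st n rvar) * KY (kap_dr_Y n rvar))
     \<and> hcls n (scal ((-1) ^ n * chi n Plus (w0 n)) * hecke_sym n Minus)
       = hcls n (KX (kap_st n rvar) * KX (kap_dr_X n rvar) * eX n Minus)
     \<and> hcls n (KX (kap_st n rvar) * KX (kap_dr_X n rvar) * eX n Minus)
       = hcls n (KY (kap_st n rinv) * KY (kap_dr_Y n rinv) * eY n Minus)
     \<and> hcls n (scal ((-1) ^ n * chi n Plus (w0 n)) * hecke_sym n PlusMinus)
       = hcls n (KX (kap_dr_X n rvar) * eX n PlusMinus * KX (kap_st n rinv))
     \<and> hcls n (KX (kap_dr_X n rvar) * eX n PlusMinus * KX (kap_st n rinv))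
       = hcls n (KY (kap_dr_Y n rinv) * eY n PlusMinus * KY (kap_st n rvar))
     \<and> hcls n (scal (chi n Plus (w0 n)) * hecke_sym n MinusPlus)
       = hcls n (KX (kap_st n rvar) * eX n MinusPlus * KX (kap_dr_X n rinv))
     \<and> hcls n (KX (kap_st n rvar) * eX n MinusPlus * KX (kap_dr_X n rinv))
       = hcls n (KY (kap_st n rinv) * eY n MinusPlus * KY (kap_dr_Y n rvar))"
proof -
  interpret X: hecke_side n rinv unh KX xi by (rule hecke_side_X[OF assms])
  interpret Y: hecke_side n rvar t0h KY eta by (rule hecke_side_Y[OF assms])
  have inv: "(\<lambda>i. inverse (rvar i)) = rinv" "(\<lambda>i. inverse (rinv i)) = rvar"
    by (simp_all add: rinv_def fun_eq_iff)
  have e: "X.e_sym = eX n" "Y.e_sym = eY n"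
    by (simp_all add: fun_eq_iff X.e_sym_def Y.e_sym_def eX_def eY_def xiw_def etaw_def)
  have k: "X.kap_dr = kap_dr_X n" "Y.kap_dr = kap_dr_Y n"
    by (simp_all add: fun_eq_iff X.kap_dr_def Y.kap_dr_def kap_dr_X_def kap_dr_Y_def)
  note X = X.hecke_sym_Plus X.hecke_sym_Minus X.hecke_sym_PlusMinus X.hecke_sym_MinusPlus
  note Y = Y.hecke_sym_Plus Y.hecke_sym_Minus Y.hecke_sym_PlusMinus Y.hecke_sym_MinusPlus
  \<comment> \<open>For each type the X- and the Y-expression are both congruent to the same
    multiple of the Hecke symmetrizer, which links them to each other.\<close>
  show ?thesis
    using X Y unfolding inv e k hcong_def by simp
qed
end
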